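(* Let $M^7=\mathbb{R}\times N^6$, where $N$ is a Calabi–Yau 3-fold with Ricci-flat Kähler metric $\check g$, Kähler form $\omega$ and holomorphic volume form $\Omega$, and let $M$ be equipped with the standard torsion-free product $\mathrm{G}_2$-structure $\overline{\varphi}=\operatorname{Re}(\Omega)-dr\wedge\omega$, which induces the product metric $g=dr^2+\check g$. Consider isometric solitons $(\varphi,Y,c)$ with $\varphi=\varphi(f,X)$ in the isometry class of $\overline{\varphi}$ and of the special form $$X=a(r)\frac{\partial}{\partial r},\qquad Y=b(r)\frac{\partial}{\partial r}.$$ The only such solitons are steady (i.e. $c=0$), and are given by $$a(r)=\sin(c_0+c_1e^{br})\quad\text{and}\quad b(r)=b$$ for constants $b,c_0,c_1$. Moreover (for $b\neq0$ and $c_1\neq0$), the pointwise norm $|T|$ of the torsion of this solution goes to zero at one end of $\mathbb{R}$ and becomes unbounded at the other end.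
   Context: Calabi–Yau 3-fold: $(N^6,\check g,\mathrm{J},\omega,\Omega)$ with $\mathrm{J}$ an integrable $\check g$-compatible complex structure, $\omega(\cdot,\cdot)=\check g(\mathrm{J}\cdot,\cdot)$, $\Omega$ a nowhere vanishing $(3,0)$-form, $\mathrm{vol}_{\check g}=\frac16\omega^3=\frac{i}{8}\Omega\wedge\overline{\Omega}$, $d\omega=0$, $d\Omega=0$. The coordinate on the factor $\mathbb{R}$ of $M$ is $r$. A $\mathrm{G}_2$-structure $\varphi$ on a 7-manifold induces a Riemannian metric $g$, an orientation, and $\psi=\star\varphi$; the sign convention is $\varphi_{ijk}\varphi_{abk}=\delta_{ia}\delta_{jb}-\delta_{ib}\delta_{ja}-\psi_{ijab}$ in local orthonormal frames (repeated indices summed). With $\nabla$ the Levi-Civita connection, the torsion $T_{pq}$ is defined by $\nabla_p\varphi_{ijk}=T_{pq}\psi_{qijk}$. Set $(\operatorname{div}T)_k=\nabla_iT_{ik}$, $(Y\lrcorner T)_k=Y_pT_{pk}$, $(\operatorname{curl}_\varphi Y)_k=\nabla_iY_j\varphi_{ijk}$. The isometry class of $\overline{\varphi}$ (all $\mathrm{G}_2$-structures inducing the same metric) consists of $$\varphi(f,X)=(f^2-|X|^2)\overline{\varphi}-2f\,X\lrcorner\overline{\psi}+2X^\flat\wedge(X\lrcorner\overline{\varphi}),$$ where $\overline{\psi}=\star\overline{\varphi}$, $f$ is a smooth function and $X$ a smooth vector field with $f^2+|X|^2=1$ (the pair is unique up to overall sign). Here $f=f(r)$ and $f^2=1-a^2$.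 An isometric soliton is a triple $(\varphi,Y,c)$, $Y$ a vector field and $c\in\mathbb{R}$, with $\mathcal{L}_Yg=2c\,g$ and $\operatorname{div}T=-\frac12\operatorname{curl}_\varphi Y+Y\lrcorner T$, where $T$ is the torsion of $\varphi$. It is steady if $c=0$.
   Formalization: For b = 0 the stated family gives only constant a, but a = sin(c0 + c1 r) with Y = 0 is also a soliton (e.g. a = sin r, f = cos r), so the classification here adds a(r) = sin(c0 + c1 r) when b = 0. *)

theory Defs
  imports "HOL-Analysis.Analysis"
begin

section \<open>Smooth manifolds and tensor fields\<close>

primrec k_smooth_on ::
  "nat \<Rightarrow> 'a::real_normed_vector set \<Rightarrow> ('a \<Rightarrow> 'b::real_normed_vector) \<Rightarrow> bool" where
  "k_smooth_on 0 S f \<longleftrightarrow> continuous_on S f"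
| "k_smooth_on (Suc k) S f \<longleftrightarrow> (\<forall>x\<in>S. f differentiable (at x)) \<and>
     (\<forall>v. k_smooth_on k S (\<lambda>x. frechet_derivative f (at x) v))"

definition smooth_on ::
  "'a::real_normed_vector set \<Rightarrow> ('a \<Rightarrow> 'b::real_normed_vector) \<Rightarrow> bool" where
  "smooth_on S f \<longleftrightarrow> (\<forall>k. k_smooth_on k S f)"

text \<open>A chart is a pair of a domain and a coordinate map (whose values outside the domain are
  irrelevant). An atlas is a family of charts indexed by a type \<open>'i\<close>; the underlying set of the
  manifold is the whole type \<open>'m\<close>.\<close>

type_synonym ('m, 'e) chart = "'m set \<times> ('m \<Rightarrow> 'e)"

definition coord_image :: "('i \<Rightarrow> ('m, 'e) chart) \<Rightarrow> 'i \<Rightarrow> 'e set" where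
  "coord_image C i = snd (C i) ` fst (C i)"

definition coord_overlap :: "('i \<Rightarrow> ('m, 'e) chart) \<Rightarrow> 'i \<Rightarrow> 'i \<Rightarrow> 'e set" where
  "coord_overlap C i j = snd (C i) ` (fst (C i) \<inter> fst (C j))"

definition transition :: "('i \<Rightarrow> ('m, 'e) chart) \<Rightarrow> 'i \<Rightarrow> 'i \<Rightarrow> 'e \<Rightarrow> 'e" where
  "transition C i j = snd (C j) \<circ> inv_into (fst (C i)) (snd (C i))"

definition atlas ::
  "('i \<Rightarrow> ('m::{t2_space,second_countable_topology}, 'e::euclidean_space) chart) \<Rightarrow> bool" where
  "atlas C \<longleftrightarrow>
     (\<Union>i. fst (C i)) = UNIV \<and>
     (\<forall>i. open (fst (C i)) \<and> open (coord_image C i) \<and>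
        (\<exists>h. homeomorphism (fst (C i)) (coord_image C i) (snd (C i)) h)) \<and>
     (\<forall>i j. smooth_on (coord_overlap C i j) (transition C i j))"

definition multilinear :: "nat \<Rightarrow> ('e::real_vector list \<Rightarrow> 'a::real_vector) \<Rightarrow> bool" where
  "multilinear k F \<longleftrightarrow> (\<forall>vs j. length vs = k \<longrightarrow> j < k \<longrightarrow> linear (\<lambda>v. F (vs[j := v])))"

definition alternating :: "nat \<Rightarrow> ('e list \<Rightarrow> 'a::zero) \<Rightarrow> bool" where
  "alternating k F \<longleftrightarrow> (\<forall>vs. length vs = k \<longrightarrow> \<not> distinct vs \<longrightarrow> F vs = 0)"

text \<open>A covariant tensor field is given by its local representatives: \<open>\<alpha> i x [v\<^sub>1,\<dots>,v\<^sub>k]\<close> is its value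
  at the point with coordinates \<open>x\<close> in the chart \<open>i\<close>, on the tangent vectors with components
  \<open>v\<^sub>1,\<dots>,v\<^sub>k\<close>. Only arguments with \<open>x\<close> in the image of the chart and lists of length \<open>k\<close> matter.\<close>

type_synonym ('i, 'e, 'a) tensor = "'i \<Rightarrow> 'e \<Rightarrow> 'e list \<Rightarrow> 'a"

definition tensor_field ::
  "('i \<Rightarrow> ('m, 'e::euclidean_space) chart) \<Rightarrow> nat \<Rightarrow> ('i, 'e, 'a::real_normed_vector) tensor \<Rightarrow> bool" where
  "tensor_field C k \<alpha> \<longleftrightarrow>
     (\<forall>i. (\<forall>x\<in>coord_image C i. multilinear k (\<alpha> i x)) \<and>
          (\<forall>vs. length vs = k \<longrightarrow> smooth_on (coord_image C i) (\<lambda>x. \<alpha> i x vs))) \<and>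
     (\<forall>i j. \<forall>x\<in>coord_overlap C i j. \<forall>vs. length vs = k \<longrightarrow>
        \<alpha> i x vs =
        \<alpha> j (transition C i j x) (map (frechet_derivative (transition C i j) (at x)) vs))"

definition form_field ::
  "('i \<Rightarrow> ('m, 'e::euclidean_space) chart) \<Rightarrow> nat \<Rightarrow> ('i, 'e, 'a::real_normed_vector) tensor \<Rightarrow> bool" where
  "form_field C k \<alpha> \<longleftrightarrow>
     tensor_field C k \<alpha> \<and> (\<forall>i. \<forall>x\<in>coord_image C i. alternating k (\<alpha> i x))"

definition vector_field ::
  "('i \<Rightarrow> ('m, 'e::euclidean_space) chart) \<Rightarrow> ('i \<Rightarrow> 'e \<Rightarrow> 'e) \<Rightarrow> bool" where
  "vector_field C Y \<longleftrightarrow>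
     (\<forall>i. smooth_on (coord_image C i) (Y i)) \<and>
     (\<forall>i j. \<forall>x\<in>coord_overlap C i j.
        Y j (transition C i j x) = frechet_derivative (transition C i j) (at x) (Y i x))"

definition endomorphism_field ::
  "('i \<Rightarrow> ('m, 'e::euclidean_space) chart) \<Rightarrow> ('i \<Rightarrow> 'e \<Rightarrow> 'e \<Rightarrow> 'e) \<Rightarrow> bool" where
  "endomorphism_field C J \<longleftrightarrow>
     (\<forall>i. (\<forall>x\<in>coord_image C i. linear (J i x)) \<and>
          (\<forall>v. smooth_on (coord_image C i) (\<lambda>x. J i x v))) \<and>
     (\<forall>i j. \<forall>x\<in>coord_overlap C i j. \<forall>v.
        J j (transition C i j x) (frechet_derivative (transition C i j) (at x) v) =
        frechet_derivative (transition C i j) (at x) (J i x v))"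

text \<open>The value at a point of the manifold of a scalar given by local representatives.\<close>

definition scalar_at ::
  "('i \<Rightarrow> ('m, 'e) chart) \<Rightarrow> ('i \<Rightarrow> 'e \<Rightarrow> real) \<Rightarrow> 'm \<Rightarrow> real" where
  "scalar_at C h m = (THE s. \<forall>i. m \<in> fst (C i) \<longrightarrow> h i (snd (C i) m) = s)"


section \<open>Exterior calculus\<close>

text \<open>Wedge product of a \<open>k\<close>-form \<open>\<alpha>\<close> with a form \<open>\<beta>\<close>, as a sum over shuffles (so that
  \<open>(\<alpha> \<and> \<beta>)(u, v) = \<alpha> u \<beta> v - \<alpha> v \<beta> u\<close> for 1-forms): \<open>S\<close> is the set of positions of the arguments
  given to \<open>\<alpha>\<close>, and the degree of \<open>\<beta>\<close> is \<open>length vs - k\<close>.\<close>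

definition shuffle_sign :: "nat \<Rightarrow> nat set \<Rightarrow> 'a::comm_ring_1" where
  "shuffle_sign n S = (- 1) ^ card {(s, t). s \<in> S \<and> t \<in> {..<n} - S \<and> t < s}"

definition wedge ::
  "nat \<Rightarrow> ('e list \<Rightarrow> 'a::comm_ring_1) \<Rightarrow> ('e list \<Rightarrow> 'a) \<Rightarrow> 'e list \<Rightarrow> 'a" where
  "wedge k \<alpha> \<beta> vs =
     (\<Sum>S | S \<subseteq> {..<length vs} \<and> card S = k.
        shuffle_sign (length vs) S * \<alpha> (nths vs S) * \<beta> (nths vs (- S)))"

definition interior :: "'e \<Rightarrow> ('e list \<Rightarrow> 'a) \<Rightarrow> 'e list \<Rightarrow> 'a" where
  "interior v \<alpha> vs = \<alpha> (v # vs)"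

text \<open>The exterior derivative in coordinates, evaluated on vectors with constant components.\<close>

definition ext_deriv ::
  "('e::real_normed_vector \<Rightarrow> 'e list \<Rightarrow> 'a::real_normed_field) \<Rightarrow> 'e \<Rightarrow> 'e list \<Rightarrow> 'a" where
  "ext_deriv \<alpha> x vs =
     (\<Sum>k<length vs. (- 1) ^ k *
        frechet_derivative (\<lambda>y. \<alpha> y (take k vs @ drop (Suc k) vs)) (at x) (vs ! k))"

definition closed_form ::
  "('i \<Rightarrow> ('m, 'e::euclidean_space) chart) \<Rightarrow> nat \<Rightarrow> ('i, 'e, 'a::real_normed_field) tensor \<Rightarrow> bool" where
  "closed_form C k \<alpha> \<longleftrightarrow>
     (\<forall>i. \<forall>x\<in>coord_image C i. \<forall>vs. length vs = Suc k \<longrightarrow> ext_deriv (\<alpha> i) x vs = 0)"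

text \<open>The Lie derivative along \<open>Y\<close>, in coordinates, on vectors with constant components.\<close>

definition lie_derivative ::
  "('e::real_normed_vector \<Rightarrow> 'e) \<Rightarrow> ('e \<Rightarrow> 'e list \<Rightarrow> real) \<Rightarrow> 'e \<Rightarrow> 'e list \<Rightarrow> real" where
  "lie_derivative Y \<alpha> x vs =
     frechet_derivative (\<lambda>y. \<alpha> y vs) (at x) (Y x) +
     (\<Sum>k<length vs. \<alpha> x (vs[k := frechet_derivative Y (at x) (vs ! k)]))"

definition lie_bracket ::
  "('e::real_normed_vector \<Rightarrow> 'e) \<Rightarrow> ('e \<Rightarrow> 'e) \<Rightarrow> 'e \<Rightarrow> 'e" where
  "lie_bracket X Y x = frechet_derivative Y (at x) (X x) - frechet_derivative X (at x) (Y x)"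


section \<open>Riemannian geometry\<close>

definition riemannian_metric ::
  "('i \<Rightarrow> ('m, 'e::euclidean_space) chart) \<Rightarrow> ('i, 'e, real) tensor \<Rightarrow> bool" where
  "riemannian_metric C g \<longleftrightarrow> tensor_field C 2 g \<and>
     (\<forall>i. \<forall>x\<in>coord_image C i.
        (\<forall>u v. g i x [u, v] = g i x [v, u]) \<and> (\<forall>v. v \<noteq> 0 \<longrightarrow> g i x [v, v] > 0))"

definition orthonormal_frame :: "('e::euclidean_space list \<Rightarrow> real) \<Rightarrow> 'e list \<Rightarrow> bool" where
  "orthonormal_frame G es \<longleftrightarrow> length es = DIM('e) \<and>
     (\<forall>p<DIM('e). \<forall>q<DIM('e). G [es ! p, es ! q] = (if p = q then 1 else 0))"

text \<open>A chosen orthonormal basis of the tangent space with inner product \<open>G\<close>; contractions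
  (repeated indices) are sums over it. They do not depend on the choice.\<close>

definition onb :: "('e::euclidean_space list \<Rightarrow> real) \<Rightarrow> 'e set" where
  "onb G = set (SOME es. orthonormal_frame G es)"

text \<open>A Riemannian volume form: the one of \<open>g\<close> for some orientation.\<close>

definition volume_form ::
  "('i \<Rightarrow> ('m, 'e::euclidean_space) chart) \<Rightarrow> ('i, 'e, real) tensor \<Rightarrow> ('i, 'e, real) tensor \<Rightarrow> bool" where
  "volume_form C g \<mu> \<longleftrightarrow> form_field C DIM('e) \<mu> \<and>
     (\<forall>i. \<forall>x\<in>coord_image C i. \<forall>es. orthonormal_frame (g i x) es \<longrightarrow> \<bar>\<mu> i x es\<bar> = 1)"

text \<open>Hodge star of a \<open>k\<close>-form, normalised by \<open>\<alpha> \<and> \<star>\<beta> = \<langle>\<alpha>, \<beta>\<rangle> \<mu>\<close>: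
  \<open>(\<star>\<alpha>)\<^sub>w = \<alpha>\<^sub>e \<mu>\<^sub>e\<^sub>w / k!\<close> with summation over all \<open>k\<close>-tuples \<open>e\<close> of frame vectors.\<close>

definition hodge ::
  "('e::euclidean_space list \<Rightarrow> real) \<Rightarrow> ('e list \<Rightarrow> real) \<Rightarrow> nat \<Rightarrow> ('e list \<Rightarrow> real) \<Rightarrow> 'e list \<Rightarrow> real" where
  "hodge G \<mu> k \<alpha> ws =
     (\<Sum>es | set es \<subseteq> onb G \<and> length es = k. \<alpha> es * \<mu> (es @ ws)) / fact k"

text \<open>The Christoffel symbols of the Levi-Civita connection: \<open>christoffel g x u v\<close> is
  \<open>\<nabla>\<^sub>u v\<close> for the vector fields with constant components \<open>u\<close> and \<open>v\<close>.\<close>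

definition christoffel ::
  "('e::euclidean_space \<Rightarrow> 'e list \<Rightarrow> real) \<Rightarrow> 'e \<Rightarrow> 'e \<Rightarrow> 'e \<Rightarrow> 'e" where
  "christoffel g x u v = (THE z. \<forall>w. g x [z, w] =
     (frechet_derivative (\<lambda>y. g y [v, w]) (at x) u +
      frechet_derivative (\<lambda>y. g y [u, w]) (at x) v -
      frechet_derivative (\<lambda>y. g y [u, v]) (at x) w) / 2)"

text \<open>\<open>nabla g \<alpha> x u vs\<close> is \<open>(\<nabla>\<^sub>u \<alpha>)(vs)\<close>.\<close>

definition nabla ::
  "('e::euclidean_space \<Rightarrow> 'e list \<Rightarrow> real) \<Rightarrow> ('e \<Rightarrow> 'e list \<Rightarrow> real) \<Rightarrow> 'e \<Rightarrow> 'e \<Rightarrow> 'e list \<Rightarrow> real" where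
  "nabla g \<alpha> x u vs =
     frechet_derivative (\<lambda>y. \<alpha> y vs) (at x) u -
     (\<Sum>k<length vs. \<alpha> x (vs[k := christoffel g x u (vs ! k)]))"

definition flat :: "('e list \<Rightarrow> real) \<Rightarrow> 'e \<Rightarrow> 'e list \<Rightarrow> real" where
  "flat G v ws = G (v # ws)"

definition divergence ::
  "('e::euclidean_space \<Rightarrow> 'e list \<Rightarrow> real) \<Rightarrow> ('e \<Rightarrow> 'e list \<Rightarrow> real) \<Rightarrow> 'e \<Rightarrow> 'e \<Rightarrow> real" where
  "divergence g T x w = (\<Sum>e\<in>onb (g x). nabla g T x e [e, w])"

definition tensor_norm2 ::
  "('e::euclidean_space list \<Rightarrow> real) \<Rightarrow> ('e list \<Rightarrow> real) \<Rightarrow> real" where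
  "tensor_norm2 G T = sqrt (\<Sum>e\<in>onb G. \<Sum>e'\<in>onb G. (T [e, e'])\<^sup>2)"


section \<open>\<open>G\<^sub>2\<close>-structures and isometric solitons\<close>

text \<open>Components, for \<open>i < j < k\<close>, of the model 3-form \<open>Re (dz\<^sub>1 \<and> dz\<^sub>2 \<and> dz\<^sub>3) - dr \<and> \<omega>\<^sub>0\<close> on
  \<open>\<real> \<times> \<complex>\<^sup>3\<close> in the oriented orthonormal basis dual to \<open>(dr, dx\<^sub>1, dy\<^sub>1, dx\<^sub>2, dy\<^sub>2, dx\<^sub>3, dy\<^sub>3)\<close>,
  numbered from 0. With this orientation
  \<open>\<phi>\<^sub>i\<^sub>j\<^sub>k \<phi>\<^sub>a\<^sub>b\<^sub>k = \<delta>\<^sub>i\<^sub>a \<delta>\<^sub>j\<^sub>b - \<delta>\<^sub>i\<^sub>b \<delta>\<^sub>j\<^sub>a - \<psi>\<^sub>i\<^sub>j\<^sub>a\<^sub>b\<close> for \<open>\<psi> = \<star>\<phi>\<close>.\<close>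

definition model_g2 :: "nat \<Rightarrow> nat \<Rightarrow> nat \<Rightarrow> real" where
  "model_g2 i j k =
     (if (i, j, k) = (1, 3, 5) then 1
      else if (i, j, k) \<in> {(1, 4, 6), (2, 3, 6), (2, 4, 5), (0, 1, 2), (0, 3, 4), (0, 5, 6)} then - 1
      else 0)"

text \<open>\<open>g2_structure C \<phi> g \<mu>\<close>: \<open>\<phi>\<close> is a \<open>G\<^sub>2\<close>-structure, and the metric and the (oriented) volume
  form it induces are \<open>g\<close> and \<open>\<mu>\<close>. The pair \<open>(g, \<mu>)\<close> is determined by \<open>\<phi>\<close>, since the stabiliser
  of the model form in \<open>GL(7, \<real>)\<close> is contained in \<open>SO(7)\<close>.\<close>

definition g2_structure ::
  "('i \<Rightarrow> ('m, 'e::euclidean_space) chart) \<Rightarrow> ('i, 'e, real) tensor \<Rightarrow>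
   ('i, 'e, real) tensor \<Rightarrow> ('i, 'e, real) tensor \<Rightarrow> bool" where
  "g2_structure C \<phi> g \<mu> \<longleftrightarrow>
     DIM('e) = 7 \<and> form_field C 3 \<phi> \<and> riemannian_metric C g \<and> volume_form C g \<mu> \<and>
     (\<forall>i. \<forall>x\<in>coord_image C i. \<exists>es. orthonormal_frame (g i x) es \<and> \<mu> i x es = 1 \<and>
        (\<forall>p q s. p < q \<longrightarrow> q < s \<longrightarrow> s < 7 \<longrightarrow>
           \<phi> i x [es ! p, es ! q, es ! s] = model_g2 p q s))"

definition torsion ::
  "('e::euclidean_space \<Rightarrow> 'e list \<Rightarrow> real) \<Rightarrow> ('e \<Rightarrow> 'e list \<Rightarrow> real) \<Rightarrow> ('e \<Rightarrow> 'e list \<Rightarrow> real) \<Rightarrow>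
   'e \<Rightarrow> 'e list \<Rightarrow> real" where
  "torsion \<phi> g \<mu> x vs =
     (THE T. bilinear T \<and>
        (\<forall>p i j k. nabla g \<phi> x p [i, j, k] =
           (\<Sum>q\<in>onb (g x). T p q * hodge (g x) (\<mu> x) 3 (\<phi> x) [q, i, j, k])))
     (vs ! 0) (vs ! 1)"

definition curl ::
  "('e::euclidean_space \<Rightarrow> 'e list \<Rightarrow> real) \<Rightarrow> ('e \<Rightarrow> 'e list \<Rightarrow> real) \<Rightarrow> ('e \<Rightarrow> 'e) \<Rightarrow> 'e \<Rightarrow> 'e \<Rightarrow> real" where
  "curl \<phi> g Y x w =
     (\<Sum>e\<in>onb (g x). \<Sum>e'\<in>onb (g x). nabla g (\<lambda>y. flat (g y) (Y y)) x e [e'] * \<phi> x [e, e', w])"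

text \<open>\<open>(\<phi>, Y, c)\<close> is an isometric soliton, \<open>g\<close> and \<open>\<mu>\<close> being the metric and the volume form
  induced by \<open>\<phi>\<close>.\<close>

definition isometric_soliton ::
  "('i \<Rightarrow> ('m, 'e::euclidean_space) chart) \<Rightarrow> ('i, 'e, real) tensor \<Rightarrow> ('i, 'e, real) tensor \<Rightarrow>
   ('i, 'e, real) tensor \<Rightarrow> ('i \<Rightarrow> 'e \<Rightarrow> 'e) \<Rightarrow> real \<Rightarrow> bool" where
  "isometric_soliton C g \<mu> \<phi> Y c \<longleftrightarrow>
     g2_structure C \<phi> g \<mu> \<and> vector_field C Y \<and>
     (\<forall>i. \<forall>x\<in>coord_image C i.
        (\<forall>u v. lie_derivative (Y i) (g i) x [u, v] = 2 * c * g i x [u, v]) \<and>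
        (\<forall>w. divergence (g i) (torsion (\<phi> i) (g i) (\<mu> i)) x w =
           - (1 / 2) * curl (\<phi> i) (g i) (Y i) x w + torsion (\<phi> i) (g i) (\<mu> i) x [Y i x, w]))"

text \<open>The 3-form \<open>\<phi>(f, X)\<close> in the isometry class of \<open>\<phi>\<close>.\<close>

definition isometric_form ::
  "('i, 'e::euclidean_space, real) tensor \<Rightarrow> ('i, 'e, real) tensor \<Rightarrow> ('i, 'e, real) tensor \<Rightarrow>
   ('i \<Rightarrow> 'e \<Rightarrow> real) \<Rightarrow> ('i \<Rightarrow> 'e \<Rightarrow> 'e) \<Rightarrow> ('i, 'e, real) tensor" where
  "isometric_form g \<mu> \<phi> f X i x vs =
     ((f i x)\<^sup>2 - g i x [X i x, X i x]) * \<phi> i x vs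
     - 2 * f i x * interior (X i x) (hodge (g i x) (\<mu> i x) 3 (\<phi> i x)) vs
     + 2 * wedge 1 (flat (g i x) (X i x)) (interior (X i x) (\<phi> i x)) vs"

definition torsion_norm ::
  "('i \<Rightarrow> ('m, 'e::euclidean_space) chart) \<Rightarrow> ('i, 'e, real) tensor \<Rightarrow> ('i, 'e, real) tensor \<Rightarrow>
   ('i, 'e, real) tensor \<Rightarrow> 'm \<Rightarrow> real" where
  "torsion_norm C g \<mu> \<phi> =
     scalar_at C (\<lambda>i x. tensor_norm2 (g i x) (torsion (\<phi> i) (g i) (\<mu> i) x))"


section \<open>Calabi--Yau 3-folds\<close>

definition integrable_complex_structure ::
  "('i \<Rightarrow> ('m, 'e::euclidean_space) chart) \<Rightarrow> ('i \<Rightarrow> 'e \<Rightarrow> 'e \<Rightarrow> 'e) \<Rightarrow> bool" where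
  "integrable_complex_structure C J \<longleftrightarrow> endomorphism_field C J \<and>
     (\<forall>i. \<forall>x\<in>coord_image C i. \<forall>v. J i x (J i x v) = - v) \<and>
     \<comment> \<open>The Nijenhuis tensor vanishes. It suffices to evaluate it on the vector fields with
         constant components \<open>u\<close> and \<open>v\<close>, for which \<open>[u, v] = 0\<close>.\<close>
     (\<forall>i. \<forall>x\<in>coord_image C i. \<forall>u v.
        lie_bracket (\<lambda>y. J i y u) (\<lambda>y. J i y v) x
        - J i x (lie_bracket (\<lambda>y. J i y u) (\<lambda>y. v) x)
        - J i x (lie_bracket (\<lambda>y. u) (\<lambda>y. J i y v) x) = 0)"

definition kaehler_volume :: "('i, 'e, real) tensor \<Rightarrow> ('i, 'e, real) tensor" where
  "kaehler_volume \<omega> i x vs = wedge 2 (\<omega> i x) (wedge 2 (\<omega> i x) (\<omega> i x)) vs / 6"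

definition calabi_yau_3fold ::
  "('i \<Rightarrow> ('n::{t2_space,second_countable_topology}, real^6) chart) \<Rightarrow>
   ('i, real^6, real) tensor \<Rightarrow> ('i \<Rightarrow> real^6 \<Rightarrow> real^6 \<Rightarrow> real^6) \<Rightarrow>
   ('i, real^6, real) tensor \<Rightarrow> ('i, real^6, complex) tensor \<Rightarrow> bool" where
  "calabi_yau_3fold C g J \<omega> \<Omega> \<longleftrightarrow>
     atlas C \<and> riemannian_metric C g \<and> integrable_complex_structure C J \<and>
     form_field C 2 \<omega> \<and> form_field C 3 \<Omega> \<and> volume_form C g (kaehler_volume \<omega>) \<and>
     (\<forall>i. \<forall>x\<in>coord_image C i.
        (\<forall>u v. g i x [J i x u, J i x v] = g i x [u, v]) \<and>
        (\<forall>u v. \<omega> i x [u, v] = g i x [J i x u, v]) \<and>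
        (\<forall>u v w. \<Omega> i x [J i x u, v, w] = \<i> * \<Omega> i x [u, v, w]) \<and>
        (\<exists>u v w. \<Omega> i x [u, v, w] \<noteq> 0) \<and>
        (\<forall>vs. length vs = 6 \<longrightarrow>
           complex_of_real (kaehler_volume \<omega> i x vs) =
           \<i> / 8 * wedge 3 (\<Omega> i x) (\<lambda>us. cnj (\<Omega> i x us)) vs)) \<and>
     closed_form C 2 \<omega> \<and> closed_form C 3 \<Omega>"


section \<open>The product \<open>\<real> \<times> N\<close>\<close>

definition cyl_atlas ::
  "('i \<Rightarrow> ('n, 'e) chart) \<Rightarrow> 'i \<Rightarrow> (real \<times> 'n, real \<times> 'e) chart" where
  "cyl_atlas C i = (UNIV \<times> fst (C i), map_prod id (snd (C i)))"

definition pullback_N :: "('i, 'e, 'a) tensor \<Rightarrow> ('i, real \<times> 'e, 'a) tensor" where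
  "pullback_N \<alpha> i p vs = \<alpha> i (snd p) (map snd vs)"

definition dr :: "('i, real \<times> 'e, real) tensor" where
  "dr i p vs = fst (vs ! 0)"

definition cyl_metric :: "('i, 'e, real) tensor \<Rightarrow> ('i, real \<times> 'e, real) tensor" where
  "cyl_metric g i p vs = fst (vs ! 0) * fst (vs ! 1) + pullback_N g i p vs"

definition cyl_g2 ::
  "('i, 'e, real) tensor \<Rightarrow> ('i, 'e, complex) tensor \<Rightarrow> ('i, real \<times> 'e, real) tensor" where
  "cyl_g2 \<omega> \<Omega> i p vs = Re (pullback_N \<Omega> i p vs) - wedge 1 (dr i p) (pullback_N \<omega> i p) vs"

text \<open>The volume form \<open>dr \<and> vol\<^sub>N\<close>, whose orientation is the one induced by \<open>cyl_g2 \<omega> \<Omega>\<close>.\<close>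

definition cyl_volume :: "('i, 'e, real) tensor \<Rightarrow> ('i, real \<times> 'e, real) tensor" where
  "cyl_volume \<omega> i p vs = wedge 1 (dr i p) (pullback_N (kaehler_volume \<omega>) i p) vs"

text \<open>The function \<open>f(r)\<close> and the vector field \<open>a(r) \<partial>/\<partial>r\<close>.\<close>

definition cyl_function :: "(real \<Rightarrow> real) \<Rightarrow> 'i \<Rightarrow> real \<times> 'e \<Rightarrow> real" where
  "cyl_function f i p = f (fst p)"

definition cyl_field :: "(real \<Rightarrow> real) \<Rightarrow> 'i \<Rightarrow> real \<times> 'e \<Rightarrow> real \<times> 'e::zero" where
  "cyl_field a i p = (a (fst p), 0)"

text \<open>The \<open>G\<^sub>2\<close>-structure \<open>\<phi>(f, X)\<close> with \<open>f = f(r)\<close> and \<open>X = a(r) \<partial>/\<partial>r\<close>.\<close>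

definition cyl_isometric_form ::
  "('i, 'e::euclidean_space, real) tensor \<Rightarrow> ('i, 'e, real) tensor \<Rightarrow> ('i, 'e, complex) tensor \<Rightarrow>
   (real \<Rightarrow> real) \<Rightarrow> (real \<Rightarrow> real) \<Rightarrow> ('i, real \<times> 'e, real) tensor" where
  "cyl_isometric_form g \<omega> \<Omega> f a =
     isometric_form (cyl_metric g) (cyl_volume \<omega>) (cyl_g2 \<omega> \<Omega>) (cyl_function f) (cyl_field a)"

end

theory Submission
  imports Defs
begin

text \<open>
  Write \<open>f = cos \<theta>\<close>, \<open>a = sin \<theta>\<close> and \<open>\<zeta> = (f - i a)\<^sup>2\<close>. Since \<open>\<partial>/\<partial>r\<close> contracted with the dual of the product
  form is \<open>- Im \<Omega>\<close>, the form \<open>\<phi>(f, X)\<close> equals \<open>Re (\<zeta> \<Omega>) - dr \<and> \<omega>\<close>: it is the product structure with \<open>\<Omega>\<close> rotated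
  by a phase which depends on \<open>r\<close> only. As \<open>\<omega>\<close> and \<open>\<Omega>\<close> are parallel, only the derivative of \<open>\<zeta>\<close> contributes to
  the torsion, and \<open>T = - 2 \<theta>' dr \<otimes> dr\<close>. Hence \<open>div T = - 2 \<theta>'' dr\<close>, while \<open>curl Y = 0\<close> because \<open>\<phi>(f, X)\<close> is
  alternating, so the soliton equations are \<open>\<theta>'' = b \<theta>'\<close> and \<open>b' dr\<^sup>2 = c g\<close>. On vectors tangent to \<open>N\<close> the latter
  gives \<open>c = 0\<close>, hence \<open>b' = 0\<close>; and \<open>|T| = 2 |\<theta>'|\<close>. Here \<open>\<theta>' = f a' - a f'\<close> is available without choosing \<open>\<theta>\<close>.
\<close>

subsection \<open>Multilinear and alternating functions of lists\<close>

text \<open>Neither the parallelism of \<omega> and \<Omega> nor any independence of frames is built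
  into the definitions. Parallelism has to come out of integrability, the two closedness conditions
  and the normalisation of the volume. Contractions refer to an unspecified frame
  \<open>onb\<close>, while \<open>christoffel\<close> and \<open>torsion\<close> are definite
  descriptions; so traces are shown to be frame independent, and the torsion can be identified only
  once the dual 4-form is known to annihilate no nonzero vector. The linear algebra is done once,
  for a fixed SU(3)-structure on a vector space of dimension 6. As the phase has modulus one,
  multiplying \<Omega> by it gives another such structure with the same metric and volume, and
  \<phi>(f, X) is pointwise its product form. The converse direction has its own obstacle: f is
  given only through its square, so the speed \<theta>' is at first known only up to sign at each
  point. The case b = 0 is separate, because there the exponential profile is constant whereas
  \<theta>'' = 0 has all affine solutions.\<close>

lemma multilinear_0 [simp]: "multilinear 0 F"
  by (simp add: multilinear_def)

text \<open>Peels off the first argument. This recursion follows the shape of lists, so facts about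
  k-linear functions and wedge products become inductions on k.\<close>

lemma multilinear_Suc_iff:
  "multilinear (Suc k) F \<longleftrightarrow>
     (\<forall>v. multilinear k (\<lambda>vs. F (v # vs))) \<and> (\<forall>vs. length vs = k \<longrightarrow> linear (\<lambda>v. F (v # vs)))"
  (is "?L \<longleftrightarrow> ?R")
proof
  assume L: ?L
  show ?R
  proof (intro conjI allI impI)
    fix v
    show "multilinear k (\<lambda>vs. F (v # vs))"
      unfolding multilinear_def
    proof (intro allI impI)
      fix vs :: "'a list" and j assume "length vs = k" "j < k"
      then show "linear (\<lambda>w. F (v # vs[j := w]))"
        using L[unfolded multilinear_def, rule_format, of "v # vs" "Suc j"] by simp
    qed
  next
    fix vs :: "'a list" assume "length vs = k"
    then show "linear (\<lambda>v. F (v # vs))"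
      using L[unfolded multilinear_def, rule_format, of "undefined # vs" 0] by simp
  qed
next
  assume R: ?R
  show ?L
    unfolding multilinear_def
  proof (intro allI impI)
    fix vs :: "'a list" and j assume *: "length vs = Suc k" "j < Suc k"
    then obtain v ws where vs: "vs = v # ws" "length ws = k" by (auto simp: length_Suc_conv)
    show "linear (\<lambda>w. F (vs[j := w]))"
    proof (cases j)
      case 0 then show ?thesis using R vs by simp
    next
      case (Suc i)
      then show ?thesis using R vs * unfolding multilinear_def by simp
    qed
  qed
qed

lemma multilinear_SucD:
  assumes "multilinear (Suc k) F"
  shows "multilinear k (\<lambda>vs. F (v # vs))" "length vs = k \<Longrightarrow> linear (\<lambda>v. F (v # vs))"
  using assms by (auto simp: multilinear_Suc_iff)

lemma multilinear_2:
  "multilinear 2 F \<longleftrightarrow> (\<forall>a. linear (\<lambda>v. F [v, a])) \<and> (\<forall>a. linear (\<lambda>v. F [a, v]))"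
  by (auto simp: numeral_2_eq_2 multilinear_Suc_iff length_Suc_conv)

lemma multilinear_3:
  "multilinear 3 F \<longleftrightarrow> (\<forall>a b. linear (\<lambda>v. F [v, a, b])) \<and> (\<forall>a b. linear (\<lambda>v. F [a, v, b])) \<and>
     (\<forall>a b. linear (\<lambda>v. F [a, b, v]))"
  by (auto simp: numeral_3_eq_3 multilinear_Suc_iff length_Suc_conv)

lemma multilinear_compose:
  assumes "multilinear k F" "linear h"
  shows "multilinear k (\<lambda>vs. h (F vs))"
  unfolding multilinear_def
proof (intro allI impI)
  fix vs :: "'a list" and j assume "length vs = k" "j < k"
  then have "linear (\<lambda>v. F (vs[j := v]))" using assms(1) by (simp add: multilinear_def)
  from linear_compose[OF this assms(2)] show "linear (\<lambda>v. h (F (vs[j := v])))" by (simp add: o_def)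
qed

lemma multilinear_add:
  assumes "multilinear k F" "multilinear k H"
  shows "multilinear k (\<lambda>vs. F vs + H vs)"
  using assms unfolding multilinear_def by (intro allI impI linear_compose_add) auto

lemma multilinear_diff:
  assumes "multilinear k F" "multilinear k H"
  shows "multilinear k (\<lambda>vs. F vs - H vs)"
  using assms unfolding multilinear_def by (intro allI impI linear_compose_sub) auto

lemma multilinear_sum:
  assumes "\<And>i. i \<in> I \<Longrightarrow> multilinear k (F i)"
  shows "multilinear k (\<lambda>vs. \<Sum>i\<in>I. F i vs)"
  using assms unfolding multilinear_def by (intro allI impI linear_compose_sum) auto

lemma multilinear_cmult:
  fixes F :: "'e::real_vector list \<Rightarrow> 'a::real_algebra"
  assumes "multilinear k F"
  shows "multilinear k (\<lambda>vs. c * F vs)"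
  using assms by (rule multilinear_compose) (simp add: linear_iff distrib_left)

lemma multilinear_map:
  assumes "multilinear k F" "linear h"
  shows "multilinear k (\<lambda>vs. F (map h vs))"
  unfolding multilinear_def map_update
proof (intro allI impI)
  fix vs :: "'c list" and j assume "length vs = k" "j < k"
  then have "linear (\<lambda>v. F ((map h vs)[j := v]))" using assms(1) by (simp add: multilinear_def)
  from linear_compose[OF assms(2) this] show "linear (\<lambda>v. F ((map h vs)[j := h v]))" by (simp add: o_def)
qed

lemma multilinear_append:
  assumes "multilinear (m + k) F" "length us = m"
  shows "multilinear k (\<lambda>vs. F (us @ vs))"
  using assms
proof (induction us arbitrary: m F)
  case (Cons u us)
  then obtain m' where m: "m = Suc m'" "length us = m'" by auto
  show ?case using Cons.IH[of m' "\<lambda>vs. F (u # vs)"] Cons.prems m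
    by (simp add: multilinear_SucD)
qed simp

lemma multilinear_append_right:
  assumes "multilinear (k + m) F" "length ws = m"
  shows "multilinear k (\<lambda>us. F (us @ ws))"
  using assms
proof (induction k arbitrary: F)
  case (Suc k)
  have "multilinear k (\<lambda>us. F (v # us @ ws))" for v
    using Suc.prems by (intro Suc.IH) (simp_all add: multilinear_SucD)
  moreover have "linear (\<lambda>v. F (v # us @ ws))" if "length us = k" for us
    using Suc.prems that multilinear_SucD(2)[of "k + m" F "us @ ws"] by simp
  ultimately show ?case by (simp add: multilinear_Suc_iff)
qed simp

lemma alternating_SucD:
  assumes "alternating (Suc k) F"
  shows "alternating k (\<lambda>vs. F (v # vs))"
  using assms by (auto simp: alternating_def)

lemma alternating_append:
  assumes "alternating (m + k) F" "length us = m"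
  shows "alternating k (\<lambda>vs. F (us @ vs))"
  using assms by (auto simp: alternating_def)

lemma alternating_append_right:
  assumes "alternating (k + m) F" "length ws = m"
  shows "alternating k (\<lambda>us. F (us @ ws))"
  using assms by (auto simp: alternating_def)

lemma alternating_map:
  assumes "alternating k F"
  shows "alternating k (\<lambda>vs. F (map h vs))"
  using assms by (auto simp: alternating_def distinct_map)

text \<open>Polarisation: with \<open>a + b\<close> in both slots the value vanishes, and so do the
  two diagonal terms of its expansion.\<close>

lemma alternating_swap:
  assumes F: "multilinear (Suc (Suc k)) F" "alternating (Suc (Suc k)) F" and zs: "length zs = k"
  shows "F (a # b # zs) = - F (b # a # zs)"
proof -
  have l1: "linear (\<lambda>v. F (v # w # zs))" for w using multilinear_SucD(2)[OF F(1)] zs by simp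
  have l2: "linear (\<lambda>v. F (w # v # zs))" for w
    using multilinear_SucD(2)[OF multilinear_SucD(1)[OF F(1)]] zs by simp
  have z: "F (v # v # zs) = 0" for v using F(2) zs by (simp add: alternating_def)
  have "F ((a + b) # (a + b) # zs) = F (a # a # zs) + F (a # b # zs) + (F (b # a # zs) + F (b # b # zs))"
    using linear_add[OF l1] linear_add[OF l2] by simp
  then show ?thesis using z by (simp add: add_eq_0_iff2)
qed

lemma alternating_3_swap:
  assumes "multilinear 3 F" "alternating 3 F"
  shows "F [u, v, w] = - F [v, u, w]" "F [u, v, w] = - F [u, w, v]"
  using assms alternating_swap[of 1 F "[w]" u v] alternating_swap[of 0 "\<lambda>vs. F (u # vs)" "[]" v w]
  by (simp_all add: numeral_3_eq_3 multilinear_SucD alternating_SucD)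

lemma alternating_move:
  assumes "multilinear k F" "alternating k F" "length xs + length ys + 1 = k"
  shows "F (xs @ v # ys) = (- 1) ^ length xs *\<^sub>R F (v # xs @ ys)"
  using assms
proof (induction xs arbitrary: k F)
  case (Cons x xs)
  obtain k' where k: "k = Suc (Suc k')" "length (xs @ ys) = k'" using Cons.prems(3) by simp
  have "F ((x # xs) @ v # ys) = (- 1) ^ length xs *\<^sub>R F (x # v # xs @ ys)"
    using Cons.IH[of "Suc k'" "\<lambda>vs. F (x # vs)"] Cons.prems k
    by (simp add: multilinear_SucD alternating_SucD)
  also have "F (x # v # xs @ ys) = - F (v # x # xs @ ys)"
    using alternating_swap[of k' F "xs @ ys" x v] Cons.prems k by simp
  finally show ?case by simp
qed simp

section \<open>Reordering arguments and signs of permutations\<close>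

fun list_sign :: "nat list \<Rightarrow> real" where
  "list_sign [] = 1"
| "list_sign (x # xs) = (- 1) ^ length (filter (\<lambda>y. y < x) xs) * list_sign xs"

lemma list_sign_square: "(list_sign xs)\<^sup>2 = 1"
  by (induction xs) (simp_all add: power_mult_distrib minus_one_power_iff)

text \<open>The prefix which \<open>x\<close> has to pass consists of the smaller entries, so its
  length is the number of inversions that \<open>list_sign\<close> charges to
  \<open>x\<close>.\<close>

lemma insort_append:
  assumes "sorted xs" "x \<notin> set xs"
  shows "\<exists>ys zs. xs = ys @ zs \<and> insort x xs = ys @ x # zs \<and> length ys = length (filter (\<lambda>y. y < x) xs)"
  using assms
proof (induction xs)
  case (Cons y xs)
  show ?case
  proof (cases "x \<le> y")
    case True
    then have "filter (\<lambda>y. y < x) (y # xs) = []" using Cons.prems by (auto simp: filter_empty_conv)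
    then show ?thesis using True by (intro exI[of _ "[]"] exI[of _ "y # xs"]) simp
  next
    case False
    have "sorted xs" "x \<notin> set xs" using Cons.prems by auto
    from Cons.IH[OF this] obtain ys zs where
      1: "xs = ys @ zs" and 2: "insort x xs = ys @ x # zs"
        and 3: "length (filter (\<lambda>y. y < x) xs) = length ys"
      by metis
    have "y # xs = (y # ys) @ zs" using 1 by simp
    moreover have "insort x (y # xs) = (y # ys) @ x # zs" using False 2 by simp
    moreover have "length (y # ys) = length (filter (\<lambda>y. y < x) (y # xs))" using False 3 by (simp add: not_le)
    ultimately show ?thesis by blast
  qed
qed auto

lemma sort_permutation:
  assumes "distinct idx" "length idx = n" "set idx \<subseteq> {..<n}"
  shows "sort idx = [0..<n]"
proof (rule sorted_distinct_set_unique)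
  show "set (sort idx) = set [0..<n]"
    using assms card_subset_eq[of "{..<n}" "set idx"] by (simp add: distinct_card lessThan_atLeast0)
qed (use assms in simp_all)

text \<open>Follows insertion sort: the tail is sorted by induction, then the head moves past the
  smaller entries, one transposition each. The sign thus appears as the parity of the number of
  inversions.\<close>

lemma alternating_sort:
  assumes "multilinear k F" "alternating k F" "length idx = k" "distinct idx"
  shows "F (map e idx) = list_sign idx *\<^sub>R F (map e (sort idx))"
  using assms
proof (induction idx arbitrary: k F)
  case (Cons x xs)
  then obtain k' where k: "k = Suc k'" "length xs = k'" by auto
  obtain ys zs where yz: "sort xs = ys @ zs" "insort x (sort xs) = ys @ x # zs"
    "length ys = length (filter (\<lambda>y. y < x) (sort xs))"
    using insort_append[of "sort xs" x] Cons.prems(4) by auto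
  have len: "length ys = length (filter (\<lambda>y. y < x) xs)"
    using yz(3) by (simp add: filter_sort)
  have "length (sort xs) = k'" using k by simp
  then have l: "length ys + length zs = k'" using yz(1) by simp
  have "F (map e (x # xs)) = list_sign xs *\<^sub>R F (e x # map e ys @ map e zs)"
    using Cons.IH[of k' "\<lambda>vs. F (e x # vs)"] Cons.prems k yz(1)
    by (simp add: multilinear_SucD alternating_SucD)
  moreover have "F (map e (sort (x # xs))) = (- 1) ^ length ys *\<^sub>R F (e x # map e ys @ map e zs)"
    using alternating_move[of k F "map e ys" "map e zs" "e x"] Cons.prems k l yz(2) by simp
  ultimately show ?case by (simp add: len power_add[symmetric] flip: mult_2)
qed simp

lemma multilinear_eqI:
  assumes "multilinear k F" "multilinear k H" "span B = UNIV"
    and "\<And>es. length es = k \<Longrightarrow> set es \<subseteq> B \<Longrightarrow> F es = H es" "length vs = k"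
  shows "F vs = H vs"
  using assms
proof (induction k arbitrary: F H vs)
  case (Suc k)
  then obtain v ws where vs: "vs = v # ws" "length ws = k" by (auto simp: length_Suc_conv)
  have "F (b # ws) = H (b # ws)" if "b \<in> B" for b
    using Suc.IH[of "\<lambda>vs. F (b # vs)" "\<lambda>vs. H (b # vs)" ws] Suc.prems vs that
    by (simp add: multilinear_SucD)
  then show ?case
    using linear_eq_on[OF multilinear_SucD(2)[OF Suc.prems(1) vs(2)] multilinear_SucD(2)[OF Suc.prems(2) vs(2)], of v B]
      vs Suc.prems(3) by auto
qed auto

text \<open>Other index lists reduce to increasing ones: a repeated index repeats a vector, and
  distinct indices are sorted with the same sign on both sides. For 3-forms in dimension six this
  leaves 20 checks.\<close>

lemma alternating_eqI:
  fixes e :: "nat \<Rightarrow> 'e::real_vector"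
  assumes F: "multilinear k F" "alternating k F" and H: "multilinear k H" "alternating k H"
    and span: "span (e ` {..<n}) = UNIV"
    and eq: "\<And>idx. length idx = k \<Longrightarrow> sorted_wrt (<) idx \<Longrightarrow> set idx \<subseteq> {..<n} \<Longrightarrow>
       F (map e idx) = H (map e idx)"
    and "length vs = k"
  shows "F vs = H vs"
proof (rule multilinear_eqI[OF F(1) H(1) span _ \<open>length vs = k\<close>])
  fix es assume es: "length es = k" "set es \<subseteq> e ` {..<n}"
  then have "\<forall>x\<in>set es. \<exists>p<n. x = e p" by auto
  then obtain q where q: "\<And>x. x \<in> set es \<Longrightarrow> q x < n \<and> x = e (q x)" by metis
  define idx where "idx = map q es"
  have idx: "es = map e idx" "set idx \<subseteq> {..<n}" "length idx = k"
    using q es by (auto simp: idx_def o_def intro!: map_idI[symmetric])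
  show "F es = H es"
  proof (cases "distinct idx")
    case True
    have "F (map e (sort idx)) = H (map e (sort idx))"
      using idx True by (intro eq) (auto simp: strict_sorted_iff)
    then show ?thesis using alternating_sort[OF F idx(3) True] alternating_sort[OF H idx(3) True] idx by simp
  next
    case False
    then have "\<not> distinct es" using idx by (simp add: distinct_map)
    then show ?thesis using F(2) H(2) es by (simp add: alternating_def)
  qed
qed


subsection \<open>Wedge products\<close>

lemma wedge_Nil: "wedge k \<alpha> \<beta> [] = (if k = 0 then \<alpha> [] * \<beta> [] else 0)"
proof -
  have "{S::nat set. S \<subseteq> {} \<and> card S = k} = (if k = 0 then {{}} else {})" by auto
  then show ?thesis by (simp add: wedge_def shuffle_sign_def)
qed

lemma nths_Cons_shift:
  "nths (x # xs) (insert 0 (Suc ` S)) = x # nths xs S" "nths (x # xs) (Suc ` S) = nths xs S"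
  "nths (x # xs) (- insert 0 (Suc ` S)) = nths xs (- S)" "nths (x # xs) (- Suc ` S) = x # nths xs (- S)"
proof -
  have "{j. Suc j \<in> insert 0 (Suc ` S)} = S" "{j. Suc j \<in> Suc ` S} = S"
    "{j. Suc j \<in> - insert 0 (Suc ` S)} = - S" "{j. Suc j \<in> - Suc ` S} = - S" by auto
  then show "nths (x # xs) (insert 0 (Suc ` S)) = x # nths xs S" "nths (x # xs) (Suc ` S) = nths xs S"
    "nths (x # xs) (- insert 0 (Suc ` S)) = nths xs (- S)" "nths (x # xs) (- Suc ` S) = x # nths xs (- S)"
    by (simp_all only: nths_Cons) auto
qed

lemma shuffle_sign_insert:
  assumes "S \<subseteq> {..<n}"
  shows "shuffle_sign (Suc n) (insert 0 (Suc ` S)) = shuffle_sign n S"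
proof -
  have "{(s, t). s \<in> insert 0 (Suc ` S) \<and> t \<in> {..<Suc n} - insert 0 (Suc ` S) \<and> t < s} =
    map_prod Suc Suc ` {(s, t). s \<in> S \<and> t \<in> {..<n} - S \<and> t < s}" (is "?A = _ ` ?B")
  proof (intro set_eqI iffI)
    fix p assume "p \<in> ?A"
    then obtain s t where "p = (s, t)" "s \<in> insert 0 (Suc ` S)" "t \<in> {..<Suc n} - insert 0 (Suc ` S)" "t < s"
      by auto
    then show "p \<in> map_prod Suc Suc ` ?B" by (cases s; cases t) auto
  qed auto
  moreover have "card (map_prod Suc Suc ` ?B) = card ?B"
    by (intro card_image) (auto simp: inj_on_def)
  ultimately show ?thesis by (simp add: shuffle_sign_def)
qed

text \<open>Position 0 now lies outside the set and below all its elements, so each element gains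
  one inversion.\<close>

lemma shuffle_sign_image:
  assumes "S \<subseteq> {..<n}"
  shows "shuffle_sign (Suc n) (Suc ` S) = (- 1) ^ card S * shuffle_sign n S"
proof -
  let ?B = "{(s, t). s \<in> S \<and> t \<in> {..<n} - S \<and> t < s}"
  have fin: "finite S" using assms finite_subset by blast
  have finB: "finite ?B" by (rule finite_subset[of _ "S \<times> {..<n}"]) (use fin in auto)
  have "{(s, t). s \<in> Suc ` S \<and> t \<in> {..<Suc n} - Suc ` S \<and> t < s} =
    map_prod Suc Suc ` ?B \<union> (\<lambda>s. (Suc s, 0)) ` S" (is "?A = _")
  proof (intro set_eqI iffI)
    fix p assume "p \<in> ?A"
    then obtain s t where "p = (s, t)" "s \<in> Suc ` S" "t \<in> {..<Suc n} - Suc ` S" "t < s"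
      by auto
    then show "p \<in> map_prod Suc Suc ` ?B \<union> (\<lambda>s. (Suc s, 0)) ` S" by (cases t) auto
  qed auto
  moreover have "card (map_prod Suc Suc ` ?B \<union> (\<lambda>s. (Suc s, 0)) ` S) =
      card (map_prod Suc Suc ` ?B) + card ((\<lambda>s. (Suc s, 0::nat)) ` S)"
    by (intro card_Un_disjoint) (use fin finB in auto)
  moreover have "card (map_prod Suc Suc ` ?B) = card ?B"
    by (intro card_image) (auto simp: inj_on_def)
  moreover have "card ((\<lambda>s. (Suc s, 0::nat)) ` S) = card S"
    by (intro card_image) (auto simp: inj_on_def)
  ultimately show ?thesis by (simp add: shuffle_sign_def power_add mult.commute)
qed

lemma subsets_lessThan_Suc:
  "{S. S \<subseteq> {..<Suc n}} = (\<lambda>S. insert 0 (Suc ` S)) ` {S. S \<subseteq> {..<n}} \<union> (`) Suc ` {S. S \<subseteq> {..<n}}"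
proof (intro set_eqI iffI)
  fix S assume S: "S \<in> {S. S \<subseteq> {..<Suc n}}"
  define R where "R = {j. Suc j \<in> S}"
  have R: "R \<subseteq> {..<n}" using S by (auto simp: R_def)
  have "S = (if 0 \<in> S then insert 0 (Suc ` R) else Suc ` R)"
    by (auto simp: R_def image_iff) (metis not0_implies_Suc)+
  then show "S \<in> (\<lambda>S. insert 0 (Suc ` S)) ` {S. S \<subseteq> {..<n}} \<union> (`) Suc ` {S. S \<subseteq> {..<n}}"
    using R by (auto split: if_splits)
qed (auto simp: less_Suc_eq_0_disj)

text \<open>The shuffles split according to whether the first vector goes to \<alpha> or to \<beta>;
  in the latter case it passes the \<open>k\<close> arguments of \<alpha>. This is the
  antiderivation rule for the interior product, and it makes wedge products computable by
  rewriting.\<close>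

lemma wedge_Cons:
  fixes \<alpha> \<beta> :: "'e list \<Rightarrow> 'a::comm_ring_1"
  shows "wedge k \<alpha> \<beta> (v # ws) =
     (case k of 0 \<Rightarrow> 0 | Suc k' \<Rightarrow> wedge k' (\<lambda>us. \<alpha> (v # us)) \<beta> ws) +
     (- 1) ^ k * wedge k \<alpha> (\<lambda>us. \<beta> (v # us)) ws"
proof -
  let ?n = "length ws"
  let ?h = "\<lambda>S. shuffle_sign (Suc ?n) S * \<alpha> (nths (v # ws) S) * \<beta> (nths (v # ws) (- S))"
  let ?A = "{S. S \<subseteq> {..<?n} \<and> Suc (card S) = k}" and ?B = "{S. S \<subseteq> {..<?n} \<and> card S = k}"
  have fin: "finite S" if "S \<subseteq> {..<?n}" for S using that finite_subset by blast
  have finP: "finite {S. S \<subseteq> {..<?n}}" using finite_Collect_subsets[of "{..<?n}"] by simp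
  have cI: "card (insert 0 (Suc ` S)) = Suc (card S)" "card (Suc ` S) = card S" if "S \<subseteq> {..<?n}" for S
    using fin[OF that] by (auto simp: card_image)
  have split: "{S. S \<subseteq> {..<Suc ?n} \<and> card S = k} =
      (\<lambda>S. insert 0 (Suc ` S)) ` ?A \<union> (`) Suc ` ?B" (is "?L = ?R")
  proof -
    have "?L = {S. S \<subseteq> {..<Suc ?n}} \<inter> {S. card S = k}" by auto
    also have "\<dots> = ?R" unfolding subsets_lessThan_Suc using cI by fastforce
    finally show ?thesis .
  qed
  have "wedge k \<alpha> \<beta> (v # ws) = sum ?h ((\<lambda>S. insert 0 (Suc ` S)) ` ?A \<union> (`) Suc ` ?B)"
    unfolding wedge_def length_Cons split ..
  also have "\<dots> = sum ?h ((\<lambda>S. insert 0 (Suc ` S)) ` ?A) + sum ?h ((`) Suc ` ?B)"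
    by (intro sum.union_disjoint) (auto intro!: finite_imageI intro: finite_subset[OF _ finP])
  also have "sum ?h ((`) Suc ` ?B) = sum (?h \<circ> (`) Suc) ?B"
    by (intro sum.reindex) (auto simp: inj_on_def)
  also have "\<dots> = (- 1) ^ k * wedge k \<alpha> (\<lambda>us. \<beta> (v # us)) ws"
    by (auto simp: wedge_def sum_distrib_left shuffle_sign_image nths_Cons_shift mult_ac
        intro!: sum.cong)
  also have "sum ?h ((\<lambda>S. insert 0 (Suc ` S)) ` ?A) = sum (?h \<circ> (\<lambda>S. insert 0 (Suc ` S))) ?A"
    by (intro sum.reindex) (auto simp: inj_on_def)
  also have "\<dots> = (case k of 0 \<Rightarrow> 0 | Suc k' \<Rightarrow> wedge k' (\<lambda>us. \<alpha> (v # us)) \<beta> ws)"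
    by (cases k) (auto simp: wedge_def shuffle_sign_insert nths_Cons_shift intro!: sum.cong)
  finally show ?thesis .
qed

lemma wedge_0 [simp]: "wedge 0 \<alpha> \<beta> vs = \<alpha> [] * \<beta> vs"
  by (induction vs arbitrary: \<beta>) (simp_all add: wedge_Nil wedge_Cons)

lemma wedge_1_Cons:
  "wedge (Suc 0) \<alpha> \<beta> (v # ws) = \<alpha> [v] * \<beta> ws - wedge (Suc 0) \<alpha> (\<lambda>us. \<beta> (v # us)) ws"
  by (simp add: wedge_Cons)

lemma wedge_map: "wedge k \<alpha> \<beta> (map h vs) = wedge k (\<lambda>us. \<alpha> (map h us)) (\<lambda>us. \<beta> (map h us)) vs"
  by (simp add: wedge_def nths_map)

lemma wedge_1_zero:
  assumes "\<And>us. length us + 1 = length ws \<Longrightarrow> \<beta> us = 0"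
  shows "wedge (Suc 0) \<alpha> \<beta> ws = 0"
  using assms by (induction ws arbitrary: \<beta>) (simp_all add: wedge_Nil wedge_1_Cons)

text \<open>If \<open>v\<close> annihilates \<gamma>, only the shuffle that feeds \<open>v\<close>
  to \<alpha> survives, and its sign is given by the position of \<open>v\<close>.\<close>

lemma wedge_1_contract:
  assumes "\<And>us. v \<in> set us \<Longrightarrow> length us = length xs + length ys \<Longrightarrow> \<gamma> us = 0"
  shows "wedge (Suc 0) \<alpha> \<gamma> (xs @ v # ys) = (- 1) ^ length xs * \<alpha> [v] * \<gamma> (xs @ ys)"
  using assms
proof (induction xs arbitrary: \<gamma>)
  case Nil
  then show ?case using wedge_1_zero[of ys "\<lambda>us. \<gamma> (v # us)"] by (simp add: wedge_1_Cons)
next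
  case (Cons x xs)
  have "wedge (Suc 0) \<alpha> (\<lambda>us. \<gamma> (x # us)) (xs @ v # ys) = (- 1) ^ length xs * \<alpha> [v] * \<gamma> (x # xs @ ys)"
    by (rule Cons.IH) (rule Cons.prems, auto)
  moreover have "\<gamma> (xs @ v # ys) = 0" by (rule Cons.prems) auto
  ultimately show ?case by (simp add: wedge_1_Cons)
qed

text \<open>If the first vector recurs, only the two shuffles feeding one of its copies to \<alpha>
  survive. Moving the other copy to the front of \<beta> shows that they cancel. A repetition inside
  the tail is handled by induction.\<close>

lemma alternating_wedge_1:
  fixes \<beta> :: "'e::real_vector list \<Rightarrow> 'a::{comm_ring_1,real_algebra_1}"
  assumes "multilinear k \<beta>" "alternating k \<beta>"
  shows "alternating (Suc k) (wedge (Suc 0) \<alpha> \<beta>)"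
  unfolding alternating_def
proof (intro allI impI)
  fix vs :: "'e list" assume "length vs = Suc k" "\<not> distinct vs"
  then show "wedge (Suc 0) \<alpha> \<beta> vs = 0"
    using assms
  proof (induction vs arbitrary: k \<beta>)
    case (Cons v ws)
    have len: "length ws = k" using Cons.prems(1) by simp
    show ?case
    proof (cases "v \<in> set ws")
      case True
      then obtain xs ys where ws: "ws = xs @ v # ys" by (auto simp: in_set_conv_decomp)
      obtain k' where k: "k = Suc k'" "k' = length xs + length ys" using len ws by auto
      have "wedge (Suc 0) \<alpha> (\<lambda>us. \<beta> (v # us)) ws = (- 1) ^ length xs * \<alpha> [v] * \<beta> (v # xs @ ys)"
        unfolding ws by (rule wedge_1_contract) (use Cons.prems(4) k in \<open>auto simp: alternating_def\<close>)
      moreover have "\<beta> ws = (- 1) ^ length xs *\<^sub>R \<beta> (v # xs @ ys)"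
        unfolding ws by (rule alternating_move[OF Cons.prems(3,4)]) (use k in simp)
      ultimately show ?thesis by (cases "even (length xs)") (simp_all add: wedge_1_Cons)
    next
      case False
      then have nd: "\<not> distinct ws" using Cons.prems(2) by simp
      then obtain k' where k: "k = Suc k'" using len by (cases k) auto
      have "wedge (Suc 0) \<alpha> (\<lambda>us. \<beta> (v # us)) ws = 0"
        by (rule Cons.IH[of k']) (use Cons.prems k nd in \<open>auto simp: multilinear_SucD alternating_SucD\<close>)
      moreover have "\<beta> ws = 0" using Cons.prems(4) nd len by (simp add: alternating_def)
      ultimately show ?thesis by (simp add: wedge_1_Cons)
    qed
  qed simp
qed

lemma wedge_1_linear_right:
  fixes \<beta> :: "'x::real_vector \<Rightarrow> 'e list \<Rightarrow> 'a::{comm_ring_1,real_algebra_1}"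
  assumes "\<And>us. length us + 1 = length ws \<Longrightarrow> linear (\<lambda>x. \<beta> x us)"
  shows "linear (\<lambda>x. wedge (Suc 0) \<alpha> (\<beta> x) ws)"
  using assms
proof (induction ws arbitrary: \<beta>)
  case Nil then show ?case by (simp add: wedge_Nil linear_iff)
next
  case (Cons v ws)
  have "linear (\<lambda>x. \<alpha> [v] * \<beta> x ws)"
    using Cons.prems[of ws] by (simp add: linear_iff distrib_left)
  moreover have "linear (\<lambda>x. wedge (Suc 0) \<alpha> (\<lambda>us. \<beta> x (v # us)) ws)"
    using Cons.prems by (intro Cons.IH) simp
  ultimately show ?case by (simp add: wedge_1_Cons linear_compose_sub)
qed

lemma multilinear_wedge_1:
  fixes \<beta> :: "'e::real_vector list \<Rightarrow> 'a::{comm_ring_1,real_algebra_1}"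
  assumes "multilinear k \<beta>" "linear (\<lambda>v. \<alpha> [v])"
  shows "multilinear (Suc k) (wedge (Suc 0) \<alpha> \<beta>)"
  using assms(1)
proof (induction k arbitrary: \<beta>)
  case 0
  show ?case using assms(2)
    by (simp add: multilinear_Suc_iff wedge_1_Cons wedge_Nil linear_iff distrib_right)
next
  case (Suc k)
  have "multilinear (Suc k) (\<lambda>ws. \<alpha> [v] * \<beta> ws - wedge (Suc 0) \<alpha> (\<lambda>us. \<beta> (v # us)) ws)" for v
    using Suc by (intro multilinear_diff multilinear_cmult Suc.IH multilinear_SucD)
  moreover have "linear (\<lambda>v. \<alpha> [v] * \<beta> ws - wedge (Suc 0) \<alpha> (\<lambda>us. \<beta> (v # us)) ws)"
    if "length ws = Suc k" for ws
  proof (rule linear_compose_sub)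
    show "linear (\<lambda>v. \<alpha> [v] * \<beta> ws)" using assms(2) by (simp add: linear_iff distrib_right)
    show "linear (\<lambda>v. wedge (Suc 0) \<alpha> (\<lambda>us. \<beta> (v # us)) ws)"
      using that by (intro wedge_1_linear_right multilinear_SucD(2)[OF Suc.prems]) simp
  qed
  ultimately show ?case by (simp add: multilinear_Suc_iff[of "Suc k"] wedge_1_Cons)
qed


subsection \<open>Orthonormal frames\<close>

text \<open>The metric at one point, in arbitrary dimension, so that the same results serve the
  six-dimensional factor and the cylinder.\<close>

locale inner_form =
  fixes G :: "'e::euclidean_space list \<Rightarrow> real"
  assumes multilinear_G: "multilinear 2 G"
    and G_commute: "G [u, v] = G [v, u]"
    and G_pos: "v \<noteq> 0 \<Longrightarrow> G [v, v] > 0"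
begin

lemma linear_G: "linear (\<lambda>v. G [v, w])" "linear (\<lambda>v. G [w, v])"
  using multilinear_G by (simp_all add: multilinear_2)

lemmas G_simps =
  linear_add[OF linear_G(1)] linear_add[OF linear_G(2)] linear_diff[OF linear_G(1)] linear_diff[OF linear_G(2)]
  linear_scale[OF linear_G(1)] linear_scale[OF linear_G(2)] linear_0[OF linear_G(1)] linear_0[OF linear_G(2)]
  linear_neg[OF linear_G(1)] linear_neg[OF linear_G(2)] linear_sum[OF linear_G(1)] linear_sum[OF linear_G(2)]

lemma G_eq_0I: "(\<And>w. G [z, w] = 0) \<Longrightarrow> z = 0"
  using G_pos[of z] by force

lemma G_eqI:
  assumes "\<And>w. G [z, w] = G [z', w]"
  shows "z = z'"
proof -
  have "z - z' = 0" by (rule G_eq_0I) (simp add: G_simps assms)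
  then show ?thesis by simp
qed

text \<open>\<open>L s\<close> is the Euclidean vector representing \<open>G [s, _]\<close>.
  Orthogonality for \<open>G\<close> thereby becomes Euclidean orthogonality to fewer vectors than
  the dimension.\<close>

lemma unit_orthogonal_exists:
  assumes "finite S" "card S < DIM('e)"
  obtains v where "G [v, v] = 1" "\<And>s. s \<in> S \<Longrightarrow> G [s, v] = 0"
proof -
  define L where "L s = (\<Sum>b\<in>Basis. G [s, b] *\<^sub>R b)" for s
  have L: "L s \<bullet> v = G [s, v]" for s v
  proof -
    have "G [s, v] = G [s, \<Sum>b\<in>Basis. (v \<bullet> b) *\<^sub>R b]" by (simp add: euclidean_representation)
    also have "\<dots> = L s \<bullet> v"
      by (simp only: G_simps(11) G_simps(12) G_simps(5,6))
         (simp add: L_def inner_sum_left inner_commute[of v] mult.commute)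
    finally show ?thesis by simp
  qed
  have "dim (L ` S) < DIM('e)"
    using assms dim_le_card'[OF finite_imageI[OF assms(1)], of L] card_image_le[OF assms(1), of L] by linarith
  then obtain v where v: "v \<noteq> 0" "\<And>y. y \<in> span (L ` S) \<Longrightarrow> orthogonal v y"
    using orthogonal_to_subspace_exists by blast
  have 0: "G [s, v] = 0" if "s \<in> S" for s
    using v(2)[of "L s"] that L[of s v] by (simp add: span_base orthogonal_def inner_commute)
  define w where "w = (1 / sqrt (G [v, v])) *\<^sub>R v"
  have "G [w, w] = 1" using G_pos[OF v(1)] by (simp add: w_def G_simps)
  moreover have "G [s, w] = 0" if "s \<in> S" for s using 0[OF that] by (simp add: w_def G_simps)
  ultimately show ?thesis using that by blast
qed

lemma orthonormal_list_exists:
  assumes "k \<le> DIM('e)"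
  shows "\<exists>es. length es = k \<and> (\<forall>p<k. \<forall>q<k. G [es ! p, es ! q] = (if p = q then 1 else 0))"
  using assms
proof (induction k)
  case (Suc k)
  then obtain es where es: "length es = k" "\<And>p q. p < k \<Longrightarrow> q < k \<Longrightarrow> G [es ! p, es ! q] = (if p = q then 1 else 0)"
    by auto
  have "card (set es) < DIM('e)" using Suc.prems card_length[of es] es(1) by simp
  then obtain v where v: "G [v, v] = 1" "\<And>s. s \<in> set es \<Longrightarrow> G [s, v] = 0"
    using unit_orthogonal_exists[of "set es"] by auto
  have "G [v, s] = 0" if "s \<in> set es" for s using v(2)[OF that] G_commute by simp
  then have "\<forall>p<Suc k. \<forall>q<Suc k. G [(es @ [v]) ! p, (es @ [v]) ! q] = (if p = q then 1 else 0)"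
    using v es by (auto simp: nth_append less_Suc_eq)
  then show ?case using es(1) by (intro exI[of _ "es @ [v]"]) simp
qed simp

lemma orthonormal_frame_exists: "\<exists>es. orthonormal_frame G es"
  using orthonormal_list_exists[of "DIM('e)"] by (simp add: orthonormal_frame_def)

lemma orthonormal_frame_onb:
  obtains es where "orthonormal_frame G es" "onb G = set es"
  using someI_ex[OF orthonormal_frame_exists] unfolding onb_def by blast

lemma orthonormal_frame_distinct:
  assumes "orthonormal_frame G es"
  shows "distinct es"
proof (rule ccontr)
  assume "\<not> distinct es"
  then obtain i j where "i < length es" "j < length es" "i \<noteq> j" "es ! i = es ! j"
    by (auto simp: distinct_conv_nth)
  then show False using assms unfolding orthonormal_frame_def by (metis zero_neq_one)
qed

lemma orthonormal_frame_G:
  assumes "orthonormal_frame G es" "e \<in> set es" "e' \<in> set es"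
  shows "G [e, e'] = (if e = e' then 1 else 0)"
  using assms orthonormal_frame_distinct[OF assms(1)] unfolding orthonormal_frame_def in_set_conv_nth
  by (auto simp: nth_eq_iff_index_eq)

lemma span_orthonormal_frame:
  assumes "orthonormal_frame G es"
  shows "span (set es) = UNIV"
proof -
  have "independent (set es)"
  proof (rule independent_if_scalars_zero)
    fix f x assume s: "(\<Sum>x\<in>set es. f x *\<^sub>R x) = 0" and x: "x \<in> set es"
    have "0 = G [\<Sum>y\<in>set es. f y *\<^sub>R y, x]" using s by (simp add: G_simps)
    also have "\<dots> = (\<Sum>y\<in>set es. f y * G [y, x])" by (simp only: G_simps real_scaleR_def)
    also have "\<dots> = (\<Sum>y\<in>set es. if y = x then f y else 0)"
      by (intro sum.cong refl) (use orthonormal_frame_G[OF assms _ x] in auto)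
    also have "\<dots> = f x" using x by simp
    finally show "f x = 0" by simp
  qed simp
  moreover have "card (set es) = DIM('e)"
    using orthonormal_frame_distinct[OF assms] assms by (simp add: distinct_card orthonormal_frame_def)
  ultimately show ?thesis
    by (metis card_eq_dim dim_UNIV finite_set subset_UNIV top.extremum_uniqueI)
qed

lemma orthonormal_frame_expand:
  assumes "orthonormal_frame G es"
  shows "(\<Sum>e\<in>set es. G [v, e] *\<^sub>R e) = v"
proof -
  define z where "z = (\<Sum>e\<in>set es. G [v, e] *\<^sub>R e) - v"
  have "G [z, e] = 0" if "e \<in> set es" for e
  proof -
    have "G [\<Sum>e\<in>set es. G [v, e] *\<^sub>R e, e] = (\<Sum>y\<in>set es. G [v, y] * G [y, e])"
      by (simp only: G_simps real_scaleR_def)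
    also have "\<dots> = (\<Sum>y\<in>set es. if y = e then G [v, y] else 0)"
      by (intro sum.cong refl) (use orthonormal_frame_G[OF assms _ that] in auto)
    finally show ?thesis using that by (simp add: z_def G_simps)
  qed
  then have "G [z, w] = 0" for w
    using linear_eq_0_on_span[OF linear_G(2)[of z], of "set es" w] span_orthonormal_frame[OF assms] by simp
  then have "z = 0" by (rule G_eq_0I)
  then show ?thesis by (simp add: z_def)
qed

text \<open>Expanding one argument in the second frame and resumming in the first moves the trace
  from one frame to the other. This is what makes contractions over the unspecified
  \<open>onb\<close> computable.\<close>

lemma bilinear_sum_frame_indep:
  fixes \<beta> :: "'e \<Rightarrow> 'e \<Rightarrow> 'a::real_normed_vector"
  assumes \<beta>: "bilinear \<beta>" and es: "orthonormal_frame G es" and fs: "orthonormal_frame G fs"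
  shows "(\<Sum>e\<in>set es. \<beta> e e) = (\<Sum>f\<in>set fs. \<beta> f f)"
proof -
  have l: "linear (\<beta> v)" "linear (\<lambda>v. \<beta> v w)" for v w using \<beta> by (auto simp: bilinear_def)
  have "(\<Sum>e\<in>set es. \<beta> e e) = (\<Sum>e\<in>set es. \<beta> e (\<Sum>f\<in>set fs. G [e, f] *\<^sub>R f))"
    by (simp add: orthonormal_frame_expand[OF fs])
  also have "\<dots> = (\<Sum>e\<in>set es. \<Sum>f\<in>set fs. G [e, f] *\<^sub>R \<beta> e f)"
    by (simp add: linear_sum[OF l(1)] linear_scale[OF l(1)])
  also have "\<dots> = (\<Sum>f\<in>set fs. \<Sum>e\<in>set es. G [f, e] *\<^sub>R \<beta> e f)"
    by (subst sum.swap) (simp add: G_commute)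
  also have "\<dots> = (\<Sum>f\<in>set fs. \<beta> (\<Sum>e\<in>set es. G [f, e] *\<^sub>R e) f)"
    by (simp add: linear_sum[OF l(2)] linear_scale[OF l(2)])
  also have "\<dots> = (\<Sum>f\<in>set fs. \<beta> f f)"
    by (simp add: orthonormal_frame_expand[OF es])
  finally show ?thesis .
qed

lemma onb_expand: "(\<Sum>e\<in>onb G. G [v, e] *\<^sub>R e) = v"
  using orthonormal_frame_onb orthonormal_frame_expand by metis

lemma onb_Parseval: "(\<Sum>e\<in>onb G. (G [v, e])\<^sup>2) = G [v, v]"
proof -
  have "G [v, v] = G [v, \<Sum>e\<in>onb G. G [v, e] *\<^sub>R e]" by (simp add: onb_expand)
  also have "\<dots> = (\<Sum>e\<in>onb G. (G [v, e])\<^sup>2)" by (simp only: G_simps real_scaleR_def power2_eq_square)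
  finally show ?thesis by simp
qed

end

section \<open>Contractions over tuples of frame vectors and the Hodge star\<close>

abbreviation tuples :: "'b set \<Rightarrow> nat \<Rightarrow> 'b list set" where
  "tuples B k \<equiv> {us. set us \<subseteq> B \<and> length us = k}"

lemma sum_lists_Suc:
  assumes "finite B"
  shows "(\<Sum>es\<in>tuples B (Suc k). h es) =
    (\<Sum>e\<in>B. \<Sum>es\<in>tuples B k. h (e # es))"
proof -
  let ?L = "{es. set es \<subseteq> B \<and> length es = k}"
  have "(\<Sum>es\<in>tuples B (Suc k). h es) = (\<Sum>(es, e)\<in>?L \<times> B. h (e # es))"
    unfolding lists_length_Suc_eq by (subst sum.reindex) (auto simp: inj_on_def case_prod_beta)
  also have "\<dots> = (\<Sum>es\<in>?L. \<Sum>e\<in>B. h (e # es))" by (simp add: sum.cartesian_product)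
  finally show ?thesis using sum.swap by simp
qed

lemma sum_lists_0: "(\<Sum>es\<in>tuples B 0. h es) = h []"
proof -
  have "{es. set es \<subseteq> B \<and> length es = 0} = {[]}" by auto
  then show ?thesis by simp
qed

lemma sum_lists_3:
  assumes "finite B"
  shows "(\<Sum>es\<in>tuples B 3. h es) = (\<Sum>e\<in>B. \<Sum>e'\<in>B. \<Sum>e''\<in>B. h [e, e', e''])"
  using assms by (simp only: numeral_3_eq_3 sum_lists_Suc sum_lists_0)

context inner_form
begin

text \<open>One index at a time: for a fixed frame in the remaining indices, the first contraction
  is the trace of a bilinear map.\<close>

lemma multilinear_sum_frame_indep:
  fixes \<alpha> \<beta> :: "'e list \<Rightarrow> real"
  assumes "multilinear k \<alpha>" "multilinear k \<beta>" and es: "orthonormal_frame G es" and fs: "orthonormal_frame G fs"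
  shows "(\<Sum>us\<in>tuples (set es) k. \<alpha> us * \<beta> us) =
         (\<Sum>us\<in>tuples (set fs) k. \<alpha> us * \<beta> us)"
  using assms(1,2)
proof (induction k arbitrary: \<alpha> \<beta>)
  case 0 show ?case by (simp only: sum_lists_0)
next
  case (Suc k)
  let ?b = "\<lambda>u v. \<Sum>us\<in>tuples (set fs) k. \<alpha> (u # us) * \<beta> (v # us)"
  have "bilinear ?b"
    unfolding bilinear_def
  proof (intro conjI allI linear_compose_sum ballI)
    fix x us assume "us \<in> tuples (set fs) k"
    then have "linear (\<lambda>v. \<alpha> (v # us))" "linear (\<lambda>v. \<beta> (v # us))" using Suc.prems by (auto simp: multilinear_SucD)
    then show "linear (\<lambda>v. \<alpha> (x # us) * \<beta> (v # us))" "linear (\<lambda>u. \<alpha> (u # us) * \<beta> (x # us))"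
      by (auto simp: linear_iff distrib_left distrib_right)
  qed
  note b = bilinear_sum_frame_indep[OF this es fs]
  have "(\<Sum>us\<in>tuples (set es) (Suc k). \<alpha> us * \<beta> us) = (\<Sum>e\<in>set es. ?b e e)"
    unfolding sum_lists_Suc[OF finite_set]
    by (intro sum.cong refl Suc.IH multilinear_SucD Suc.prems)
  also have "\<dots> = (\<Sum>us\<in>tuples (set fs) (Suc k). \<alpha> us * \<beta> us)"
    unfolding sum_lists_Suc[OF finite_set] b ..
  finally show ?case .
qed

text \<open>Allows the star to be evaluated in a frame adapted to the geometry.\<close>

lemma hodge_frame:
  assumes "multilinear k \<alpha>" "multilinear (k + m) \<mu>" "length ws = m" "orthonormal_frame G es"
  shows "hodge G \<mu> k \<alpha> ws = (\<Sum>us\<in>tuples (set es) k. \<alpha> us * \<mu> (us @ ws)) / fact k"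
proof -
  have "multilinear k (\<lambda>us. \<mu> (us @ ws))" by (rule multilinear_append_right[OF assms(2,3)])
  moreover obtain bs where "orthonormal_frame G bs" "onb G = set bs" by (rule orthonormal_frame_onb)
  ultimately show ?thesis
    unfolding hodge_def using multilinear_sum_frame_indep[OF assms(1), of "\<lambda>us. \<mu> (us @ ws)" bs es] assms(4)
    by simp
qed

text \<open>The sum of the squares of all frame components of a top-degree form is independent of the frame;
  its nonzero terms are the squares of the values on the permutations of the frame.\<close>

lemma alternating_frame_square:
  assumes F: "multilinear DIM('e) F" "alternating DIM('e) F"
    and es: "orthonormal_frame G es" and fs: "orthonormal_frame G fs"
  shows "(F es :: real)\<^sup>2 = (F fs)\<^sup>2"
proof -
  let ?n = "DIM('e)"
  let ?P = "{idx. length idx = ?n \<and> distinct idx \<and> set idx \<subseteq> {..<?n}}"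
  have *: "(\<Sum>us\<in>tuples (set bs) ?n. F us * F us) = of_nat (card ?P) * (F bs)\<^sup>2"
    if bs: "orthonormal_frame G bs" for bs
  proof -
    let ?A = "{us. set us \<subseteq> set bs \<and> length us = ?n}" and ?h = "map ((!) bs)"
    have len: "length bs = ?n" using bs by (simp add: orthonormal_frame_def)
    have finA: "finite ?A" using finite_lists_length_eq[of "set bs" ?n] by simp
    have d: "distinct bs" using orthonormal_frame_distinct[OF bs] .
    have sub: "?h ` ?P \<subseteq> ?A" using len by (auto simp: nth_mem subset_iff)
    have out: "F us * F us = 0" if "us \<in> ?A - ?h ` ?P" for us
    proof -
      have "\<not> distinct us"
      proof
        assume dus: "distinct us"
        have "\<forall>u\<in>set us. \<exists>p<?n. u = bs ! p" 
        proof
          fix u assume "u \<in> set us"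
          then have "u \<in> set bs" using that by auto
          then show "\<exists>p<?n. u = bs ! p" unfolding in_set_conv_nth len by metis
        qed
        then obtain q where q: "\<And>u. u \<in> set us \<Longrightarrow> q u < ?n \<and> u = bs ! q u" by metis
        have "us = ?h (map q us)" using q by (auto simp: o_def intro!: map_idI[symmetric])
        moreover have "inj_on q (set us)" by (rule inj_onI) (metis q)
        then have "map q us \<in> ?P" using q that dus by (auto simp: distinct_map)
        ultimately show False using that by blast
      qed
      then show ?thesis using F(2) that by (simp add: alternating_def)
    qed
    have sort: "sort idx = [0..<?n]" if "idx \<in> ?P" for idx
      using that by (intro sort_permutation) auto
    have val: "F (?h idx) * F (?h idx) = (F bs)\<^sup>2" if "idx \<in> ?P" for idx
    proof -
      have "F (?h idx) = list_sign idx * F (?h (sort idx))"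
        using alternating_sort[OF F, of idx "(!) bs"] that by simp
      also have "?h (sort idx) = bs" using sort[OF that] map_nth[of bs] len by simp
      finally show ?thesis using list_sign_square[of idx] by (simp add: power2_eq_square mult_ac)
    qed
    have inj: "inj_on ?h ?P"
      by (rule inj_onI, rule nth_equalityI) (auto simp: list_eq_iff_nth_eq nth_eq_iff_index_eq[OF d] len subset_iff)
    have "(\<Sum>us\<in>?A. F us * F us) = (\<Sum>us\<in>?h ` ?P. F us * F us)"
      by (rule sum.mono_neutral_right[OF finA sub]) (use out in blast)
    also have "\<dots> = (\<Sum>idx\<in>?P. F (?h idx) * F (?h idx))" using inj by (simp add: sum.reindex)
    also have "\<dots> = (\<Sum>idx\<in>?P. (F bs)\<^sup>2)" using val by (intro sum.cong) auto
    finally show ?thesis by simp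
  qed
  have "finite ?P" using finite_lists_length_eq[of "{..<?n}" ?n]
    by (rule rev_finite_subset) auto
  moreover have "[0..<?n] \<in> ?P" by auto
  ultimately have "card ?P \<noteq> 0" by (metis card_0_eq empty_iff)
  then show ?thesis using *[OF es] *[OF fs] multilinear_sum_frame_indep[OF F(1) F(1) es fs] by simp
qed

end


subsection \<open>Linear \<open>SU(3)\<close>-structures\<close>

text \<open>Separated from the Hermitian structure because it is instantiated both by \<Omega> and
  by its covariant derivative, whose proportionality is \<open>form_3_0_eq\<close>. Complex
  linearity in the other two slots follows from alternation.\<close>

locale form_3_0 =
  fixes J :: "'e::real_vector \<Rightarrow> 'e" and \<Omega> :: "'e list \<Rightarrow> complex"
  assumes multilinear_\<Omega>: "multilinear 3 \<Omega>" and alternating_\<Omega>: "alternating 3 \<Omega>"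
    and \<Omega>_J: "\<Omega> [J u, v, w] = \<i> * \<Omega> [u, v, w]"
begin

lemmas \<Omega>_swap = alternating_3_swap[OF multilinear_\<Omega> alternating_\<Omega>]

lemma \<Omega>_repeat [simp]: "\<Omega> [u, u, w] = 0" "\<Omega> [u, w, u] = 0" "\<Omega> [w, u, u] = 0"
  using alternating_\<Omega> by (auto simp: alternating_def)

lemma \<Omega>_J_simps: "\<Omega> [J u, v, w] = \<i> * \<Omega> [u, v, w]" "\<Omega> [u, J v, w] = \<i> * \<Omega> [u, v, w]"
  "\<Omega> [u, v, J w] = \<i> * \<Omega> [u, v, w]"
proof -
  show *: "\<Omega> [J u, v, w] = \<i> * \<Omega> [u, v, w]" for u v w by (rule \<Omega>_J)
  show **: "\<Omega> [u, J v, w] = \<i> * \<Omega> [u, v, w]" for u v w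
    using *[of v u w] \<Omega>_swap(1)[of u "J v" w] \<Omega>_swap(1)[of u v w] by simp
  show "\<Omega> [u, v, J w] = \<i> * \<Omega> [u, v, w]"
    using **[of u w v] \<Omega>_swap(2)[of u v "J w"] \<Omega>_swap(2)[of u v w] by simp
qed

lemma linear_\<Omega>: "linear (\<lambda>v. \<Omega> [v, a, b])" "linear (\<lambda>v. \<Omega> [a, v, b])" "linear (\<lambda>v. \<Omega> [a, b, v])"
  using multilinear_\<Omega> by (simp_all add: multilinear_3)

end

locale hermitian_form = inner_form G for G :: "'e::euclidean_space list \<Rightarrow> real" +
  fixes J :: "'e \<Rightarrow> 'e" and \<omega> :: "'e list \<Rightarrow> real"
  assumes linear_J: "linear J" and J_J: "J (J v) = - v" and G_J_J: "G [J u, J v] = G [u, v]"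
    and \<omega>_eq: "\<omega> [u, v] = G [J u, v]"
begin

lemma G_J_right: "G [u, J v] = - G [J u, v]"
  using G_J_J[of u "J v"] by (simp add: J_J G_simps)

lemma G_J_self [simp]: "G [J u, u] = 0" "G [u, J u] = 0"
  using G_J_right[of u u] G_commute[of u "J u"] by auto

lemma \<omega>_commute: "\<omega> [u, v] = - \<omega> [v, u]"
  using G_J_right[of v u] G_commute[of "J u" v] by (simp add: \<omega>_eq)

lemma multilinear_\<omega>: "multilinear 2 \<omega>"
  using linear_J by (auto simp: multilinear_2 \<omega>_eq linear_iff G_simps)

lemma alternating_\<omega>: "alternating 2 \<omega>"
  by (auto simp: alternating_def numeral_2_eq_2 length_Suc_conv \<omega>_eq)

end

text \<open>\<open>vol\<close> is kept abstract: the linear algebra uses its normalisation on frames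
  and its relation to \<Omega>. Its expression through \<omega> enters only where it is
  differentiated.\<close>

locale su3_form = hermitian_form G J \<omega> + form_3_0 J \<Omega>
  for G :: "(real^6) list \<Rightarrow> real" and J :: "real^6 \<Rightarrow> real^6" and \<Omega> :: "(real^6) list \<Rightarrow> complex"
    and \<omega> :: "(real^6) list \<Rightarrow> real" +
  fixes vol :: "(real^6) list \<Rightarrow> real"
  assumes multilinear_vol: "multilinear 6 vol" and alternating_vol: "alternating 6 vol"
    and vol_frame: "orthonormal_frame G es \<Longrightarrow> \<bar>vol es\<bar> = 1"
    and vol_\<Omega>: "length vs = 6 \<Longrightarrow>
      complex_of_real (vol vs) = \<i> / 8 * wedge 3 \<Omega> (\<lambda>us. cnj (\<Omega> us)) vs"
begin

definition J_frame :: "real^6 \<Rightarrow> real^6 \<Rightarrow> real^6 \<Rightarrow> (real^6) list" where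
  "J_frame a b c = [a, J a, b, J b, c, J c]"

text \<open>Since \<open>J\<close> is a skew isometry, these nine entries determine the whole Gram
  matrix.\<close>

lemma orthonormal_J_frame_iff:
  "orthonormal_frame G (J_frame a b c) \<longleftrightarrow>
     G [a, a] = 1 \<and> G [b, b] = 1 \<and> G [c, c] = 1 \<and> G [a, b] = 0 \<and> G [J a, b] = 0 \<and>
     G [a, c] = 0 \<and> G [J a, c] = 0 \<and> G [b, c] = 0 \<and> G [J b, c] = 0"
  (is "?L \<longleftrightarrow> ?R")
proof
  assume L: ?L
  then have *: "G [J_frame a b c ! p, J_frame a b c ! q] = (if p = q then 1 else 0)" if "p < 6" "q < 6" for p q
    using that by (simp add: orthonormal_frame_def)
  show ?R
    using *[of 0 0] *[of 2 2] *[of 4 4] *[of 0 2] *[of 1 2] *[of 0 4] *[of 1 4] *[of 2 4] *[of 3 4]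
    by (simp add: J_frame_def)
next
  assume R: ?R
  have 1: "G [b, a] = 0" "G [c, a] = 0" "G [c, b] = 0" using R G_commute[of b a] G_commute[of c a] G_commute[of c b] by simp_all
  have 2: "G [J b, a] = 0" "G [J c, a] = 0" "G [J c, b] = 0"
    using R G_J_right[of b a] G_J_right[of c a] G_J_right[of c b] G_commute[of b "J a"] G_commute[of c "J a"]
      G_commute[of c "J b"] by simp_all
  have "p < 6 \<Longrightarrow> p = 0 \<or> p = 1 \<or> p = 2 \<or> p = 3 \<or> p = 4 \<or> p = 5" for p :: nat by arith
  moreover have "G [J_frame a b c ! p, J_frame a b c ! q] = (if p = q then 1 else 0)"
    if "p = 0 \<or> p = 1 \<or> p = 2 \<or> p = 3 \<or> p = 4 \<or> p = 5" "q = 0 \<or> q = 1 \<or> q = 2 \<or> q = 3 \<or> q = 4 \<or> q = 5"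
    for p q
    using that by (elim disjE) (simp_all add: J_frame_def R 1 2 G_J_J G_J_right J_J G_simps)
  ultimately show ?L by (simp add: orthonormal_frame_def J_frame_def)
qed

lemma J_frame_exists: "\<exists>a b c. orthonormal_frame G (J_frame a b c)"
proof -
  obtain a where a: "G [a, a] = 1" using unit_orthogonal_exists[of "{}"] by auto
  have "card {a, J a} < DIM(real^6)" using card_length[of "[a, J a]"] by simp
  then obtain b where b: "G [b, b] = 1" "G [a, b] = 0" "G [J a, b] = 0"
    by (rule unit_orthogonal_exists[rotated]) auto
  have "card {a, J a, b, J b} < DIM(real^6)" using card_length[of "[a, J a, b, J b]"] by simp
  then obtain c where "G [c, c] = 1" "G [a, c] = 0" "G [J a, c] = 0" "G [b, c] = 0" "G [J b, c] = 0"
    by (rule unit_orthogonal_exists[rotated]) auto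
  then show ?thesis using a b by (auto simp: orthonormal_J_frame_iff)
qed

text \<open>On such a frame the wedge product of \<Omega> and its conjugate is
  \<open>- 8 * \<i>\<close> times the squared modulus of \<open>\<Omega> [a, b, c]\<close>. Hence
  \<open>vol\<close> is nonnegative there, and its absolute value 1 fixes both the orientation and
  the modulus.\<close>

lemma vol_J_frame:
  assumes "orthonormal_frame G (J_frame a b c)"
  shows "vol (J_frame a b c) = 1" "cmod (\<Omega> [a, b, c]) = 1"
proof -
  have "wedge 3 \<Omega> (\<lambda>us. cnj (\<Omega> us)) (J_frame a b c) = - 8 * \<i> * (\<Omega> [a, b, c] * cnj (\<Omega> [a, b, c]))"
    by (simp add: J_frame_def numeral_3_eq_3 wedge_Cons wedge_Nil \<Omega>_J_simps)
  then have "complex_of_real (vol (J_frame a b c)) = \<Omega> [a, b, c] * cnj (\<Omega> [a, b, c])"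
    using vol_\<Omega>[of "J_frame a b c"] by (simp add: J_frame_def)
  then have *: "vol (J_frame a b c) = (cmod (\<Omega> [a, b, c]))\<^sup>2"
    by (simp only: complex_norm_square[symmetric] of_real_eq_iff)
  then show 1: "vol (J_frame a b c) = 1" using vol_frame[OF assms] by simp
  show "cmod (\<Omega> [a, b, c]) = 1" using * 1 norm_ge_zero[of "\<Omega> [a, b, c]"] by (auto simp: power2_eq_1_iff)
qed

lemma unit_J_frame_exists: "\<exists>a b c. orthonormal_frame G (J_frame a b c) \<and> \<Omega> [a, b, c] = 1"
proof -
  obtain a b c where f: "orthonormal_frame G (J_frame a b c)" using J_frame_exists by blast
  define z where "z = \<Omega> [a, b, c]"
  have z: "cmod z = 1" using vol_J_frame(2)[OF f] by (simp add: z_def)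
  then have xy: "Re z * Re z + Im z * Im z = 1" using cmod_power2[of z] by (simp add: power2_eq_square)
  \<comment> \<open>With \<open>J\<close> acting as multiplication by the imaginary unit, this is
    \<open>cnj z\<close> times \<open>a\<close>; it removes the phase of \<open>z\<close>.\<close>
  define a' where "a' = Re z *\<^sub>R a - Im z *\<^sub>R J a"
  have "\<Omega> [a', b, c] = (Re z - \<i> * Im z) * z"
    by (simp add: a'_def linear_diff[OF linear_\<Omega>(1)] linear_scale[OF linear_\<Omega>(1)] \<Omega>_J_simps
        scaleR_conv_of_real[where 'a = complex] algebra_simps flip: z_def)
  also have "Re z - \<i> * Im z = cnj z" by (simp add: complex_eq_iff)
  also have "cnj z * z = 1" using z complex_norm_square[of z] by (simp add: mult.commute)
  finally have "\<Omega> [a', b, c] = 1" .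
  moreover have "orthonormal_frame G (J_frame a' b c)"
    using f xy by (simp add: orthonormal_J_frame_iff a'_def G_simps linear_diff[OF linear_J]
      linear_scale[OF linear_J] J_J G_J_J)
  ultimately show ?thesis by blast
qed

end

section \<open>The Hodge star and the line of (3,0)-forms\<close>

lemma triple_less_6_cases:
  assumes "i < j" "j < k" "k < (6::nat)"
    "P 0 1 2" "P 0 1 3" "P 0 1 4" "P 0 1 5" "P 0 2 3" "P 0 2 4" "P 0 2 5" "P 0 3 4" "P 0 3 5" "P 0 4 5"
    "P 1 2 3" "P 1 2 4" "P 1 2 5" "P 1 3 4" "P 1 3 5" "P 1 4 5" "P 2 3 4" "P 2 3 5" "P 2 4 5" "P 3 4 5"
  shows "P i j k"
  using assms by (auto simp: eval_nat_numeral less_Suc_eq)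

text \<open>Meant for a product of two alternating factors, which is symmetric and vanishes on
  repeated indices: 216 terms reduce to 20.\<close>

lemma symmetric_sum_6:
  fixes T :: "nat \<Rightarrow> nat \<Rightarrow> nat \<Rightarrow> complex"
  assumes "\<And>p q r. T p q r = T q p r" "\<And>p q r. T p q r = T p r q" "\<And>p q. T p p q = 0"
  shows "(\<Sum>p<6. \<Sum>q<6. \<Sum>r<6. T p q r) = 6 *
    (T 0 1 2 + T 0 1 3 + T 0 1 4 + T 0 1 5 + T 0 2 3 + T 0 2 4 + T 0 2 5 + T 0 3 4 + T 0 3 5 + T 0 4 5 +
     T 1 2 3 + T 1 2 4 + T 1 2 5 + T 1 3 4 + T 1 3 5 + T 1 4 5 + T 2 3 4 + T 2 3 5 + T 2 4 5 + T 3 4 5)"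
proof -
  have z: "T p p q = 0" "T p q p = 0" "T q p p = 0" for p q using assms by metis+
  have I: "{..<6::nat} = {0, 1, 2, 3, 4, 5}" by auto
  have o: "q < p \<Longrightarrow> T p q r = T q p r" "q < p \<Longrightarrow> T r p q = T r q p" for p q r
    using assms by blast+
  show ?thesis unfolding I by (simp add: z o)
qed

context su3_form
begin

text \<open>The real part of the identity \<open>\<star>\<Omega> = - i \<Omega>\<close>.\<close>

lemma star_Re_\<Omega>:
  assumes "length ws = 3" and fs: "orthonormal_frame G fs"
  shows "(\<Sum>us\<in>tuples (set fs) 3. Re (\<Omega> us) * vol (us @ ws)) = 6 * Im (\<Omega> ws)"
proof -
  obtain a b c where f: "orthonormal_frame G (J_frame a b c)" and 1: "\<Omega> [a, b, c] = 1"
    using unit_J_frame_exists by blast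
  define e where "e = (!) (J_frame a b c)"
  have len: "length (J_frame a b c) = 6" by (simp add: J_frame_def)
  have dist: "distinct (J_frame a b c)" by (rule orthonormal_frame_distinct[OF f])
  have set_e: "set (J_frame a b c) = e ` {..<6}" by (auto simp: e_def set_conv_nth len)
  have inj_e: "inj_on e {..<6}" using dist by (auto simp: inj_on_def e_def nth_eq_iff_index_eq len)
  have map_e: "map e [0..<6] = J_frame a b c" using map_nth[of "J_frame a b c"] by (simp add: e_def len)
  have \<Omega>_e: "\<Omega> [e 0, e 2, e 4] = 1" "\<Omega> [e 0, e 2, e 5] = \<i>" "\<Omega> [e 0, e 3, e 4] = \<i>" "\<Omega> [e 0, e 3, e 5] = - 1"
     "\<Omega> [e 1, e 2, e 4] = \<i>" "\<Omega> [e 1, e 2, e 5] = - 1" "\<Omega> [e 1, e 3, e 4] = - 1" "\<Omega> [e 1, e 3, e 5] = - \<i>"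
     "\<Omega> [e 0, e 1, u] = 0" "\<Omega> [e 2, e 3, u] = 0" "\<Omega> [u, e 2, e 3] = 0" "\<Omega> [u, e 4, e 5] = 0" for u
    by (simp_all add: e_def J_frame_def \<Omega>_J_simps 1)
  have vol_e: "vol [e p, e q, e r, e i, e j, e k] =
      (if distinct [p, q, r, i, j, k] then list_sign [p, q, r, i, j, k] else 0)"
    if "p < 6" "q < 6" "r < 6" "i < 6" "j < 6" "k < 6" for p q r i j k
  proof (cases "distinct [p, q, r, i, j, k]")
    case True
    have "sort [p, q, r, i, j, k] = [0..<6]"
      using that by (intro sort_permutation[OF True]) simp_all
    then have "vol (map e [p, q, r, i, j, k]) = list_sign [p, q, r, i, j, k]"
      using alternating_sort[OF multilinear_vol alternating_vol _ True, of e] vol_J_frame(1)[OF f] map_e by simp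
    then show ?thesis using True by simp
  next
    case False
    then have "\<not> distinct [e p, e q, e r, e i, e j, e k]" by auto
    then show ?thesis using False alternating_vol by (auto simp: alternating_def)
  qed
  define T where "T ws p q r = \<Omega> [e p, e q, e r] * complex_of_real (vol ([e p, e q, e r] @ ws))" for ws p q r
  have T: "T ws p q r = T ws q p r" "T ws p q r = T ws p r q" "T ws p p q = 0"
    if "length ws = 3" for ws p q r
    using alternating_3_swap[of "\<lambda>us. vol (us @ ws)" "e p" "e q" "e r"] \<Omega>_swap[of "e p" "e q" "e r"]
      multilinear_append_right[of 3 3 vol ws] alternating_append_right[of 3 3 vol ws]
      multilinear_vol alternating_vol that
    by (simp_all add: T_def)
  \<comment> \<open>The factor 6 is 3!, from summing over ordered triples, and \<open>- \<i>\<close>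
    is the value by which the star acts on \<Omega>. As \<open>vol\<close> is real, the real part
    can be taken afterwards.\<close>
  have star: "(\<Sum>p<6. \<Sum>q<6. \<Sum>r<6. T ws p q r) = - 6 * \<i> * \<Omega> ws"
  proof (rule alternating_eqI[where e = e and n = 6 and k = 3])
    have ml: "multilinear 3 (\<lambda>ws. vol (us @ ws))" "alternating 3 (\<lambda>ws. vol (us @ ws))" if "length us = 3" for us
      using multilinear_append[of 3 3 vol us] alternating_append[of 3 3 vol us] that
        multilinear_vol alternating_vol by simp_all
    have ml': "multilinear 3 (\<lambda>ws. complex_of_real (vol (us @ ws)))" if "length us = 3" for us
      by (rule multilinear_compose[OF ml(1)[OF that]]) (simp add: linear_iff scaleR_conv_of_real)
    show "multilinear 3 (\<lambda>ws. \<Sum>p<6. \<Sum>q<6. \<Sum>r<6. T ws p q r)"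
      unfolding T_def by (intro multilinear_sum multilinear_cmult ml') simp
    show "alternating 3 (\<lambda>ws. \<Sum>p<6. \<Sum>q<6. \<Sum>r<6. T ws p q r)"
      unfolding alternating_def
    proof (intro allI impI)
      fix vs :: "(real^6) list" assume vs: "length vs = 3" "\<not> distinct vs"
      then have "vol (us @ vs) = 0" if "length us = 3" for us
        using ml(2)[OF that] by (simp add: alternating_def)
      from this[of "[_, _, _]"] have "T vs p q r = 0" for p q r by (simp add: T_def)
      then show "(\<Sum>p<6. \<Sum>q<6. \<Sum>r<6. T vs p q r) = 0" by simp
    qed
    show "multilinear 3 (\<lambda>ws. - 6 * \<i> * \<Omega> ws)" by (intro multilinear_cmult multilinear_\<Omega>)
    show "alternating 3 (\<lambda>ws. - 6 * \<i> * \<Omega> ws)" using alternating_\<Omega> by (simp add: alternating_def)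
    show "span (e ` {..<6}) = UNIV" using span_orthonormal_frame[OF f] by (simp add: set_e)
    show "length ws = 3" by fact
    fix idx :: "nat list" assume "length idx = 3" "sorted_wrt (<) idx" "set idx \<subseteq> {..<6}"
    then obtain i j k where ijk: "idx = [i, j, k]" "i < j" "j < k" "k < 6"
      by (auto simp: numeral_3_eq_3 length_Suc_conv)
    have "(\<Sum>p<6. \<Sum>q<6. \<Sum>r<6. T [e i, e j, e k] p q r) = - 6 * \<i> * \<Omega> [e i, e j, e k]"
      using ijk(2,3,4)
      by (rule triple_less_6_cases)
        (simp_all only: symmetric_sum_6[of "T [_, _, _]", OF T] list.size, simp_all add: T_def \<Omega>_e[unfolded One_nat_def] vol_e mult.assoc)
    then show "(\<Sum>p<6. \<Sum>q<6. \<Sum>r<6. T (map e idx) p q r) = - 6 * \<i> * \<Omega> (map e idx)"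
      using ijk(1) by simp
  qed
  let ?I = "tuples (set (J_frame a b c)) 3"
  have reindex: "(\<Sum>x\<in>set (J_frame a b c). h x) = (\<Sum>p<6. h (e p))" for h :: "_ \<Rightarrow> real"
    unfolding set_e using inj_e by (simp add: sum.reindex)
  have "(\<Sum>us\<in>tuples (set fs) 3. Re (\<Omega> us) * vol (us @ ws)) =
        (\<Sum>us\<in>?I. Re (\<Omega> us) * vol (us @ ws))"
  proof (rule multilinear_sum_frame_indep[OF _ _ fs f])
    show "multilinear 3 (\<lambda>us. Re (\<Omega> us))"
      by (rule multilinear_compose[OF multilinear_\<Omega>]) (simp add: linear_iff)
    show "multilinear 3 (\<lambda>us. vol (us @ ws))"
      using multilinear_append_right[of 3 3 vol ws] multilinear_vol \<open>length ws = 3\<close> by simp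
  qed
  also have "\<dots> = (\<Sum>p<6. \<Sum>q<6. \<Sum>r<6. Re (T ws p q r))"
    by (simp add: sum_lists_3 reindex T_def)
  also have "\<dots> = Re (\<Sum>p<6. \<Sum>q<6. \<Sum>r<6. T ws p q r)" by simp
  also have "\<dots> = 6 * Im (\<Omega> ws)" by (simp add: star)
  finally show ?thesis .
qed

text \<open>In complex dimension three the (3,0)-forms are a line: complex linearity reduces a frame
  triple to \<open>(a, b, c)\<close>, and two vectors on the same complex line give zero.\<close>

lemma form_3_0_eq:
  assumes "form_3_0 J F" and f: "orthonormal_frame G (J_frame a b c)" and 1: "\<Omega> [a, b, c] = 1"
    and "length vs = 3"
  shows "F vs = F [a, b, c] * \<Omega> vs"
proof -
  interpret F: form_3_0 J F by fact
  define e where "e = (!) (J_frame a b c)"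
  have set_e: "set (J_frame a b c) = e ` {..<6}" by (auto simp: e_def set_conv_nth J_frame_def)
  show ?thesis
  proof (rule alternating_eqI[OF F.multilinear_\<Omega> F.alternating_\<Omega> _ _ _ _ \<open>length vs = 3\<close>])
    show "multilinear 3 (\<lambda>vs. F [a, b, c] * \<Omega> vs)" by (intro multilinear_cmult multilinear_\<Omega>)
    show "alternating 3 (\<lambda>vs. F [a, b, c] * \<Omega> vs)" using alternating_\<Omega> by (simp add: alternating_def)
    show "span (e ` {..<6}) = UNIV" using span_orthonormal_frame[OF f] by (simp add: set_e)
    fix idx :: "nat list" assume "length idx = 3" "sorted_wrt (<) idx" "set idx \<subseteq> {..<6}"
    then obtain i j k where ijk: "idx = [i, j, k]" "i < j" "j < k" "k < 6"
      by (auto simp: numeral_3_eq_3 length_Suc_conv)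
    have "F [e i, e j, e k] = F [a, b, c] * \<Omega> [e i, e j, e k]"
      using ijk(2,3,4)
      by (rule triple_less_6_cases) (simp_all add: e_def J_frame_def \<Omega>_J_simps F.\<Omega>_J_simps 1)
    then show "F (map e idx) = F [a, b, c] * \<Omega> (map e idx)" using ijk(1) by simp
  qed
qed

end


subsection \<open>The Levi-Civita connection in a chart\<close>

abbreviation Der :: "('a::real_normed_vector \<Rightarrow> 'b::real_normed_vector) \<Rightarrow> 'a \<Rightarrow> 'a \<Rightarrow> 'b" where
  "Der f x \<equiv> frechet_derivative f (at x)"

lemma has_derivative_cong_open:
  assumes "open S" "x \<in> S" "\<And>y. y \<in> S \<Longrightarrow> f y = h y"
  shows "(f has_derivative D) (at x) \<longleftrightarrow> (h has_derivative D) (at x)"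
  using assms by (metis has_derivative_transform_within_open)

lemma Der_cong_open:
  assumes "open S" "x \<in> S" "\<And>y. y \<in> S \<Longrightarrow> f y = h y"
  shows "Der f x = Der h x"
  by (simp add: frechet_derivative_def has_derivative_cong_open[OF assms])

lemma differentiable_cong_open:
  assumes "open S" "x \<in> S" "\<And>y. y \<in> S \<Longrightarrow> f y = h y"
  shows "f differentiable (at x) \<longleftrightarrow> h differentiable (at x)"
  by (simp add: differentiable_def has_derivative_cong_open[OF assms])

lemma Der_eqI:
  "(f has_derivative D) (at x) \<Longrightarrow> Der f x u = D u"
  by (metis frechet_derivative_at)

lemma linear_Der_param:
  fixes L :: "'x::real_normed_vector \<Rightarrow> 'v::real_vector \<Rightarrow> 'a::real_normed_vector"
  assumes S: "open S" "x \<in> S" and lin: "\<And>y. y \<in> S \<Longrightarrow> linear (L y)"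
    and diff: "\<And>v. (\<lambda>y. L y v) differentiable (at x)"
  shows "linear (\<lambda>v. Der (\<lambda>y. L y v) x u)"
proof (rule linearI)
  note d = diff[unfolded frechet_derivative_works]
  fix v w :: 'v and c :: real
  have "((\<lambda>y. L y v + L y w) has_derivative
      (\<lambda>u. Der (\<lambda>y. L y v) x u + Der (\<lambda>y. L y w) x u)) (at x)"
    by (intro has_derivative_add d)
  moreover have "Der (\<lambda>y. L y (v + w)) x = Der (\<lambda>y. L y v + L y w) x"
    by (rule Der_cong_open[OF S]) (simp add: linear_add[OF lin])
  ultimately show "Der (\<lambda>y. L y (v + w)) x u =
      Der (\<lambda>y. L y v) x u + Der (\<lambda>y. L y w) x u"
    by (simp add: Der_eqI)
  have "((\<lambda>y. c *\<^sub>R L y v) has_derivative (\<lambda>u. c *\<^sub>R Der (\<lambda>y. L y v) x u)) (at x)"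
    by (intro has_derivative_scaleR_right d)
  moreover have "Der (\<lambda>y. L y (c *\<^sub>R v)) x = Der (\<lambda>y. c *\<^sub>R L y v) x"
    by (rule Der_cong_open[OF S]) (simp add: linear_scale[OF lin])
  ultimately show "Der (\<lambda>y. L y (c *\<^sub>R v)) x u = c *\<^sub>R Der (\<lambda>y. L y v) x u"
    by (simp add: Der_eqI)
qed

section \<open>Derivatives of tensors evaluated on moving arguments\<close>

definition diff_tensor_on ::
  "'x::real_normed_vector set \<Rightarrow> nat \<Rightarrow> ('x \<Rightarrow> 'v::real_vector list \<Rightarrow> 'a::real_normed_vector) \<Rightarrow> bool" where
  "diff_tensor_on S k F \<longleftrightarrow>
     (\<forall>x\<in>S. multilinear k (F x) \<and> (\<forall>vs. length vs = k \<longrightarrow> (\<lambda>y. F y vs) differentiable (at x)))"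

lemma multilinear_Der_param:
  assumes "open S" "x \<in> S" "diff_tensor_on S k F"
  shows "multilinear k (\<lambda>vs. Der (\<lambda>y. F y vs) x u)"
  unfolding multilinear_def
proof (intro allI impI)
  fix vs :: "'b list" and j assume "length vs = k" "j < k"
  then show "linear (\<lambda>v. Der (\<lambda>y. F y (vs[j := v])) x u)"
    using assms by (intro linear_Der_param[OF assms(1,2)])
      (auto simp: diff_tensor_on_def multilinear_def)
qed

text \<open>The product rule for a tensor and all its arguments. Expanding the first argument in the
  Euclidean basis leaves scalar coefficients times tensors with a constant first argument, to which
  the induction hypothesis applies.\<close>

lemma has_derivative_multilinear:
  fixes F :: "'x::real_normed_vector \<Rightarrow> 'v::euclidean_space list \<Rightarrow> 'a::real_normed_vector"
  assumes S: "open S" "x \<in> S"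
  assumes "diff_tensor_on S k F" "length ps = k" "length ps' = k"
    and "\<And>j. j < k \<Longrightarrow> (ps ! j has_derivative ps' ! j) (at x)"
  shows "((\<lambda>y. F y (map (\<lambda>p. p y) ps)) has_derivative
     (\<lambda>u. Der (\<lambda>y. F y (map (\<lambda>p. p x) ps)) x u +
        (\<Sum>j<k. F x ((map (\<lambda>p. p x) ps)[j := (ps' ! j) u])))) (at x)"
  using assms(3-)
proof (induction k arbitrary: F ps ps')
  case 0
  then show ?case
    using S by (auto simp: diff_tensor_on_def frechet_derivative_works)
next
  case (Suc k)
  obtain p qs where ps: "ps = p # qs" "length qs = k" using Suc.prems(2) by (auto simp: length_Suc_conv)
  obtain p' qs' where ps': "ps' = p' # qs'" "length qs' = k" using Suc.prems(3) by (auto simp: length_Suc_conv)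
  let ?Q = "\<lambda>y. map (\<lambda>p. p y) qs"
  let ?D = "\<lambda>v. Der (\<lambda>y. F y (v # ?Q x)) x"
  have p: "(p has_derivative p') (at x)" using Suc.prems(4)[of 0] ps ps' by simp
  have lin: "linear (\<lambda>v. F y (v # ws))" if "y \<in> S" "length ws = k" for y ws
    using Suc.prems(1) that by (auto simp: diff_tensor_on_def multilinear_SucD)
  have lin_D: "linear (\<lambda>v. ?D v u)" for u
    using Suc.prems(1) S ps lin by (intro linear_Der_param[OF S]) (auto simp: diff_tensor_on_def)
  have expand: "h v = (\<Sum>b\<in>Basis. (v \<bullet> b) *\<^sub>R h b)" if "linear h" for h :: "'v \<Rightarrow> 'a" and v
  proof -
    have "h v = h (\<Sum>b\<in>Basis. (v \<bullet> b) *\<^sub>R b)" by (simp add: euclidean_representation)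
    also have "\<dots> = (\<Sum>b\<in>Basis. (v \<bullet> b) *\<^sub>R h b)"
      by (simp only: linear_sum[OF that] linear_scale[OF that])
    finally show ?thesis .
  qed
  have IH: "((\<lambda>y. F y (b # ?Q y)) has_derivative
      (\<lambda>u. ?D b u + (\<Sum>j<k. F x (b # (?Q x)[j := (qs' ! j) u])))) (at x)" for b
    using Suc.prems ps ps' by (intro Suc.IH[of "\<lambda>y vs. F y (b # vs)" qs qs'])
      (force simp: diff_tensor_on_def multilinear_SucD)+
  have "((\<lambda>y. \<Sum>b\<in>Basis. (p y \<bullet> b) *\<^sub>R F y (b # ?Q y)) has_derivative
      (\<lambda>u. \<Sum>b\<in>Basis. (p x \<bullet> b) *\<^sub>R (?D b u + (\<Sum>j<k. F x (b # (?Q x)[j := (qs' ! j) u]))) +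
        (p' u \<bullet> b) *\<^sub>R F x (b # ?Q x))) (at x)"
    by (intro has_derivative_sum has_derivative_scaleR IH has_derivative_inner_left p)
  \<comment> \<open>Undoes the expansion at \<open>x\<close> in each of the three contributions: the
    derivative of the tensor, of the first argument and of the remaining ones.\<close>
  moreover have "(\<Sum>b\<in>Basis. (p x \<bullet> b) *\<^sub>R (?D b u + (\<Sum>j<k. F x (b # (?Q x)[j := (qs' ! j) u]))) +
        (p' u \<bullet> b) *\<^sub>R F x (b # ?Q x)) =
      ?D (p x) u + (\<Sum>j<Suc k. F x ((map (\<lambda>p. p x) ps)[j := (ps' ! j) u]))" for u
  proof -
    have "F x (p' u # ?Q x) = (\<Sum>b\<in>Basis. (p' u \<bullet> b) *\<^sub>R F x (b # ?Q x))"
      by (rule expand) (rule lin, use S ps in simp_all)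
    moreover have "?D (p x) u = (\<Sum>b\<in>Basis. (p x \<bullet> b) *\<^sub>R ?D b u)" by (rule expand[OF lin_D])
    moreover have "(\<Sum>j<k. F x (p x # (?Q x)[j := (qs' ! j) u])) =
        (\<Sum>b\<in>Basis. (p x \<bullet> b) *\<^sub>R (\<Sum>j<k. F x (b # (?Q x)[j := (qs' ! j) u])))"
      by (rule expand) (intro linear_compose_sum ballI lin, use S ps in simp_all)
    ultimately show ?thesis
      by (simp add: ps ps' sum.lessThan_Suc_shift sum.distrib scaleR_add_right del: sum.lessThan_Suc)
  qed
  ultimately have "((\<lambda>y. \<Sum>b\<in>Basis. (p y \<bullet> b) *\<^sub>R F y (b # ?Q y)) has_derivative
      (\<lambda>u. ?D (p x) u + (\<Sum>j<Suc k. F x ((map (\<lambda>p. p x) ps)[j := (ps' ! j) u])))) (at x)"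
    by simp
  moreover have "(\<Sum>b\<in>Basis. (p y \<bullet> b) *\<^sub>R F y (b # ?Q y)) = F y (map (\<lambda>p. p y) ps)" if "y \<in> S" for y
    using expand[OF lin[OF that, of "?Q y"], of "p y"] ps by simp
  ultimately have "((\<lambda>y. F y (map (\<lambda>p. p y) ps)) has_derivative
      (\<lambda>u. ?D (p x) u + (\<Sum>j<Suc k. F x ((map (\<lambda>p. p x) ps)[j := (ps' ! j) u])))) (at x)"
    by (rule has_derivative_transform_within_open[OF _ S])
  then show ?case using ps by simp
qed

lemma wedge_has_derivative:
  fixes A B :: "'x::real_normed_vector \<Rightarrow> 'v list \<Rightarrow> 'a::real_normed_field"
  assumes "\<And>us. length us = k \<Longrightarrow> ((\<lambda>y. A y us) has_derivative (\<lambda>u. A' u us)) (at x)"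
    and "\<And>us. length us + k = length vs \<Longrightarrow> ((\<lambda>y. B y us) has_derivative (\<lambda>u. B' u us)) (at x)"
  shows "((\<lambda>y. wedge k (A y) (B y) vs) has_derivative
     (\<lambda>u. wedge k (A' u) (B x) vs + wedge k (A x) (B' u) vs)) (at x)"
  using assms
proof (induction vs arbitrary: k A A' B B')
  case Nil
  show ?case
  proof (cases k)
    case 0
    have "((\<lambda>y. A y [] * B y []) has_derivative (\<lambda>u. A x [] * B' u [] + A' u [] * B x [])) (at x)"
      using Nil[of "[]"] 0 by (intro has_derivative_mult) auto
    then show ?thesis using 0 by (simp add: add.commute)
  qed (simp add: wedge_Nil)
next
  case (Cons v vs)
  have 1: "((\<lambda>y. wedge k (A y) (\<lambda>us. B y (v # us)) vs) has_derivative
      (\<lambda>u. wedge k (A' u) (\<lambda>us. B x (v # us)) vs + wedge k (A x) (\<lambda>us. B' u (v # us)) vs)) (at x)"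
    using Cons.prems by (intro Cons.IH) auto
  show ?case
  proof (cases k)
    case 0
    then show ?thesis using 1 by (simp add: wedge_Cons)
  next
    case (Suc k')
    have 2: "((\<lambda>y. wedge k' (\<lambda>us. A y (v # us)) (B y) vs) has_derivative
        (\<lambda>u. wedge k' (\<lambda>us. A' u (v # us)) (B x) vs + wedge k' (\<lambda>us. A x (v # us)) (B' u) vs)) (at x)"
      using Cons.prems Suc by (intro Cons.IH) auto
    show ?thesis
      using has_derivative_add[OF 2 has_derivative_mult_right[OF 1, of "(- 1) ^ k"]] Suc
      by (simp add: wedge_Cons algebra_simps)
  qed
qed

section \<open>Christoffel symbols and covariant derivatives\<close>

lemma (in inner_form) representation_exists:
  assumes "linear c"
  shows "\<exists>z. \<forall>w. G [z, w] = c w"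
proof (intro exI allI)
  fix w
  have "c w = c (\<Sum>e\<in>onb G. G [w, e] *\<^sub>R e)" by (simp add: onb_expand)
  also have "\<dots> = G [\<Sum>e\<in>onb G. c e *\<^sub>R e, w]"
    by (simp add: linear_sum[OF assms] linear_scale[OF assms] G_simps G_commute[of w] mult.commute)
  finally show "G [\<Sum>e\<in>onb G. c e *\<^sub>R e, w] = c w" ..
qed

text \<open>The formula of \<open>nabla\<close> with values in an arbitrary normed space, as needed
  for the complex form \<Omega>.\<close>

definition covariant ::
  "('e::euclidean_space \<Rightarrow> 'e list \<Rightarrow> real) \<Rightarrow> ('e \<Rightarrow> 'e list \<Rightarrow> 'a::real_normed_vector) \<Rightarrow> 'e \<Rightarrow> 'e \<Rightarrow> 'e list \<Rightarrow> 'a" where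
  "covariant g \<alpha> x u vs =
     Der (\<lambda>y. \<alpha> y vs) x u -
     (\<Sum>k<length vs. \<alpha> x (vs[k := christoffel g x u (vs ! k)]))"

lemma nabla_eq_covariant: "nabla g \<alpha> x u vs = covariant g \<alpha> x u vs"
  by (simp add: nabla_def covariant_def)

locale metric_chart =
  fixes S :: "'e::euclidean_space set" and g :: "'e \<Rightarrow> 'e list \<Rightarrow> real"
  assumes open_S: "open S" and inner_g: "x \<in> S \<Longrightarrow> inner_form (g x)"
    and diff_g: "x \<in> S \<Longrightarrow> (\<lambda>y. g y [u, v]) differentiable (at x)"
begin

lemma diff_tensor_g: "diff_tensor_on S 2 g"
  using inner_g diff_g by (auto simp: diff_tensor_on_def inner_form_def length_Suc_conv numeral_2_eq_2)

context
  fixes x assumes x: "x \<in> S"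
begin

abbreviation "\<Gamma> \<equiv> christoffel g x"

abbreviation "Dg u v w \<equiv> Der (\<lambda>y. g y [v, w]) x u"

interpretation inner_form "g x" using inner_g[OF x] .

lemma linear_Dg: "linear (\<lambda>u. Dg u v w)" "linear (\<lambda>v. Dg u v w)" "linear (\<lambda>w. Dg u v w)"
proof -
  show "linear (\<lambda>u. Dg u v w)"
    using diff_g[OF x, of v w] by (rule linear_frechet_derivative)
  show "linear (\<lambda>v. Dg u v w)" "linear (\<lambda>w. Dg u v w)"
    using multilinear_Der_param[OF open_S x diff_tensor_g]
    by (simp_all add: multilinear_2)
qed

lemma Dg_commute: "Dg u v w = Dg u w v"
  using Der_cong_open[OF open_S x, of "\<lambda>y. g y [v, w]" "\<lambda>y. g y [w, v]"]
    inner_form.G_commute[OF inner_g, of _ v w] by simp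

text \<open>The right-hand side is linear in \<open>w\<close>, so it is represented by a vector, and
  definiteness makes that vector unique; this justifies the definite description.\<close>

lemma christoffel: "g x [\<Gamma> u v, w] = (Dg u v w + Dg v u w - Dg w u v) / 2"
proof -
  have "linear (\<lambda>w. (Dg u v w + Dg v u w - Dg w u v) / 2)"
    using linear_Dg by (simp add: linear_iff add_divide_distrib diff_divide_distrib algebra_simps)
  from representation_exists[OF this]
  obtain z where z: "\<forall>w. g x [z, w] = (Dg u v w + Dg v u w - Dg w u v) / 2" ..
  have "\<forall>w. g x [\<Gamma> u v, w] = (Dg u v w + Dg v u w - Dg w u v) / 2"
    unfolding christoffel_def by (rule theI[of _ z], rule z, rule G_eqI) (metis z)
  then show ?thesis ..
qed

lemma christoffel_commute: "\<Gamma> u v = \<Gamma> v u"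
  by (rule G_eqI) (simp add: christoffel Dg_commute)

text \<open>Metric compatibility: in the Koszul formulas for \<open>(u, v, w)\<close> and
  \<open>(u, w, v)\<close> the terms skew in \<open>v, w\<close> cancel.\<close>

lemma christoffel_metric: "Dg u v w = g x [\<Gamma> u v, w] + g x [v, \<Gamma> u w]"
  using christoffel[of u v w] christoffel[of u w v] G_commute[of v "\<Gamma> u w"] Dg_commute[where u = u and v = w and w = v]
    Dg_commute[where u = v and v = u and w = w] by simp

lemma linear_christoffel: "linear (\<Gamma> u)" "linear (\<lambda>u. \<Gamma> u v)"
proof -
  show *: "linear (\<Gamma> u)" for u
    by (rule linearI; rule G_eqI)
       (simp_all add: G_simps christoffel linear_add[OF linear_Dg(1)] linear_add[OF linear_Dg(2)]
         linear_add[OF linear_Dg(3)] linear_scale[OF linear_Dg(1)] linear_scale[OF linear_Dg(2)]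
         linear_scale[OF linear_Dg(3)] add_divide_distrib diff_divide_distrib algebra_simps)
  show "linear (\<lambda>u. \<Gamma> u v)" using *[of v] by (simp add: christoffel_commute[of _ v])
qed

text \<open>Vector fields with prescribed value at \<open>x\<close> which are parallel to first order at \<open>x\<close>. Differentiating
  tensors along them turns the product rule for \<open>\<nabla>\<close> into the product rule for functions.\<close>

definition par :: "'e \<Rightarrow> 'e \<Rightarrow> 'e" where
  "par y v = v - \<Gamma> (y - x) v"

lemma par_x [simp]: "par x v = v"
  by (simp add: par_def linear_0[OF linear_christoffel(2)])

lemma linear_par: "linear (par y)"
  unfolding par_def by (intro linear_compose_sub linear_christoffel linear_ident)

lemma par_has_derivative: "((\<lambda>y. par y v) has_derivative (\<lambda>u. - \<Gamma> u v)) (at x)"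
proof -
  have "bounded_linear (\<lambda>u. \<Gamma> u v)" using linear_christoffel(2) by (simp add: linear_conv_bounded_linear)
  moreover have "((\<lambda>y. y - x) has_derivative (\<lambda>u. u)) (at x)" by (auto intro!: derivative_eq_intros)
  ultimately have "((\<lambda>y. \<Gamma> (y - x) v) has_derivative (\<lambda>u. \<Gamma> u v)) (at x)"
    by (rule bounded_linear.has_derivative)
  then show ?thesis unfolding par_def by (auto intro!: derivative_eq_intros)
qed

lemma has_derivative_par:
  fixes \<alpha> :: "'e \<Rightarrow> 'e list \<Rightarrow> 'a::real_normed_vector"
  assumes "diff_tensor_on S k \<alpha>" "length vs = k"
  shows "((\<lambda>y. \<alpha> y (map (par y) vs)) has_derivative
     (\<lambda>u. Der (\<lambda>y. \<alpha> y vs) x u - (\<Sum>j<k. \<alpha> x (vs[j := \<Gamma> u (vs ! j)])))) (at x)"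
proof -
  let ?ps = "map (\<lambda>v y. par y v) vs" and ?ps' = "map (\<lambda>v u. - \<Gamma> u v) vs"
  have 1: "((\<lambda>y. \<alpha> y (map (\<lambda>p. p y) ?ps)) has_derivative
     (\<lambda>u. Der (\<lambda>y. \<alpha> y (map (\<lambda>p. p x) ?ps)) x u +
        (\<Sum>j<k. \<alpha> x ((map (\<lambda>p. p x) ?ps)[j := (?ps' ! j) u])))) (at x)"
    by (rule has_derivative_multilinear[OF open_S x assms(1)]) (use assms(2) par_has_derivative in auto)
  have 2: "\<alpha> x (vs[j := - w]) = - \<alpha> x (vs[j := w])" if "j < k" for j w
    using assms x that linear_neg[of "\<lambda>v. \<alpha> x (vs[j := v])" w]
    by (auto simp: diff_tensor_on_def multilinear_def)
  have "(\<Sum>j<k. \<alpha> x (vs[j := (?ps' ! j) u])) = - (\<Sum>j<k. \<alpha> x (vs[j := \<Gamma> u (vs ! j)]))" for u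
    using assms(2) by (simp add: 2 sum_negf)
  then show ?thesis using 1 by (simp add: o_def)
qed

lemma covariant_has_derivative:
  fixes \<alpha> :: "'e \<Rightarrow> 'e list \<Rightarrow> 'a::real_normed_vector"
  assumes "diff_tensor_on S k \<alpha>" "length vs = k"
  shows "((\<lambda>y. \<alpha> y (map (par y) vs)) has_derivative (\<lambda>u. covariant g \<alpha> x u vs)) (at x)"
  using has_derivative_par[OF assms] assms(2) by (simp add: covariant_def)

lemma map_par_x [simp]: "map (par x) us = us"
  by (simp add: map_idI)

lemma linear_covariant:
  fixes \<alpha> :: "'e \<Rightarrow> 'e list \<Rightarrow> 'a::real_normed_vector"
  assumes "diff_tensor_on S k \<alpha>" "length vs = k"
  shows "linear (\<lambda>u. covariant g \<alpha> x u vs)"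
  using covariant_has_derivative[OF assms] has_derivative_linear by blast

lemma covariant_multilinear:
  fixes \<alpha> :: "'e \<Rightarrow> 'e list \<Rightarrow> 'a::real_normed_vector"
  assumes "diff_tensor_on S k \<alpha>"
  shows "multilinear k (covariant g \<alpha> x u)"
  unfolding multilinear_def
proof (intro allI impI)
  fix vs :: "'e list" and j assume vs: "length vs = k" "j < k"
  note D = covariant_has_derivative[OF assms, of "vs[j := _]"]
  have "linear (\<lambda>v. Der (\<lambda>y. \<alpha> y (map (par y) (vs[j := v]))) x u)"
  proof (rule linear_Der_param[OF open_S x])
    fix y assume "y \<in> S"
    then have "multilinear k (\<lambda>vs. \<alpha> y (map (par y) vs))"
      using assms by (intro multilinear_map linear_par) (simp add: diff_tensor_on_def)
    then show "linear (\<lambda>v. \<alpha> y (map (par y) (vs[j := v])))" using vs by (simp add: multilinear_def)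
  next
    show "(\<lambda>y. \<alpha> y (map (par y) (vs[j := v]))) differentiable (at x)" for v
      using D vs unfolding differentiable_def by auto
  qed
  moreover have "Der (\<lambda>y. \<alpha> y (map (par y) (vs[j := v]))) x u = covariant g \<alpha> x u (vs[j := v])" for v
    using D[of v] vs by (intro Der_eqI) simp
  ultimately show "linear (\<lambda>v. covariant g \<alpha> x u (vs[j := v]))" by simp
qed

text \<open>Arguments that coincide at \<open>x\<close> coincide along \<open>par\<close>, so the
  differentiated function vanishes identically near \<open>x\<close>.\<close>

lemma covariant_alternating:
  fixes \<alpha> :: "'e \<Rightarrow> 'e list \<Rightarrow> 'a::real_normed_vector"
  assumes "diff_tensor_on S k \<alpha>" "\<And>y. y \<in> S \<Longrightarrow> alternating k (\<alpha> y)"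
  shows "alternating k (covariant g \<alpha> x u)"
  unfolding alternating_def
proof (intro allI impI)
  fix vs :: "'e list" assume vs: "length vs = k" "\<not> distinct vs"
  have "((\<lambda>y. \<alpha> y (map (par y) vs)) has_derivative (\<lambda>u. 0)) (at x)"
    by (rule has_derivative_transform_within_open[OF has_derivative_const[of 0] open_S x])
       (use vs assms(2) in \<open>auto simp: alternating_def distinct_map\<close>)
  from has_derivative_unique[OF covariant_has_derivative[OF assms(1) vs(1)] this]
  show "covariant g \<alpha> x u vs = 0" by (rule fun_cong)
qed

end

end


subsection \<open>Parallel tensors on a Calabi--Yau manifold\<close>

locale kaehler_chart = metric_chart S g for S :: "'e::euclidean_space set" and g +
  fixes J :: "'e \<Rightarrow> 'e \<Rightarrow> 'e" and \<omega> :: "'e \<Rightarrow> 'e list \<Rightarrow> real"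
  assumes hermitian: "x \<in> S \<Longrightarrow> hermitian_form (g x) (J x) (\<omega> x)"
    and diff_J: "x \<in> S \<Longrightarrow> (\<lambda>y. J y v) differentiable (at x)"
    and closed_\<omega>: "x \<in> S \<Longrightarrow> ext_deriv \<omega> x [u, v, w] = 0"
    and nijenhuis: "x \<in> S \<Longrightarrow> lie_bracket (\<lambda>y. J y u) (\<lambda>y. J y v) x
        - J x (lie_bracket (\<lambda>y. J y u) (\<lambda>y. v) x) - J x (lie_bracket (\<lambda>y. u) (\<lambda>y. J y v) x) = 0"
begin

lemmas linear_J = hermitian_form.linear_J[OF hermitian]
  and J_J = hermitian_form.J_J[OF hermitian]
  and g_J_right = hermitian_form.G_J_right[OF hermitian]
  and \<omega>_eq = hermitian_form.\<omega>_eq[OF hermitian]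
  and \<omega>_commute = hermitian_form.\<omega>_commute[OF hermitian]
  and multilinear_\<omega> = hermitian_form.multilinear_\<omega>[OF hermitian]
  and alternating_\<omega> = hermitian_form.alternating_\<omega>[OF hermitian]

definition DJ :: "'e \<Rightarrow> 'e \<Rightarrow> 'e \<Rightarrow> 'e" where
  "DJ x u v = Der (\<lambda>y. J y v) x u"

text \<open>The covariant derivative of the endomorphism \<open>J\<close>, written out because
  \<open>nabla\<close> treats covariant tensors only.\<close>

definition nabla_J :: "'e \<Rightarrow> 'e \<Rightarrow> 'e \<Rightarrow> 'e" where
  "nabla_J x u v = DJ x u v + christoffel g x u (J x v) - J x (christoffel g x u v)"

lemma J_has_derivative: "x \<in> S \<Longrightarrow> ((\<lambda>y. J y v) has_derivative (\<lambda>u. DJ x u v)) (at x)"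
  using diff_J[of x v] by (simp add: DJ_def frechet_derivative_works[symmetric])

lemma \<omega>_has_derivative:
  assumes x: "x \<in> S"
  shows "((\<lambda>y. \<omega> y [v, w]) has_derivative
    (\<lambda>u. Der (\<lambda>y. g y [J x v, w]) x u + g x [DJ x u v, w])) (at x)"
proof -
  interpret inner_form "g x" using inner_g[OF x] .
  have "((\<lambda>y. g y (map (\<lambda>p. p y) [\<lambda>y. J y v, \<lambda>y. w])) has_derivative
     (\<lambda>u. Der (\<lambda>y. g y (map (\<lambda>p. p x) [\<lambda>y. J y v, \<lambda>y. w])) x u +
        (\<Sum>j<2. g x ((map (\<lambda>p. p x) [\<lambda>y. J y v, \<lambda>y. w])[j := ([\<lambda>u. DJ x u v, \<lambda>u. 0] ! j) u])))) (at x)"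
    by (rule has_derivative_multilinear[OF open_S x diff_tensor_g])
       (use J_has_derivative[OF x] in \<open>auto simp: less_2_cases_iff\<close>)
  then have "((\<lambda>y. g y [J y v, w]) has_derivative
    (\<lambda>u. Der (\<lambda>y. g y [J x v, w]) x u + g x [DJ x u v, w])) (at x)"
    by (simp add: numeral_2_eq_2 G_simps)
  then show ?thesis
    by (rule has_derivative_transform_within_open[OF _ open_S x]) (simp add: \<omega>_eq)
qed

lemma diff_tensor_\<omega>: "diff_tensor_on S 2 \<omega>"
  using \<omega>_has_derivative multilinear_\<omega>
  by (auto simp: diff_tensor_on_def differentiable_def numeral_2_eq_2 length_Suc_conv)

text \<open>Since the metric is parallel, differentiating \<open>\<omega> = g(J _, _)\<close> leaves
  only the derivative of \<open>J\<close>.\<close>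

lemma nabla_\<omega>_eq:
  assumes x: "x \<in> S"
  shows "nabla g \<omega> x u [v, w] = g x [nabla_J x u v, w]"
proof -
  interpret inner_form "g x" using inner_g[OF x] .
  have "nabla g \<omega> x u [v, w] = Der (\<lambda>y. g y [J x v, w]) x u + g x [DJ x u v, w]
      - (\<omega> x [christoffel g x u v, w] + \<omega> x [v, christoffel g x u w])"
    by (simp add: nabla_def Der_eqI[OF \<omega>_has_derivative[OF x]])
  then show ?thesis
    by (simp add: christoffel_metric[OF x] \<omega>_eq[OF x] nabla_J_def G_simps)
qed

text \<open>Obtained by differentiating the constant \<open>J (J v) = - v\<close>.\<close>

lemma nabla_J_anticommute:
  assumes x: "x \<in> S"
  shows "nabla_J x u (J x v) = - J x (nabla_J x u v)"
proof -
  note l = linear_J[OF x]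
  \<comment> \<open>\<open>hd\<close> presents \<open>J\<close> as a vector-valued tensor of degree
    one on lists, so that the general product rule applies.\<close>
  have "((\<lambda>y. J y (hd (map (\<lambda>p. p y) [\<lambda>y. J y v]))) has_derivative
     (\<lambda>u. Der (\<lambda>y. J y (hd (map (\<lambda>p. p x) [\<lambda>y. J y v]))) x u +
        (\<Sum>j<Suc 0. J x (hd ((map (\<lambda>p. p x) [\<lambda>y. J y v])[j := ([\<lambda>u. DJ x u v] ! j) u]))))) (at x)"
    by (rule has_derivative_multilinear[OF open_S x])
       (use J_has_derivative[OF x] linear_J diff_J in
         \<open>auto simp: diff_tensor_on_def multilinear_Suc_iff length_Suc_conv\<close>)
  then have "((\<lambda>y. J y (J y v)) has_derivative (\<lambda>u. DJ x u (J x v) + J x (DJ x u v))) (at x)"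
    by (simp add: DJ_def)
  moreover have "((\<lambda>y. J y (J y v)) has_derivative (\<lambda>u. 0)) (at x)"
    by (rule has_derivative_transform_within_open[OF has_derivative_const[of "- v"] open_S x]) (simp add: J_J)
  ultimately have "(\<lambda>u. DJ x u (J x v) + J x (DJ x u v)) = (\<lambda>u. 0)" by (rule has_derivative_unique)
  then have "DJ x u (J x v) + J x (DJ x u v) = 0" by metis
  then have "DJ x u (J x v) = - J x (DJ x u v)" by (simp add: add_eq_0_iff2)
  then show ?thesis
    by (simp add: nabla_J_def J_J[OF x] linear_add[OF l] linear_diff[OF l] linear_neg[OF linear_christoffel(1)[OF x]])
qed

text \<open>The Levi-Civita connection is torsion-free: by the symmetry of the Christoffel symbols,
  all correction terms cancel when coordinate derivatives of \<open>J\<close> are replaced by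
  covariant ones.\<close>

lemma nijenhuis_nabla:
  assumes x: "x \<in> S"
  shows "nabla_J x (J x u) v - nabla_J x (J x v) u + J x (nabla_J x v u) - J x (nabla_J x u v) = 0"
proof -
  note l = linear_J[OF x]
  have b: "lie_bracket (\<lambda>y. J y u) (\<lambda>y. J y v) x = DJ x (J x u) v - DJ x (J x v) u"
    "lie_bracket (\<lambda>y. J y u) (\<lambda>y. v) x = - DJ x v u" "lie_bracket (\<lambda>y. u) (\<lambda>y. J y v) x = DJ x u v" for u v
    by (simp_all add: lie_bracket_def DJ_def)
  have "DJ x (J x u) v - DJ x (J x v) u + J x (DJ x v u) - J x (DJ x u v) = 0"
    using nijenhuis[OF x, of u v] by (simp add: b linear_neg[OF l])
  then show ?thesis
    using christoffel_commute[OF x, of u v] christoffel_commute[OF x, of "J x u" "J x v"]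
      christoffel_commute[OF x, of "J x u" v] christoffel_commute[OF x, of "J x v" u]
    by (simp add: nabla_J_def linear_add[OF l] linear_diff[OF l] J_J[OF x] algebra_simps)
qed

text \<open>The Christoffel terms cancel in pairs, by their symmetry and the skewness of
  \<omega>.\<close>

lemma ext_deriv_\<omega>_nabla:
  assumes x: "x \<in> S"
  shows "nabla g \<omega> x u [v, w] - nabla g \<omega> x v [u, w] + nabla g \<omega> x w [u, v] = 0"
proof -
  have "ext_deriv \<omega> x [u, v, w] = nabla g \<omega> x u [v, w] - nabla g \<omega> x v [u, w] + nabla g \<omega> x w [u, v]"
    using \<omega>_commute[OF x, of v "christoffel g x u w"] \<omega>_commute[OF x, of u "christoffel g x v w"]
      \<omega>_commute[OF x, of u "christoffel g x w v"]
      christoffel_commute[OF x, of v u] christoffel_commute[OF x, of w u] christoffel_commute[OF x, of w v]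
    by (simp add: ext_deriv_def nabla_def numeral_3_eq_3)
  then show ?thesis using closed_\<omega>[OF x] by simp
qed

text \<open>With \<open>A(u, v, w) = (\<nabla>\<^sub>u\<omega>)(v, w)\<close>, integrability makes \<open>B(u, v, w) = A(Ju, v, w) + A(u, Jv, w)\<close>
  symmetric in \<open>u, v\<close>; being skew in \<open>v, w\<close> it vanishes. Then \<open>A(Ju, v, w) = - A(u, Jv, w)\<close>, and
  comparing two instances of \<open>d\<omega> = 0\<close> gives \<open>A = 0\<close>.\<close>

theorem nabla_\<omega>:
  assumes x: "x \<in> S"
  shows "nabla g \<omega> x u [v, w] = 0"
proof -
  interpret inner_form "g x" using inner_g[OF x] .
  define A where "A u v w = nabla g \<omega> x u [v, w]" for u v w
  have A: "A u v w = g x [nabla_J x u v, w]" for u v w by (simp add: A_def nabla_\<omega>_eq[OF x])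
  have skew: "A u v w = - A u w v" for u v w
  proof -
    have "multilinear (Suc (Suc 0)) (covariant g \<omega> x u)"
      using covariant_multilinear[OF x diff_tensor_\<omega>] by (simp add: numeral_2_eq_2)
    then show ?thesis
      using covariant_alternating[OF x diff_tensor_\<omega> alternating_\<omega>, of u]
        alternating_swap[of 0 "covariant g \<omega> x u" "[]" v w]
      by (simp add: A_def nabla_eq_covariant numeral_2_eq_2)
  qed
  have AJ: "A u (J x v) w = A u v (J x w)" for u v w
    by (simp add: A nabla_J_anticommute[OF x] g_J_right[OF x] G_simps)
  have N: "A (J x u) v w + A u (J x v) w = A (J x v) u w + A v (J x u) w" for u v w
  proof -
    have "nabla_J x (J x u) v - J x (nabla_J x u v) = nabla_J x (J x v) u - J x (nabla_J x v u)"
      using nijenhuis_nabla[OF x, of u v] by (simp add: algebra_simps)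
    then have "g x [nabla_J x (J x u) v - J x (nabla_J x u v), w] =
        g x [nabla_J x (J x v) u - J x (nabla_J x v u), w]" by simp
    then show ?thesis by (simp add: A nabla_J_anticommute[OF x] G_simps)
  qed
  define B where "B u v w = A (J x u) v w + A u (J x v) w" for u v w
  have sym: "B u v w = B v u w" for u v w using N by (simp add: B_def)
  have skewB: "B u v w = - B u w v" for u v w
    using skew[of "J x u" v w] skew[of u "J x v" w] AJ[of u w v] by (simp add: B_def)
  \<comment> \<open>Six swaps, alternately of the first two and of the last two arguments, return to
    \<open>B u v w\<close> with three sign changes.\<close>
  have "B u v w = 0" for u v w
    using sym[of u v w] skewB[of v u w] sym[of v w u] skewB[of w v u] sym[of w u v] skewB[of u w v] by simp
  then have C: "A (J x u) v w = - A u (J x v) w" for u v w by (simp add: B_def add_eq_0_iff2)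
  have cyc: "A u v w - A v u w + A w u v = 0" for u v w
    using ext_deriv_\<omega>_nabla[OF x] by (simp add: A_def)
  \<comment> \<open>On adding the two cyclic identities, \<open>C\<close> cancels the first two
    pairs of terms, and by \<open>AJ\<close> the third pair is twice
    \<open>A w u (J x v)\<close>.\<close>
  have "A w u (J x v) = 0" for u v w
    using cyc[of "J x u" v w] cyc[of u "J x v" w] C[of u v w] C[of v u w] AJ[of w u v] by simp
  from this[of u v "- J x w"]
  have "A u v (J x (- J x w)) = 0" .
  then show ?thesis by (simp add: linear_neg[OF linear_J[OF x]] J_J[OF x] A_def)
qed

lemma nabla_J:
  assumes x: "x \<in> S"
  shows "nabla_J x u v = 0"
  using inner_form.G_eq_0I[OF inner_g[OF x]] nabla_\<omega>_eq[OF x] nabla_\<omega>[OF x] by simp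

end

section \<open>The holomorphic volume form is parallel\<close>

lemma wedge_zero [simp]: "wedge k (\<lambda>us. 0) \<beta> vs = 0" "wedge k \<alpha> (\<lambda>us. 0) vs = 0"
  by (simp_all add: wedge_def)

lemma wedge_cmult:
  "wedge k (\<lambda>us. c * \<alpha> us) \<beta> vs = c * wedge k \<alpha> \<beta> vs"
  "wedge k \<alpha> (\<lambda>us. c * \<beta> us) vs = c * wedge k \<alpha> \<beta> vs"
  by (simp_all add: wedge_def sum_distrib_left mult_ac)

locale cy_chart = kaehler_chart S g J \<omega>
  for S :: "(real^6) set" and g J \<omega> +
  fixes \<Omega> :: "real^6 \<Rightarrow> (real^6) list \<Rightarrow> complex" and vol :: "real^6 \<Rightarrow> (real^6) list \<Rightarrow> real"
  assumes su3: "x \<in> S \<Longrightarrow> su3_form (g x) (J x) (\<Omega> x) (\<omega> x) (vol x)"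
    and diff_\<Omega>: "x \<in> S \<Longrightarrow> length vs = 3 \<Longrightarrow> (\<lambda>y. \<Omega> y vs) differentiable (at x)"
    and closed_\<Omega>: "x \<in> S \<Longrightarrow> ext_deriv \<Omega> x [a, b, c, d] = 0"
    and vol_\<omega>: "x \<in> S \<Longrightarrow> vol x vs = wedge 2 (\<omega> x) (wedge 2 (\<omega> x) (\<omega> x)) vs / 6"
begin

lemma diff_tensor_\<Omega>: "diff_tensor_on S 3 \<Omega>"
  using diff_\<Omega> su3 by (auto simp: diff_tensor_on_def su3_form_def form_3_0_def)

text \<open>Differentiates the type condition \<open>\<Omega>(J _, _, _) = \<i> \<Omega>\<close>.
  The terms containing derivatives of \<open>J\<close> combine to \<open>nabla_J\<close>, which
  vanishes, so the type is preserved.\<close>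

lemma covariant_\<Omega>_J:
  assumes x: "x \<in> S"
  shows "covariant g \<Omega> x u [J x v, w, z] = \<i> * covariant g \<Omega> x u [v, w, z]"
proof -
  interpret su3_form "g x" "J x" "\<Omega> x" "\<omega> x" "vol x" using su3[OF x] .
  have "((\<lambda>y. \<Omega> y (map (\<lambda>p. p y) [\<lambda>y. J y v, \<lambda>y. w, \<lambda>y. z])) has_derivative
     (\<lambda>u. Der (\<lambda>y. \<Omega> y (map (\<lambda>p. p x) [\<lambda>y. J y v, \<lambda>y. w, \<lambda>y. z])) x u +
        (\<Sum>j<3. \<Omega> x ((map (\<lambda>p. p x) [\<lambda>y. J y v, \<lambda>y. w, \<lambda>y. z])
          [j := ([\<lambda>u. DJ x u v, \<lambda>u. 0, \<lambda>u. 0] ! j) u])))) (at x)"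
    by (rule has_derivative_multilinear[OF open_S x diff_tensor_\<Omega>])
       (use J_has_derivative[OF x] in \<open>auto simp: less_Suc_eq numeral_3_eq_3\<close>)
  then have "((\<lambda>y. \<Omega> y [J y v, w, z]) has_derivative
     (\<lambda>u. Der (\<lambda>y. \<Omega> y [J x v, w, z]) x u + \<Omega> x [DJ x u v, w, z])) (at x)"
    by (simp add: numeral_3_eq_3 linear_0[OF linear_\<Omega>(2)] linear_0[OF linear_\<Omega>(3)])
  moreover have "((\<lambda>y. \<Omega> y [J y v, w, z]) has_derivative
     (\<lambda>u. \<i> * Der (\<lambda>y. \<Omega> y [v, w, z]) x u)) (at x)"
  proof (rule has_derivative_transform_within_open[OF _ open_S x])
    show "((\<lambda>y. \<i> * \<Omega> y [v, w, z]) has_derivative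
        (\<lambda>u. \<i> * Der (\<lambda>y. \<Omega> y [v, w, z]) x u)) (at x)"
      using diff_\<Omega>[OF x, of "[v, w, z]"]
      by (intro has_derivative_mult_right) (simp add: frechet_derivative_works[symmetric])
    show "\<i> * \<Omega> y [v, w, z] = \<Omega> y [J y v, w, z]" if "y \<in> S" for y
      using su3[OF that] by (simp add: su3_form_def form_3_0_def)
  qed
  ultimately have "Der (\<lambda>y. \<Omega> y [J x v, w, z]) x u + \<Omega> x [DJ x u v, w, z] =
      \<i> * Der (\<lambda>y. \<Omega> y [v, w, z]) x u" by (rule fun_cong[OF has_derivative_unique])
  then have D: "Der (\<lambda>y. \<Omega> y [J x v, w, z]) x u =
      \<i> * Der (\<lambda>y. \<Omega> y [v, w, z]) x u - \<Omega> x [DJ x u v, w, z]"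
    by (simp only: eq_diff_eq)
  have c: "christoffel g x u (J x v) = J x (christoffel g x u v) - DJ x u v"
    using nabla_J[OF x, of u v] by (simp add: nabla_J_def algebra_simps)
  show ?thesis
    by (simp add: covariant_def numeral_3_eq_3 D c linear_diff[OF linear_\<Omega>(1)] \<Omega>_J_simps algebra_simps)
qed

lemma form_3_0_covariant_\<Omega>:
  assumes x: "x \<in> S"
  shows "form_3_0 (J x) (covariant g \<Omega> x u)"
proof
  show "multilinear 3 (covariant g \<Omega> x u)" by (rule covariant_multilinear[OF x diff_tensor_\<Omega>])
  show "alternating 3 (covariant g \<Omega> x u)"
    by (rule covariant_alternating[OF x diff_tensor_\<Omega>])
       (use su3 in \<open>auto simp: su3_form_def form_3_0_def\<close>)
qed (rule covariant_\<Omega>_J[OF x])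

text \<open>As in degree two, the symmetric Christoffel symbols drop out after alternation.\<close>

lemma ext_deriv_\<Omega>_covariant:
  assumes x: "x \<in> S"
  shows "covariant g \<Omega> x a [b, c, d] - covariant g \<Omega> x b [a, c, d] +
    covariant g \<Omega> x c [a, b, d] - covariant g \<Omega> x d [a, b, c] = 0"
proof -
  interpret su3_form "g x" "J x" "\<Omega> x" "\<omega> x" "vol x" using su3[OF x] .
  let ?G = "christoffel g x"
  note c = christoffel_commute[OF x]
  have r: "\<Omega> x [u, v, z] = \<Omega> x [z, u, v]" for u v z
    using \<Omega>_swap(2)[of u v z] \<Omega>_swap(1)[of u z v] by simp
  have 1: "\<Omega> x [b, ?G a c, d] = - \<Omega> x [?G a c, b, d]" "\<Omega> x [b, c, ?G a d] = \<Omega> x [?G a d, b, c]"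
    "\<Omega> x [a, ?G b c, d] = - \<Omega> x [?G b c, a, d]" "\<Omega> x [a, c, ?G b d] = \<Omega> x [?G b d, a, c]"
    "\<Omega> x [a, b, ?G c d] = \<Omega> x [?G c d, a, b]" "\<Omega> x [a, ?G b d, c] = - \<Omega> x [?G b d, a, c]"
    for a b c d
    by (rule \<Omega>_swap(1) r)+
  have "ext_deriv \<Omega> x [a, b, c, d] = covariant g \<Omega> x a [b, c, d] - covariant g \<Omega> x b [a, c, d] +
    covariant g \<Omega> x c [a, b, d] - covariant g \<Omega> x d [a, b, c]"
    by (simp add: ext_deriv_def covariant_def numeral_3_eq_3 1 c[of b a] c[of c a] c[of c b] c[of d a] c[of d b] c[of d c])
  then show ?thesis using closed_\<Omega>[OF x] by simp
qed

text \<open>\<open>\<nabla>\<Omega>\<close> is again of type (3,0), so \<open>\<nabla>\<Omega> = \<theta> \<otimes> \<Omega>\<close>. Since \<open>d\<Omega> = 0\<close>, the form \<open>\<theta>\<close> is complex linear; since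
  \<open>\<Omega> \<and> cnj \<Omega>\<close> is a constant multiple of the parallel form \<open>\<omega>\<^sup>3\<close>, it is purely imaginary. Hence \<open>\<theta> = 0\<close>.\<close>

theorem covariant_\<Omega>:
  assumes x: "x \<in> S" and "length vs = 3"
  shows "covariant g \<Omega> x u vs = 0"
proof -
  interpret su3_form "g x" "J x" "\<Omega> x" "\<omega> x" "vol x" using su3[OF x] .
  obtain a b c where f: "orthonormal_frame (g x) (J_frame a b c)" and 1: "\<Omega> x [a, b, c] = 1"
    using unit_J_frame_exists by blast
  let ?es = "J_frame a b c"
  define \<theta> where "\<theta> u = covariant g \<Omega> x u [a, b, c]" for u
  have cov: "covariant g \<Omega> x u us = \<theta> u * \<Omega> x us" if "length us = 3" for u us
    unfolding \<theta>_def by (rule form_3_0_eq[OF form_3_0_covariant_\<Omega>[OF x] f 1 that])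
  have lin: "linear \<theta>" unfolding \<theta>_def by (rule linear_covariant[OF x diff_tensor_\<Omega>]) simp
  \<comment> \<open>In the closedness of \<Omega> on \<open>(J p, p, q, r)\<close>, the last two
    terms contain \<open>J p\<close> and \<open>p\<close> together inside \<Omega> and
    vanish.\<close>
  have \<theta>J: "\<theta> (J x p) = \<i> * \<theta> p" if "\<Omega> x [p, q, r] = 1" for p q r
    using ext_deriv_\<Omega>_covariant[OF x, of "J x p" p q r] that by (simp add: cov \<Omega>_J_simps)
  have re: "Re (\<theta> u) = 0" for u
  proof -
    \<comment> \<open>With arguments moved along \<open>par\<close>, the derivatives at
      \<open>x\<close> are covariant: zero for \<omega>, and \<theta> times \<Omega> for \<Omega>.
      Differentiating both expressions of the volume on one frame, where its value is 1, gives
      \<open>\<theta> u + cnj (\<theta> u) = 0\<close>.\<close>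
    let ?W = "\<lambda>y us. \<Omega> y (map (par x y) us)" and ?w = "\<lambda>y us. \<omega> y (map (par x y) us)"
    have 2: "((\<lambda>y. ?w y us) has_derivative (\<lambda>u. 0)) (at x)" if us: "length us = 2" for us
    proof -
      obtain v w where "us = [v, w]" using us by (auto simp: numeral_2_eq_2 length_Suc_conv)
      then show ?thesis
        using covariant_has_derivative[OF x diff_tensor_\<omega> us] nabla_\<omega>[OF x]
        by (simp add: nabla_eq_covariant)
    qed
    have 4: "((\<lambda>y. wedge 2 (?w y) (?w y) us) has_derivative (\<lambda>u. 0)) (at x)" if "length us = 4" for us
      using wedge_has_derivative[of 2 ?w "\<lambda>u us. 0" x us ?w "\<lambda>u us. 0"] 2 that by simp
    have 6: "((\<lambda>y. wedge 2 (?w y) (wedge 2 (?w y) (?w y)) ?es) has_derivative (\<lambda>u. 0)) (at x)"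
      using wedge_has_derivative[of 2 ?w "\<lambda>u us. 0" x ?es "\<lambda>y. wedge 2 (?w y) (?w y)" "\<lambda>u us. 0"] 2 4
      by (simp add: J_frame_def)
    have "((\<lambda>y. ?W y us) has_derivative (\<lambda>u. \<theta> u * \<Omega> x us)) (at x)" if "length us = 3" for us
      using covariant_has_derivative[OF x diff_tensor_\<Omega> that] cov[OF that] by simp
    from this has_derivative_cnj[OF this]
    have "((\<lambda>y. wedge 3 (?W y) (\<lambda>us. cnj (?W y us)) ?es) has_derivative
        (\<lambda>u. wedge 3 (\<lambda>us. \<theta> u * \<Omega> x us) (\<lambda>us. cnj (?W x us)) ?es +
             wedge 3 (?W x) (\<lambda>us. cnj (\<theta> u * \<Omega> x us)) ?es)) (at x)"
      by (intro wedge_has_derivative) (simp_all add: J_frame_def)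
    then have d: "((\<lambda>y. wedge 3 (?W y) (\<lambda>us. cnj (?W y us)) ?es) has_derivative
        (\<lambda>u. (\<theta> u + cnj (\<theta> u)) * wedge 3 (\<Omega> x) (\<lambda>us. cnj (\<Omega> x us)) ?es)) (at x)"
      by (simp add: x wedge_cmult distrib_right)
    have v: "complex_of_real (vol x ?es) = \<i> / 8 * wedge 3 (\<Omega> x) (\<lambda>us. cnj (\<Omega> x us)) ?es"
      using vol_\<Omega>[of ?es] by (simp add: J_frame_def)
    from has_derivative_mult_right[OF d, of "\<i> / 8"]
    have d: "((\<lambda>y. \<i> / 8 * wedge 3 (?W y) (\<lambda>us. cnj (?W y us)) ?es) has_derivative
        (\<lambda>u. (\<theta> u + cnj (\<theta> u)) * complex_of_real (vol x ?es))) (at x)"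
      by (simp only: v mult.left_commute[of "\<i> / 8"])
    have "((\<lambda>y. complex_of_real (wedge 2 (?w y) (wedge 2 (?w y) (?w y)) ?es / 6)) has_derivative (\<lambda>u. 0)) (at x)"
      using has_derivative_of_real[OF has_derivative_mult_right[OF 6, of "1 / 6"], where 'a = complex] by simp
    moreover have "complex_of_real (wedge 2 (?w y) (wedge 2 (?w y) (?w y)) ?es / 6) =
        \<i> / 8 * wedge 3 (?W y) (\<lambda>us. cnj (?W y us)) ?es" if "y \<in> S" for y
    proof -
      have "length (map (par x y) ?es) = 6" by (simp add: J_frame_def)
      from su3_form.vol_\<Omega>[OF su3[OF that] this] show ?thesis unfolding vol_\<omega>[OF that] wedge_map .
    qed
    ultimately have "((\<lambda>y. \<i> / 8 * wedge 3 (?W y) (\<lambda>us. cnj (?W y us)) ?es) has_derivative (\<lambda>u. 0)) (at x)"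
      by (rule has_derivative_transform_within_open[OF _ open_S x])
    from fun_cong[OF has_derivative_unique[OF d this], of u]
    have "\<theta> u + cnj (\<theta> u) = 0" by (simp add: vol_J_frame(1)[OF f])
    then show ?thesis by (simp add: complex_eq_iff)
  qed
  \<comment> \<open>\<open>\<theta> (J x p)\<close> is purely imaginary, but also
    \<open>\<i>\<close> times the purely imaginary \<open>\<theta> p\<close>, hence real. Cyclic
    permutations of \<open>(a, b, c)\<close> let each of the three vectors play the part of
    \<open>p\<close>.\<close>
  have zero: "\<theta> p = 0 \<and> \<theta> (J x p) = 0" if "\<Omega> x [p, q, r] = 1" for p q r
    using \<theta>J[OF that] re[of p] re[of "J x p"] by (simp add: complex_eq_iff)
  have "\<Omega> x [b, c, a] = 1" "\<Omega> x [c, a, b] = 1"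
    using \<Omega>_swap[of b c a] \<Omega>_swap(1)[of b a c] \<Omega>_swap(1)[of c a b] \<Omega>_swap(2)[of a c b] 1 by simp_all
  then have "\<theta> e = 0" if "e \<in> set ?es" for e
    using that zero[OF 1] zero[of b c a] zero[of c a b] by (auto simp: J_frame_def)
  then have "\<theta> u = 0" for u
    using linear_eq_0_on_span[OF lin, of "set ?es" u] span_orthonormal_frame[OF f] by simp
  then show ?thesis using cov[OF assms(2)] by simp
qed

end


subsection \<open>The linear \<open>G\<^sub>2\<close>-structure on \<open>\<real> \<times> V\<close>\<close>

type_synonym cyl = "real \<times> (real^6)"

lemma multilinear_zero:
  assumes "multilinear k F" "length vs = k" "0 \<in> set vs"
  shows "F vs = 0"
proof -
  obtain j where j: "j < k" "vs ! j = 0" using assms(2,3) by (auto simp: in_set_conv_nth)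
  then have "linear (\<lambda>v. F (vs[j := v]))" using assms by (simp add: multilinear_def)
  from linear_0[OF this] show ?thesis using j by (metis list_update_id)
qed

lemma wedge_cong:
  assumes "\<And>us. length us = k \<Longrightarrow> \<alpha> us = \<alpha>' us" "\<And>us. length us + k = length vs \<Longrightarrow> \<beta> us = \<beta>' us"
  shows "wedge k \<alpha> \<beta> vs = wedge k \<alpha>' \<beta>' vs"
  using assms
proof (induction vs arbitrary: k \<alpha> \<alpha>' \<beta> \<beta>')
  case Nil then show ?case by (simp add: wedge_Nil)
next
  case (Cons v vs)
  have "wedge k \<alpha> (\<lambda>us. \<beta> (v # us)) vs = wedge k \<alpha>' (\<lambda>us. \<beta>' (v # us)) vs"
    using Cons.prems by (intro Cons.IH) auto
  moreover have "wedge k' (\<lambda>us. \<alpha> (v # us)) \<beta> vs = wedge k' (\<lambda>us. \<alpha>' (v # us)) \<beta>' vs" if "k = Suc k'" for k'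
    using Cons.prems that by (intro Cons.IH) auto
  ultimately show ?case by (simp add: wedge_Cons split: nat.split)
qed

context su3_form
begin

text \<open>Replacing \<open>v\<close> by \<open>J v\<close> exchanges imaginary and real parts up
  to sign, so the whole contraction vanishes. Pairing with two of the vectors \<open>a, b, c\<close>
  isolates the complex coordinate of \<open>z\<close> along the third.\<close>

lemma \<Omega>_nondegenerate:
  assumes "\<And>v w. Im (\<Omega> [z, v, w]) = 0"
  shows "z = 0"
proof -
  have 0: "\<Omega> [z, v, w] = 0" for v w
    using assms[of v w] assms[of "J v" w] by (simp add: \<Omega>_J_simps complex_eq_iff)
  obtain a b c where f: "orthonormal_frame G (J_frame a b c)" and 1: "\<Omega> [a, b, c] = 1"
    using unit_J_frame_exists by blast
  have perm: "\<Omega> [b, c, a] = 1" "\<Omega> [c, a, b] = 1" "\<Omega> [b, a, c] = - 1" "\<Omega> [c, b, a] = - 1" "\<Omega> [a, c, b] = - 1"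
    using \<Omega>_swap(2)[of b c a] \<Omega>_swap(1)[of b a c] \<Omega>_swap(1)[of c a b] \<Omega>_swap(2)[of a c b] \<Omega>_swap(1)[of c b a]
      \<Omega>_swap(2)[of b a c] 1
    by simp_all
  have dist: "distinct (J_frame a b c)" by (rule orthonormal_frame_distinct[OF f])
  have z: "z = G [z, a] *\<^sub>R a + G [z, J a] *\<^sub>R J a + G [z, b] *\<^sub>R b + G [z, J b] *\<^sub>R J b +
      G [z, c] *\<^sub>R c + G [z, J c] *\<^sub>R J c"
    using orthonormal_frame_expand[OF f, of z] dist by (simp add: J_frame_def add.assoc)
  have e: "\<Omega> [z, v, w] = G [z, a] * \<Omega> [a, v, w] + G [z, J a] * (\<i> * \<Omega> [a, v, w]) +
      G [z, b] * \<Omega> [b, v, w] + G [z, J b] * (\<i> * \<Omega> [b, v, w]) + G [z, c] * \<Omega> [c, v, w] +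
      G [z, J c] * (\<i> * \<Omega> [c, v, w])" for v w
    by (subst z) (simp only: linear_add[OF linear_\<Omega>(1)] linear_scale[OF linear_\<Omega>(1)] \<Omega>_J
        scaleR_conv_of_real[where 'a = complex])
  have "G [z, a] = 0 \<and> G [z, J a] = 0"
    using e[of b c] 0[of b c] by (simp add: 1 complex_eq_iff)
  moreover have "G [z, b] = 0 \<and> G [z, J b] = 0"
    using e[of c a] 0[of c a] by (simp add: perm complex_eq_iff)
  moreover have "G [z, c] = 0 \<and> G [z, J c] = 0"
    using e[of a b] 0[of a b] by (simp add: perm complex_eq_iff)
  ultimately show ?thesis using z by simp
qed

text \<open>A unit phase cancels in the wedge product of \<Omega> with its conjugate and commutes
  with the type condition. Every result about a product form thus holds for its rotated versions
  too.\<close>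

lemma su3_form_rotate:
  assumes "cmod \<zeta> = 1"
  shows "su3_form G J (\<lambda>vs. \<zeta> * \<Omega> vs) \<omega> vol"
proof (intro su3_form.intro form_3_0.intro su3_form_axioms.intro)
  show "multilinear 3 (\<lambda>vs. \<zeta> * \<Omega> vs)" by (intro multilinear_cmult multilinear_\<Omega>)
  show "alternating 3 (\<lambda>vs. \<zeta> * \<Omega> vs)" using alternating_\<Omega> by (simp add: alternating_def)
  show "complex_of_real (vol vs) = \<i> / 8 * wedge 3 (\<lambda>vs. \<zeta> * \<Omega> vs) (\<lambda>us. cnj (\<zeta> * \<Omega> us)) vs"
    if "length vs = 6" for vs
  proof -
    have "\<zeta> * cnj \<zeta> = 1" using complex_norm_square[of \<zeta>] assms by simp
    then have "\<zeta> * (cnj \<zeta> * z) = z" for z by (metis mult.assoc mult_1)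
    then show ?thesis using vol_\<Omega>[OF that] by (simp add: wedge_cmult)
  qed
qed (use hermitian_form_axioms multilinear_vol alternating_vol vol_frame \<Omega>_J in \<open>auto simp: mult.left_commute\<close>)

section \<open>Metric, volume form and product 3-form on one tangent space of the cylinder\<close>

definition cyl_G :: "cyl list \<Rightarrow> real" where
  "cyl_G vs = fst (vs ! 0) * fst (vs ! 1) + G (map snd vs)"

definition cyl_vol :: "cyl list \<Rightarrow> real" where
  "cyl_vol = wedge (Suc 0) (\<lambda>vs. fst (vs ! 0)) (\<lambda>us. vol (map snd us))"

definition cyl_phi :: "cyl list \<Rightarrow> real" where
  "cyl_phi vs = Re (\<Omega> (map snd vs)) - wedge (Suc 0) (\<lambda>vs. fst (vs ! 0)) (\<lambda>us. \<omega> (map snd us)) vs"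

lemma linear_fst_snd: "linear (fst :: cyl \<Rightarrow> real)" "linear (snd :: cyl \<Rightarrow> real^6)"
  by (simp_all add: linear_iff)

sublocale cyl: inner_form cyl_G
proof
  show "multilinear 2 cyl_G"
    by (auto simp: multilinear_2 cyl_G_def linear_iff G_simps algebra_simps)
  show "cyl_G [u, v] = cyl_G [v, u]" for u v
    using G_commute[of "snd u" "snd v"] by (simp add: cyl_G_def mult.commute)
  show "cyl_G [v, v] > 0" if "v \<noteq> 0" for v
  proof (cases "snd v = 0")
    case True
    then have "fst v \<noteq> 0" using that by (auto simp: prod_eq_iff)
    then show ?thesis using True by (auto simp: cyl_G_def G_simps zero_less_mult_iff)
  next
    case False
    then show ?thesis using G_pos[of "snd v"] by (simp add: cyl_G_def add_nonneg_pos)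
  qed
qed

lemma multilinear_cyl: "multilinear 7 cyl_vol" "multilinear 3 cyl_phi"
proof -
  have l: "linear (\<lambda>v::cyl. fst ([v] ! 0))" using linear_fst_snd(1) by simp
  show "multilinear 7 cyl_vol"
    using multilinear_wedge_1[OF multilinear_map[OF multilinear_vol linear_fst_snd(2)], of "\<lambda>vs. fst (vs ! 0)"] l
    by (simp add: cyl_vol_def)
  have "multilinear 3 (\<lambda>vs. Re (\<Omega> (map snd (vs :: cyl list))))"
    by (rule multilinear_compose[OF multilinear_map[OF multilinear_\<Omega> linear_fst_snd(2)]]) (simp add: linear_iff)
  moreover have "multilinear 3 (wedge (Suc 0) (\<lambda>vs. fst (vs ! 0)) (\<lambda>us. \<omega> (map snd (us :: cyl list))))"
    using multilinear_wedge_1[OF multilinear_map[OF multilinear_\<omega> linear_fst_snd(2)], of "\<lambda>vs. fst (vs ! 0)"] l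
    by simp
  ultimately show "multilinear 3 cyl_phi"
    using multilinear_diff unfolding cyl_phi_def by blast
qed

lemma alternating_cyl: "alternating 7 cyl_vol" "alternating 3 cyl_phi"
proof -
  show "alternating 7 cyl_vol"
    using alternating_wedge_1[OF multilinear_map[OF multilinear_vol linear_fst_snd(2)] alternating_map[OF alternating_vol],
        of "\<lambda>vs. fst (vs ! 0)"]
    by (simp add: cyl_vol_def)
  have "alternating 3 (wedge (Suc 0) (\<lambda>vs. fst (vs ! 0)) (\<lambda>us. \<omega> (map snd (us :: cyl list))))"
    using alternating_wedge_1[OF multilinear_map[OF multilinear_\<omega> linear_fst_snd(2)] alternating_map[OF alternating_\<omega>],
        of "\<lambda>vs. fst (vs ! 0)"] by simp
  then show "alternating 3 cyl_phi"
    using alternating_map[OF alternating_\<Omega>, of "snd :: cyl \<Rightarrow> _"]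
    by (simp add: alternating_def cyl_phi_def)
qed

text \<open>A vector \<open>(s, 0)\<close> projects to zero, so only the shuffle that gives it to dr
  contributes.\<close>

lemma cyl_vol_dr:
  assumes "length us + length ws = 6"
  shows "cyl_vol (us @ (s, 0) # ws) = (- 1) ^ length us * s * vol (map snd (us @ ws))"
  unfolding cyl_vol_def
proof (subst wedge_1_contract)
  fix vs :: "cyl list" assume "(s, 0) \<in> set vs" "length vs = length us + length ws"
  then show "vol (map snd vs) = 0"
    using assms by (intro multilinear_zero[OF multilinear_vol]) force+
qed simp

definition cyl_frame :: "(real^6) list \<Rightarrow> cyl list" where
  "cyl_frame fs = (1, 0) # map (Pair 0) fs"

lemma orthonormal_cyl_frame:
  assumes "orthonormal_frame G fs"
  shows "orthonormal_frame cyl_G (cyl_frame fs)"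
  unfolding orthonormal_frame_def
proof (intro conjI allI impI)
  have len: "length fs = 6" using assms by (simp add: orthonormal_frame_def)
  then show "length (cyl_frame fs) = DIM(cyl)" by (simp add: cyl_frame_def)
  fix p q assume "p < DIM(cyl)" "q < DIM(cyl)"
  then show "cyl_G [cyl_frame fs ! p, cyl_frame fs ! q] = (if p = q then 1 else 0)"
    using assms by (cases p; cases q) (simp_all add: orthonormal_frame_def cyl_frame_def cyl_G_def G_simps len)
qed

lemma cyl_vol_frame:
  assumes "orthonormal_frame G fs"
  shows "cyl_vol (cyl_frame fs) = vol fs"
proof -
  have "length fs = 6" using assms by (simp add: orthonormal_frame_def)
  then show ?thesis using cyl_vol_dr[of "[]" "map (Pair 0) fs" 1] by (simp add: cyl_frame_def o_def)
qed

text \<open>Compares an arbitrary frame with a product frame through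
  \<open>alternating_frame_square\<close>.\<close>

lemma cyl_vol_orthonormal:
  assumes "orthonormal_frame cyl_G es"
  shows "\<bar>cyl_vol es\<bar> = 1"
proof -
  obtain fs where fs: "orthonormal_frame G fs" using orthonormal_frame_exists by blast
  have "(cyl_vol es)\<^sup>2 = (vol fs)\<^sup>2"
    using cyl.alternating_frame_square[OF _ _ assms orthonormal_cyl_frame[OF fs], of cyl_vol]
      multilinear_cyl(1) alternating_cyl(1) by (simp add: cyl_vol_frame[OF fs])
  from arg_cong[OF this, of sqrt] show ?thesis using vol_frame[OF fs] by simp
qed

text \<open>In a product frame the volume form needs its dr-slot for \<open>(s, 0)\<close>, so only
  triples tangent to the second factor contribute, and on these the 3-form is the real part of
  \<Omega>. The minus sign comes from the three arguments preceding \<open>(s, 0)\<close>.\<close>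

lemma hodge_cyl_phi_dr:
  assumes ws: "length ws = 3"
  shows "hodge cyl_G cyl_vol 3 cyl_phi ((s, 0) # ws) = - s * Im (\<Omega> (map snd ws))"
proof -
  obtain fs where fs: "orthonormal_frame G fs" using orthonormal_frame_exists by blast
  define H where "H us = cyl_phi us * vol (map snd (us @ ws))" for us
  have H0: "H [u, v, w] = 0" if "snd u = 0 \<or> snd v = 0 \<or> snd w = 0" for u v w
  proof -
    have "vol (map snd ([u, v, w] @ ws)) = 0"
      by (rule multilinear_zero[OF multilinear_vol]) (use that ws in auto)
    then show ?thesis by (simp add: H_def)
  qed
  have H1: "H [(0, u), (0, v), (0, w)] = Re (\<Omega> [u, v, w]) * vol ([u, v, w] @ map snd ws)" for u v w
    by (simp add: H_def cyl_phi_def wedge_1_Cons wedge_Nil)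
  have set_frame: "set (cyl_frame fs) = insert (1, 0) (Pair 0 ` set fs)" by (simp add: cyl_frame_def)
  have sum: "(\<Sum>e\<in>set (cyl_frame fs). h e) = h (1, 0) + (\<Sum>e\<in>set fs. h (0, e))" for h :: "cyl \<Rightarrow> real"
  proof -
    have "inj_on (Pair 0) (set fs)" by (simp add: inj_on_def)
    then have "sum h (Pair 0 ` set fs) = (\<Sum>e\<in>set fs. h (0, e))" by (subst sum.reindex) simp_all
    then show ?thesis unfolding set_frame by (subst sum.insert) auto
  qed
  have "hodge cyl_G cyl_vol 3 cyl_phi ((s, 0) # ws) =
      (\<Sum>us\<in>tuples (set (cyl_frame fs)) 3. cyl_phi us * cyl_vol (us @ (s, 0) # ws)) / fact 3"
    by (rule cyl.hodge_frame[where m = 4]) (use multilinear_cyl ws orthonormal_cyl_frame[OF fs] in simp_all)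
  also have "(\<Sum>us\<in>tuples (set (cyl_frame fs)) 3. cyl_phi us * cyl_vol (us @ (s, 0) # ws)) =
      (\<Sum>us\<in>tuples (set (cyl_frame fs)) 3. - s * H us)"
    by (intro sum.cong refl) (use ws in \<open>auto simp: cyl_vol_dr H_def\<close>)
  also have "\<dots> = - s * (\<Sum>us\<in>tuples (set (cyl_frame fs)) 3. H us)"
    by (simp only: sum_distrib_left)
  also have "(\<Sum>us\<in>tuples (set (cyl_frame fs)) 3. H us) =
      (\<Sum>u\<in>set fs. \<Sum>v\<in>set fs. \<Sum>w\<in>set fs. Re (\<Omega> [u, v, w]) * vol ([u, v, w] @ map snd ws))"
    by (simp only: sum_lists_3 finite_set sum) (simp add: H0 H1)
  also have "\<dots> = 6 * Im (\<Omega> (map snd ws))"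
    using star_Re_\<Omega>[OF _ fs, of "map snd ws"] ws by (simp add: sum_lists_3)
  finally show ?thesis by (simp add: fact_numeral)
qed

lemma linear_hodge_cyl_phi: "linear (\<lambda>z. hodge cyl_G cyl_vol 3 cyl_phi [z, u, v, w])"
proof -
  have "linear (\<lambda>z. cyl_vol (us @ [z, u, v, w]))" if "length us = 3" for us
    using multilinear_append[of 3 4 cyl_vol us] multilinear_cyl(1) that multilinear_SucD(2)[of 3 "\<lambda>vs. cyl_vol (us @ vs)" "[u, v, w]"]
    by simp
  then have "linear (\<lambda>z. cyl_phi us * cyl_vol (us @ [z, u, v, w]))" if "length us = 3" for us
    using that by (simp add: linear_iff distrib_left)
  then have "linear (\<lambda>z. \<Sum>us | set us \<subseteq> onb cyl_G \<and> length us = 3. cyl_phi us * cyl_vol (us @ [z, u, v, w]))"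
    by (intro linear_compose_sum) simp
  then show ?thesis unfolding hodge_def by (simp add: linear_iff add_divide_distrib)
qed

lemma hodge_cyl_phi_swap:
  "hodge cyl_G cyl_vol 3 cyl_phi [z, u, v, w] = - hodge cyl_G cyl_vol 3 cyl_phi [u, z, v, w]"
proof -
  have "cyl_vol (us @ [z, u, v, w]) = - cyl_vol (us @ [u, z, v, w])" if "length us = 3" for us
    using alternating_swap[of 2 "\<lambda>vs. cyl_vol (us @ vs)" "[v, w]" z u] that
      multilinear_append[of 3 4 cyl_vol us] multilinear_cyl(1) alternating_append[of 3 4 cyl_vol us] alternating_cyl(1)
    by (simp add: numeral_eq_Suc)
  then show ?thesis by (simp add: hodge_def sum_negf)
qed

text \<open>This gives the uniqueness of the torsion. Contraction with \<open>(1, 0)\<close> leaves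
  the imaginary part of \<Omega> and kills \<open>snd z\<close>; after that
  \<open>hodge_cyl_phi_dr\<close> applies to \<open>z\<close> itself.\<close>

lemma hodge_cyl_phi_nondegenerate:
  assumes z: "\<And>u v w. hodge cyl_G cyl_vol 3 cyl_phi [z, u, v, w] = 0"
  shows "z = 0"
proof -
  have "Im (\<Omega> [snd z, v, w]) = 0" for v w
    using z[of "(1, 0)" "(0, v)" "(0, w)"] hodge_cyl_phi_swap[of z "(1, 0)" "(0, v)" "(0, w)"]
      hodge_cyl_phi_dr[of "[z, (0, v), (0, w)]" 1] by simp
  then have "snd z = 0" by (rule \<Omega>_nondegenerate)
  moreover have "fst z = 0"
  proof -
    obtain a b c where 1: "\<Omega> [a, b, c] = 1" using unit_J_frame_exists by blast
    have "z = (fst z, 0)" using \<open>snd z = 0\<close> by (simp add: prod_eq_iff)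
    \<comment> \<open>The triple starts with \<open>J a\<close> because
      \<open>\<Omega> [a, b, c] = 1\<close> has no imaginary part, while
      \<open>\<Omega> [J a, b, c] = \<i>\<close>.\<close>
    then show ?thesis
      using z[of "(0, J a)" "(0, b)" "(0, c)"] hodge_cyl_phi_dr[of "[(0, J a), (0, b), (0, c)]" "fst z"]
      by (simp add: \<Omega>_J 1)
  qed
  ultimately show ?thesis by (simp add: prod_eq_iff)
qed

lemma pair_less_6_cases:
  assumes "i < j" "j < (6::nat)" "P 0 1" "P 0 2" "P 0 3" "P 0 4" "P 0 5" "P 1 2" "P 1 3" "P 1 4" "P 1 5"
    "P 2 3" "P 2 4" "P 2 5" "P 3 4" "P 3 5" "P 4 5"
  shows "P i j"
  using assms by (auto simp: eval_nat_numeral less_Suc_eq)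

text \<open>For \<open>\<Omega> [a, b, c] = 1\<close>, the basis dual to the model coframe is
  \<open>(1, 0)\<close> followed by \<open>a, J a, b, J b, c, J c\<close>. Index 0 belongs to the
  real line, which shifts the indices of the \<open>J_frame\<close> by one.\<close>

lemma g2_frame_exists:
  "\<exists>es. orthonormal_frame cyl_G es \<and> cyl_vol es = 1 \<and>
     (\<forall>p q s. p < q \<longrightarrow> q < s \<longrightarrow> s < 7 \<longrightarrow> cyl_phi [es ! p, es ! q, es ! s] = model_g2 p q s)"
proof -
  obtain a b c where f: "orthonormal_frame G (J_frame a b c)" and 1: "\<Omega> [a, b, c] = 1"
    using unit_J_frame_exists by blast
  define e where "e = (!) (J_frame a b c)"
  let ?es = "cyl_frame (J_frame a b c)"
  have len: "length (J_frame a b c) = 6" by (simp add: J_frame_def)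
  have es: "?es ! 0 = (1, 0)" "p < 6 \<Longrightarrow> ?es ! Suc p = (0, e p)" for p
    by (simp_all add: cyl_frame_def e_def len)
  have "cyl_phi [?es ! p, ?es ! q, ?es ! s] = model_g2 p q s" if pqs: "p < q" "q < s" "s < 7" for p q s
  proof -
    obtain j k where jk: "q = Suc j" "s = Suc k" using pqs by (cases q; cases s) auto
    show ?thesis
    proof (cases p)
      case 0
      have G1: "G [a, a] = 1" "G [b, b] = 1" "G [c, c] = 1" "G [J a, b] = 0" "G [J a, c] = 0" "G [J b, c] = 0"
        "G [a, b] = 0" "G [a, c] = 0" "G [b, c] = 0"
        using f by (simp_all add: orthonormal_J_frame_iff)
      have "- \<omega> [e j, e k] = model_g2 0 (Suc j) (Suc k)"
        by (rule pair_less_6_cases[of j k])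
           (use pqs jk in \<open>simp_all add: e_def J_frame_def \<omega>_eq model_g2_def G_J_J G_J_right J_J linear_neg[OF linear_J] G_simps G1\<close>)
      then show ?thesis
        using pqs jk 0 by (simp add: es cyl_phi_def wedge_1_Cons wedge_Nil)
          (simp add: \<omega>_eq G_simps linear_0[OF linear_J] linear_0[OF linear_\<Omega>(1)])
    next
      case (Suc i)
      have "Re (\<Omega> [e i, e j, e k]) = model_g2 (Suc i) (Suc j) (Suc k)"
        by (rule triple_less_6_cases[of i j k])
           (use pqs jk Suc in \<open>simp_all add: e_def J_frame_def \<Omega>_J_simps model_g2_def 1\<close>)
      then show ?thesis
        using pqs jk Suc by (simp add: es cyl_phi_def wedge_1_Cons wedge_Nil)
    qed
  qed
  moreover have "cyl_vol ?es = 1" using cyl_vol_frame[OF f] vol_J_frame(1)[OF f] by simp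
  ultimately show ?thesis using orthonormal_cyl_frame[OF f] by blast
qed

end


subsection \<open>Smooth functions\<close>

lemma k_smooth_on_cong:
  assumes "open S" "\<And>x. x \<in> S \<Longrightarrow> f x = h x"
  shows "k_smooth_on k S f \<longleftrightarrow> k_smooth_on k S h"
  using assms
proof (induction k arbitrary: f h)
  case 0
  then show ?case using continuous_on_cong[of S S f h] by simp
next
  case (Suc k)
  have "k_smooth_on k S (\<lambda>x. Der f x v) \<longleftrightarrow>
      k_smooth_on k S (\<lambda>x. Der h x v)" for v
  proof (rule Suc.IH[OF \<open>open S\<close>])
    fix x assume "x \<in> S"
    from Der_cong_open[OF \<open>open S\<close> this Suc.prems(2)]
    show "Der f x v = Der h x v" by simp
  qed
  moreover have "(\<forall>x\<in>S. f differentiable at x) \<longleftrightarrow> (\<forall>x\<in>S. h differentiable at x)"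
    using differentiable_cong_open[OF \<open>open S\<close>, of _ f h] Suc.prems(2) by blast
  ultimately show ?case by simp
qed

lemma k_smooth_on_SucD: "k_smooth_on (Suc k) S f \<Longrightarrow> k_smooth_on k S f"
proof (induction k arbitrary: f)
  case 0
  then show ?case
    by (auto intro!: differentiable_imp_continuous_on simp: differentiable_on_def differentiable_at_withinI)
next
  case (Suc k)
  then show ?case by (metis k_smooth_on.simps(2))
qed

lemma k_smooth_on_has_derivative:
  "k_smooth_on (Suc k) S f \<Longrightarrow> x \<in> S \<Longrightarrow> (f has_derivative Der f x) (at x)"
  by (simp add: frechet_derivative_works[symmetric])

lemma k_smooth_on_SucI:
  assumes "open S" "\<And>x. x \<in> S \<Longrightarrow> (f has_derivative D x) (at x)" "\<And>v. k_smooth_on k S (\<lambda>x. D x v)"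
  shows "k_smooth_on (Suc k) S f"
proof -
  have "k_smooth_on k S (\<lambda>x. Der f x v)" for v
    using k_smooth_on_cong[OF assms(1), of "\<lambda>x. Der f x v" "\<lambda>x. D x v"]
      Der_eqI[OF assms(2)] assms(3) by simp
  then show ?thesis using assms(2) by (auto simp: differentiable_def)
qed

lemma k_smooth_on_const: "open S \<Longrightarrow> k_smooth_on k S (\<lambda>x. c)"
proof (induction k arbitrary: c)
  case (Suc k)
  then show ?case by (intro k_smooth_on_SucI[OF _ has_derivative_const])
qed simp

lemma k_smooth_on_bounded_linear:
  assumes "open S" "bounded_linear h" "k_smooth_on k S f"
  shows "k_smooth_on k S (\<lambda>x. h (f x))"
  using assms(3)
proof (induction k arbitrary: f)
  case 0
  then show ?case using bounded_linear.continuous_on[OF assms(2)] by simp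
next
  case (Suc k)
  show ?case
  proof (rule k_smooth_on_SucI[OF assms(1)])
    show "((\<lambda>x. h (f x)) has_derivative (\<lambda>v. h (Der f x v))) (at x)" if "x \<in> S" for x
      by (rule bounded_linear.has_derivative[OF assms(2) k_smooth_on_has_derivative[OF Suc.prems that]])
  qed (use Suc in auto)
qed

lemma k_smooth_on_add:
  assumes "open S" "k_smooth_on k S f" "k_smooth_on k S h"
  shows "k_smooth_on k S (\<lambda>x. f x + h x)"
  using assms(2,3)
proof (induction k arbitrary: f h)
  case 0
  then show ?case by (simp add: continuous_on_add)
next
  case (Suc k)
  show ?case
  proof (rule k_smooth_on_SucI[OF assms(1)])
    show "((\<lambda>x. f x + h x) has_derivative
        (\<lambda>v. Der f x v + Der h x v)) (at x)" if "x \<in> S" for x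
      by (intro has_derivative_add k_smooth_on_has_derivative[of k, OF _ that] Suc.prems)
  qed (use Suc in auto)
qed

lemma k_smooth_on_mult:
  fixes f h :: "'a::real_normed_vector \<Rightarrow> real"
  assumes "open S" "k_smooth_on k S f" "k_smooth_on k S h"
  shows "k_smooth_on k S (\<lambda>x. f x * h x)"
  using assms(2,3)
proof (induction k arbitrary: f h)
  case 0
  then show ?case by (simp add: continuous_on_mult)
next
  case (Suc k)
  show ?case
  proof (rule k_smooth_on_SucI[OF assms(1)])
    show "((\<lambda>x. f x * h x) has_derivative
        (\<lambda>v. f x * Der h x v + Der f x v * h x)) (at x)" if "x \<in> S" for x
      by (intro has_derivative_mult k_smooth_on_has_derivative[of k, OF _ that] Suc.prems)
    show "k_smooth_on k S (\<lambda>x. f x * Der h x v + Der f x v * h x)" for v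
      using Suc.prems k_smooth_on_SucD[OF Suc.prems(1)] k_smooth_on_SucD[OF Suc.prems(2)]
      by (intro k_smooth_on_add[OF assms(1)] Suc.IH) auto
  qed
qed

text \<open>Applied to the two projections of the cylinder. With a linear inner map, a directional
  derivative is again a composition of the same shape, so the induction closes.\<close>

lemma k_smooth_on_compose_linear:
  assumes "open S" "bounded_linear L" "L ` S \<subseteq> T" "k_smooth_on k T f"
  shows "k_smooth_on k S (\<lambda>x. f (L x))"
  using assms(4)
proof (induction k arbitrary: f)
  case 0
  then show ?case
    using continuous_on_compose2[of T f S L] assms(3) linear_continuous_on[OF assms(2)] by simp
next
  case (Suc k)
  show ?case
  proof (rule k_smooth_on_SucI[OF assms(1)])
    show "((\<lambda>x. f (L x)) has_derivative (\<lambda>v. Der f (L x) (L v))) (at x)" if "x \<in> S" for x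
      using that assms(3) by (intro has_derivative_compose[OF bounded_linear_imp_has_derivative[OF assms(2)]]
          k_smooth_on_has_derivative[OF Suc.prems]) auto
    show "k_smooth_on k S (\<lambda>x. Der f (L x) (L v))" for v
      using Suc.IH[of "\<lambda>y. Der f y (L v)"] Suc.prems by simp
  qed
qed

lemma smooth_on_cong:
  assumes "open S" "\<And>x. x \<in> S \<Longrightarrow> f x = h x"
  shows "smooth_on S f \<longleftrightarrow> smooth_on S h"
  using k_smooth_on_cong[OF assms] by (simp add: smooth_on_def)

lemma smooth_on_const: "open S \<Longrightarrow> smooth_on S (\<lambda>x. c)"
  by (simp add: smooth_on_def k_smooth_on_const)

lemma smooth_on_bounded_linear:
  "open S \<Longrightarrow> bounded_linear h \<Longrightarrow> smooth_on S f \<Longrightarrow> smooth_on S (\<lambda>x. h (f x))"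
  by (simp add: smooth_on_def k_smooth_on_bounded_linear)

lemma smooth_on_add: "open S \<Longrightarrow> smooth_on S f \<Longrightarrow> smooth_on S h \<Longrightarrow> smooth_on S (\<lambda>x. f x + h x)"
  by (simp add: smooth_on_def k_smooth_on_add)

lemma smooth_on_diff: "open S \<Longrightarrow> smooth_on S f \<Longrightarrow> smooth_on S h \<Longrightarrow> smooth_on S (\<lambda>x. f x - h x)"
  using smooth_on_add[of S f "\<lambda>x. - h x"]
    smooth_on_bounded_linear[OF _ bounded_linear_minus[OF bounded_linear_ident], of S h] by simp

lemma smooth_on_mult:
  fixes f h :: "'a::real_normed_vector \<Rightarrow> real"
  shows "open S \<Longrightarrow> smooth_on S f \<Longrightarrow> smooth_on S h \<Longrightarrow> smooth_on S (\<lambda>x. f x * h x)"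
  by (simp add: smooth_on_def k_smooth_on_mult)

lemma smooth_on_compose_linear:
  "open S \<Longrightarrow> bounded_linear L \<Longrightarrow> L ` S \<subseteq> T \<Longrightarrow> smooth_on T f \<Longrightarrow> smooth_on S (\<lambda>x. f (L x))"
  unfolding smooth_on_def using k_smooth_on_compose_linear by blast

lemma smooth_on_differentiable: "smooth_on S f \<Longrightarrow> x \<in> S \<Longrightarrow> f differentiable (at x)"
  unfolding smooth_on_def by (metis k_smooth_on.simps(2))


subsection \<open>Tensor fields on the cylinder\<close>

lemma atlasD:
  assumes "atlas C"
  shows "open (coord_image C i)" "inj_on (snd (C i)) (fst (C i))" "open (coord_overlap C i j)"
    "smooth_on (coord_overlap C i j) (transition C i j)" "\<exists>i. m \<in> fst (C i)"
proof -
  from assms obtain h where h: "homeomorphism (fst (C i)) (coord_image C i) (snd (C i)) h"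
    and o: "open (fst (C j))" and o': "open (coord_image C i)"
    unfolding atlas_def by blast
  show "open (coord_image C i)" by fact
  show "inj_on (snd (C i)) (fst (C i))"
    by (rule inj_on_inverseI[of _ h]) (rule homeomorphism_apply1[OF h])
  \<comment> \<open>\<open>h\<close> is the continuous inverse of the coordinate map; the overlap
    becomes the preimage of an open set under it.\<close>
  have "coord_overlap C i j = coord_image C i \<inter> h -` (fst (C j))"
  proof (intro set_eqI iffI)
    fix x assume "x \<in> coord_overlap C i j"
    then show "x \<in> coord_image C i \<inter> h -` fst (C j)"
      using homeomorphism_apply1[OF h] by (auto simp: coord_overlap_def coord_image_def)
  next
    fix x assume x: "x \<in> coord_image C i \<inter> h -` fst (C j)"
    then have "h x \<in> fst (C i)" using homeomorphism_image2[OF h] by auto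
    moreover have "snd (C i) (h x) = x" using homeomorphism_apply2[OF h] x by auto
    ultimately show "x \<in> coord_overlap C i j"
      using x by (auto simp: coord_overlap_def intro!: rev_image_eqI[of "h x"])
  qed
  moreover have "open (coord_image C i \<inter> h -` (fst (C j)))"
    using h o o' by (intro continuous_open_preimage) (auto simp: homeomorphism_def)
  ultimately show "open (coord_overlap C i j)" by simp
  show "smooth_on (coord_overlap C i j) (transition C i j)" using assms by (simp add: atlas_def)
  show "\<exists>i. m \<in> fst (C i)" using assms unfolding atlas_def by blast
qed

lemma cyl_atlas_simps:
  "fst (cyl_atlas C i) = UNIV \<times> fst (C i)"
  "coord_image (cyl_atlas C) i = UNIV \<times> coord_image C i"
  "coord_overlap (cyl_atlas C) i j = UNIV \<times> coord_overlap C i j"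
  by (auto simp: cyl_atlas_def coord_image_def coord_overlap_def image_iff Bex_def)

lemma coord_overlap_subset: "x \<in> coord_overlap C i j \<Longrightarrow> x \<in> coord_image C i"
  by (auto simp: coord_overlap_def coord_image_def)

lemma transition_coord_image:
  assumes "atlas C" "x \<in> coord_overlap C i j"
  shows "transition C i j x \<in> coord_image C j"
  using assms(2) inv_into_f_f[OF atlasD(2)[OF assms(1)], of _ i]
  by (auto simp: coord_overlap_def coord_image_def transition_def)

lemma cyl_transition:
  assumes "atlas C" "snd p \<in> coord_overlap C i j"
  shows "transition (cyl_atlas C) i j p = (fst p, transition C i j (snd p))"
proof -
  obtain m where m: "snd p = snd (C i) m" "m \<in> fst (C i)" using assms(2) by (auto simp: coord_overlap_def)
  note inj = atlasD(2)[OF assms(1), of i]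
  have "inj_on (map_prod id (snd (C i))) (UNIV \<times> fst (C i))" using inj by (auto simp: inj_on_def)
  then have "inv_into (UNIV \<times> fst (C i)) (map_prod id (snd (C i))) p = (fst p, m)"
    by (rule inv_into_f_eq) (use m in \<open>auto simp: prod_eq_iff\<close>)
  moreover have "inv_into (fst (C i)) (snd (C i)) (snd p) = m" using inj m by simp
  ultimately show ?thesis by (simp add: transition_def cyl_atlas_def)
qed

lemma cyl_transition_derivative:
  assumes C: "atlas C" and p: "snd p \<in> coord_overlap C i j"
  shows "Der (transition (cyl_atlas C) i j) p v =
    (fst v, Der (transition C i j) (snd p) (snd v))"
proof (rule Der_eqI)
  have "(transition C i j has_derivative Der (transition C i j) (snd p)) (at (snd p))"
    using smooth_on_differentiable[OF atlasD(4)[OF C] p] by (simp add: frechet_derivative_works[symmetric])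
  from has_derivative_compose[OF bounded_linear_imp_has_derivative[OF bounded_linear_snd] this]
  have "((\<lambda>q. (fst q, transition C i j (snd q))) has_derivative
      (\<lambda>v. (fst v, Der (transition C i j) (snd p) (snd v)))) (at p)"
    by (intro has_derivative_Pair bounded_linear_imp_has_derivative[OF bounded_linear_fst])
  then show "(transition (cyl_atlas C) i j has_derivative
      (\<lambda>v. (fst v, Der (transition C i j) (snd p) (snd v)))) (at p)"
    by (rule has_derivative_transform_within_open[of _ _ _ _ "UNIV \<times> coord_overlap C i j"])
       (use p in \<open>auto simp: cyl_transition[OF C] open_Times atlasD(3)[OF C] mem_Times_iff\<close>)
qed

lemma tensor_fieldI:
  assumes "\<And>i x. x \<in> coord_image C i \<Longrightarrow> multilinear k (\<alpha> i x)"
    and "\<And>i vs. length vs = k \<Longrightarrow> smooth_on (coord_image C i) (\<lambda>x. \<alpha> i x vs)"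
    and "\<And>i j x vs. x \<in> coord_overlap C i j \<Longrightarrow> length vs = k \<Longrightarrow>
      \<alpha> i x vs = \<alpha> j (transition C i j x) (map (Der (transition C i j) x) vs)"
  shows "tensor_field C k \<alpha>"
  unfolding tensor_field_def using assms by blast

lemma tensor_fieldD:
  assumes "tensor_field C k \<alpha>"
  shows "x \<in> coord_image C i \<Longrightarrow> multilinear k (\<alpha> i x)"
    and "length vs = k \<Longrightarrow> smooth_on (coord_image C i) (\<lambda>x. \<alpha> i x vs)"
    and "x \<in> coord_overlap C i j \<Longrightarrow> length vs = k \<Longrightarrow>
      \<alpha> i x vs = \<alpha> j (transition C i j x) (map (Der (transition C i j) x) vs)"
  using assms unfolding tensor_field_def by blast+

text \<open>Lets the smoothness of \<phi>(f, X), whose definition involves a frame chosen separately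
  at each point, be read off from an explicit formula.\<close>

lemma tensor_field_cong:
  assumes C: "\<And>i. open (coord_image C i)" "\<And>i j x. x \<in> coord_overlap C i j \<Longrightarrow> transition C i j x \<in> coord_image C j"
    and eq: "\<And>i x vs. x \<in> coord_image C i \<Longrightarrow> length vs = k \<Longrightarrow> \<alpha> i x vs = \<beta> i x vs"
    and "tensor_field C k \<beta>"
  shows "tensor_field C k \<alpha>"
proof (rule tensor_fieldI)
  note D = tensor_fieldD[OF assms(4)]
  show "multilinear k (\<alpha> i x)" if "x \<in> coord_image C i" for i x
    using D(1)[OF that] eq[OF that] by (simp add: multilinear_def)
  show "smooth_on (coord_image C i) (\<lambda>x. \<alpha> i x vs)" if "length vs = k" for i vs
    using D(2)[OF that] smooth_on_cong[OF C(1) eq[OF _ that]] by simp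
  show "\<alpha> i x vs = \<alpha> j (transition C i j x) (map (Der (transition C i j) x) vs)"
    if "x \<in> coord_overlap C i j" "length vs = k" for i j x vs
    unfolding eq[OF coord_overlap_subset[OF that(1)] that(2)]
    using D(3)[OF that] eq[OF C(2)[OF that(1)], of "map _ vs"] that(2) by simp
qed

lemma tensor_field_bounded_linear:
  assumes "\<And>i. open (coord_image C i)" "bounded_linear h" "tensor_field C k \<alpha>"
  shows "tensor_field C k (\<lambda>i x vs. h (\<alpha> i x vs))"
proof (rule tensor_fieldI)
  show "multilinear k (\<lambda>vs. h (\<alpha> i x vs))" if "x \<in> coord_image C i" for i x
    by (rule multilinear_compose[OF tensor_fieldD(1)[OF assms(3) that] bounded_linear.linear[OF assms(2)]])
  show "smooth_on (coord_image C i) (\<lambda>x. h (\<alpha> i x vs))" if "length vs = k" for i vs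
    by (rule smooth_on_bounded_linear[OF assms(1,2) tensor_fieldD(2)[OF assms(3) that]])
  show "h (\<alpha> i x vs) = h (\<alpha> j (transition C i j x) (map (Der (transition C i j) x) vs))"
    if "x \<in> coord_overlap C i j" "length vs = k" for i j x vs
    by (rule arg_cong[OF tensor_fieldD(3)[OF assms(3) that]])
qed

lemma tensor_field_add:
  assumes "\<And>i. open (coord_image C i)" "tensor_field C k \<alpha>" "tensor_field C k \<beta>"
  shows "tensor_field C k (\<lambda>i x vs. \<alpha> i x vs + \<beta> i x vs)"
  by (intro tensor_fieldI smooth_on_add multilinear_add arg_cong2[where f = "(+)"]
      tensor_fieldD[OF assms(2)] tensor_fieldD[OF assms(3)] assms)

lemma tensor_field_diff:
  assumes "\<And>i. open (coord_image C i)" "tensor_field C k \<alpha>" "tensor_field C k \<beta>"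
  shows "tensor_field C k (\<lambda>i x vs. \<alpha> i x vs - \<beta> i x vs)"
  by (intro tensor_fieldI smooth_on_diff multilinear_diff arg_cong2[where f = "(-)"]
      tensor_fieldD[OF assms(2)] tensor_fieldD[OF assms(3)] assms)

lemma open_cyl_coord_image: "atlas C \<Longrightarrow> open (coord_image (cyl_atlas C) i)"
  by (simp add: cyl_atlas_simps open_Times atlasD(1))

text \<open>Transition maps of the cylinder fix the first coordinate, so functions of
  \<open>r\<close> are invariant under them.\<close>

lemma tensor_field_cyl_function:
  fixes \<alpha> :: "('i, real \<times> 'e::euclidean_space, real) tensor"
  assumes "atlas C" "smooth_on UNIV c" "tensor_field (cyl_atlas C) k \<alpha>"
  shows "tensor_field (cyl_atlas C) k (\<lambda>i p vs. c (fst p) * \<alpha> i p vs)"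
proof -
  have "smooth_on (coord_image (cyl_atlas C) i) (\<lambda>p. c (fst p))" for i
    using assms(2) by (intro smooth_on_compose_linear[OF open_cyl_coord_image[OF assms(1)] bounded_linear_fst]) auto
  moreover have "c (fst p) = c (fst (transition (cyl_atlas C) i j p))" if "p \<in> coord_overlap (cyl_atlas C) i j" for i j p
    using that by (auto simp: cyl_atlas_simps(3) cyl_transition[OF assms(1)])
  ultimately show ?thesis
    by (intro tensor_fieldI smooth_on_mult open_cyl_coord_image multilinear_cmult arg_cong2[where f = "(*)"]
        tensor_fieldD[OF assms(3)] assms(1))
qed

lemma tensor_field_pullback:
  fixes \<alpha> :: "('i, 'e::euclidean_space, 'a::real_normed_vector) tensor"
  assumes C: "atlas C" and \<alpha>: "tensor_field C k \<alpha>"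
  shows "tensor_field (cyl_atlas C) k (pullback_N \<alpha>)"
  unfolding tensor_field_def
proof (intro conjI allI ballI impI)
  fix i and p :: "real \<times> 'e" assume "p \<in> coord_image (cyl_atlas C) i"
  then have "multilinear k (\<alpha> i (snd p))" using \<alpha> by (auto simp: tensor_field_def cyl_atlas_simps)
  then show "multilinear k (pullback_N \<alpha> i p)"
    unfolding pullback_N_def by (rule multilinear_map) (simp add: linear_iff)
next
  fix i and vs :: "(real \<times> 'e) list" assume "length vs = k"
  then show "smooth_on (coord_image (cyl_atlas C) i) (\<lambda>p. pullback_N \<alpha> i p vs)"
    unfolding pullback_N_def using \<alpha>
    by (intro smooth_on_compose_linear[OF open_cyl_coord_image[OF C] bounded_linear_snd, of _ "coord_image C i"])
       (auto simp: cyl_atlas_simps tensor_field_def)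
next
  fix i j and p :: "real \<times> 'e" and vs :: "(real \<times> 'e) list"
  assume p: "p \<in> coord_overlap (cyl_atlas C) i j" and vs: "length vs = k"
  then have p': "snd p \<in> coord_overlap C i j" by (auto simp: cyl_atlas_simps)
  then have "\<alpha> i (snd p) (map snd vs) =
      \<alpha> j (transition C i j (snd p)) (map (Der (transition C i j) (snd p)) (map snd vs))"
    using \<alpha> vs by (simp add: tensor_field_def)
  then show "pullback_N \<alpha> i p vs = pullback_N \<alpha> j (transition (cyl_atlas C) i j p)
      (map (Der (transition (cyl_atlas C) i j) p) vs)"
    by (simp add: pullback_N_def cyl_transition[OF C p'] cyl_transition_derivative[OF C p'] o_def)
qed

lemma smooth_on_wedge_dr:
  assumes "open S" "\<And>us. length us + 1 = length vs \<Longrightarrow> smooth_on S (\<lambda>p. \<beta> p us)"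
  shows "smooth_on S (\<lambda>p. wedge (Suc 0) (dr i p) (\<beta> p) vs)"
  using assms(2)
proof (induction vs arbitrary: \<beta>)
  case Nil then show ?case by (simp add: wedge_Nil smooth_on_const assms(1))
next
  case (Cons v vs)
  have "smooth_on S (\<lambda>p. fst v * \<beta> p vs - wedge (Suc 0) (dr i p) (\<lambda>us. \<beta> p (v # us)) vs)"
    using Cons.prems
    by (intro smooth_on_diff smooth_on_mult smooth_on_const Cons.IH[of "\<lambda>p us. \<beta> p (v # us)"] assms(1)) auto
  moreover have "dr i p [v] = fst v" for p by (simp add: dr_def)
  ultimately show ?case by (simp add: wedge_1_Cons)
qed

lemma tensor_field_wedge_dr:
  fixes \<alpha> :: "('i, 'e::euclidean_space, real) tensor"
  assumes C: "atlas C" and \<alpha>: "tensor_field C k \<alpha>"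
  shows "tensor_field (cyl_atlas C) (Suc k) (\<lambda>i p. wedge (Suc 0) (dr i p) (pullback_N \<alpha> i p))"
  unfolding tensor_field_def
proof (intro conjI allI ballI impI)
  note pb = tensor_field_pullback[OF C \<alpha>, unfolded tensor_field_def]
  fix i
  {
    fix p :: "real \<times> 'e" assume "p \<in> coord_image (cyl_atlas C) i"
    then show "multilinear (Suc k) (wedge (Suc 0) (dr i p) (pullback_N \<alpha> i p))"
      using pb by (intro multilinear_wedge_1) (auto simp: dr_def linear_iff)
  }
  {
    fix vs :: "(real \<times> 'e) list" assume "length vs = Suc k"
    then show "smooth_on (coord_image (cyl_atlas C) i) (\<lambda>p. wedge (Suc 0) (dr i p) (pullback_N \<alpha> i p) vs)"
      using pb by (intro smooth_on_wedge_dr open_cyl_coord_image[OF C]) auto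
  }
  fix j and p :: "real \<times> 'e" and vs :: "(real \<times> 'e) list"
  assume p: "p \<in> coord_overlap (cyl_atlas C) i j" and vs: "length vs = Suc k"
  then have p': "snd p \<in> coord_overlap C i j" by (auto simp: cyl_atlas_simps)
  show "wedge (Suc 0) (dr i p) (pullback_N \<alpha> i p) vs =
      wedge (Suc 0) (dr j (transition (cyl_atlas C) i j p)) (pullback_N \<alpha> j (transition (cyl_atlas C) i j p))
      (map (Der (transition (cyl_atlas C) i j) p) vs)"
    unfolding wedge_map
  proof (rule wedge_cong)
    show "dr i p us = dr j (transition (cyl_atlas C) i j p) (map (Der (transition (cyl_atlas C) i j) p) us)"
      if "length us = Suc 0" for us
      using that by (simp add: dr_def cyl_transition_derivative[OF C p'])
    show "pullback_N \<alpha> i p us = pullback_N \<alpha> j (transition (cyl_atlas C) i j p)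
        (map (Der (transition (cyl_atlas C) i j) p) us)"
      if "length us + Suc 0 = length vs" for us
      using pb p that vs by simp
  qed
qed

lemma tensor_field_cyl_metric:
  fixes g :: "('i, 'e::euclidean_space, real) tensor"
  assumes C: "atlas C" and g: "tensor_field C 2 g"
  shows "tensor_field (cyl_atlas C) 2 (cyl_metric g)"
proof -
  have "tensor_field (cyl_atlas C) 2 (\<lambda>i p vs. fst (vs ! 0) * fst (vs ! 1) :: real)"
    by (rule tensor_fieldI)
       (auto simp: multilinear_2 linear_iff algebra_simps smooth_on_const[OF open_cyl_coord_image[OF C]] cyl_atlas_simps(3)
        cyl_transition_derivative[OF C])
  from tensor_field_add[OF open_cyl_coord_image[OF C] this tensor_field_pullback[OF C g]]
  show ?thesis by (simp add: cyl_metric_def[abs_def])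
qed

lemma vector_field_cyl_field:
  fixes C :: "'i \<Rightarrow> ('m::{t2_space,second_countable_topology}, 'e::euclidean_space) chart"
  assumes C: "atlas C" and b: "smooth_on UNIV b"
  shows "vector_field (cyl_atlas C) (cyl_field b)"
proof -
  have "smooth_on (coord_image (cyl_atlas C) i) (cyl_field b i)" for i
  proof -
    have "bounded_linear (\<lambda>t::real. (t, 0::'e))"
      by (intro bounded_linear_Pair bounded_linear_ident bounded_linear_zero)
    moreover have "smooth_on (coord_image (cyl_atlas C) i) (\<lambda>p. b (fst p))"
      using b by (intro smooth_on_compose_linear[OF open_cyl_coord_image[OF C] bounded_linear_fst]) auto
    ultimately show ?thesis
      using smooth_on_bounded_linear[OF open_cyl_coord_image[OF C]] by (force simp: cyl_field_def[abs_def])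
  qed
  moreover have "Der (transition C i j) x 0 = 0" if "x \<in> coord_overlap C i j" for i j x
    using smooth_on_differentiable[OF atlasD(4)[OF C] that] linear_frechet_derivative linear_0 by blast
  ultimately show ?thesis
    by (auto simp: vector_field_def cyl_atlas_simps(3) cyl_field_def cyl_transition[OF C] cyl_transition_derivative[OF C])
qed


subsection \<open>Isometric solitons on the cylinder\<close>

definition phase :: "(real \<Rightarrow> real) \<Rightarrow> (real \<Rightarrow> real) \<Rightarrow> real \<Rightarrow> complex" where
  "phase f a r = (complex_of_real (f r) - \<i> * complex_of_real (a r))\<^sup>2"

text \<open>If \<open>f = cos \<theta>\<close> and \<open>a = sin \<theta>\<close>, then this is the derivative of \<open>\<theta>\<close>.\<close>

definition speed :: "(real \<Rightarrow> real) \<Rightarrow> (real \<Rightarrow> real) \<Rightarrow> real \<Rightarrow> real" where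
  "speed f a r = f r * deriv a r - a r * deriv f r"

lemma smooth_on_DERIV:
  assumes "smooth_on UNIV (f :: real \<Rightarrow> real)"
  shows "(f has_real_derivative deriv f r) (at r)"
  using smooth_on_differentiable[OF assms, of r] by (simp add: DERIV_deriv_iff_real_differentiable)

lemma smooth_on_deriv:
  assumes "smooth_on UNIV (f :: real \<Rightarrow> real)"
  shows "smooth_on UNIV (deriv f)"
proof -
  have "Der f x 1 = deriv f x" for x
    using Der_eqI[OF smooth_on_DERIV[OF assms, of x, unfolded has_field_derivative_def]] by simp
  moreover have "smooth_on UNIV (\<lambda>x. Der f x 1)"
    using assms unfolding smooth_on_def by (metis k_smooth_on.simps(2))
  ultimately show ?thesis by (simp add: fun_eq_iff)
qed

lemma smooth_on_speed: "smooth_on UNIV f \<Longrightarrow> smooth_on UNIV a \<Longrightarrow> smooth_on UNIV (speed f a)"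
  unfolding speed_def[abs_def] by (intro smooth_on_diff smooth_on_mult smooth_on_deriv open_UNIV)

text \<open>Differentiating \<open>f^2 + a^2 = 1\<close> shows that the velocity
  \<open>(f', a')\<close> is orthogonal to \<open>(f, a)\<close>, hence a multiple of
  \<open>(- a, f)\<close>; the speed is the factor.\<close>

lemma speed_unit:
  assumes f: "smooth_on UNIV f" and a: "smooth_on UNIV a" and fa: "\<And>r. (f r)\<^sup>2 = 1 - (a r)\<^sup>2"
  shows "deriv f r = - a r * speed f a r" "deriv a r = f r * speed f a r"
proof -
  have "((\<lambda>r. (f r)\<^sup>2 + (a r)\<^sup>2) has_real_derivative 2 * f r * deriv f r + 2 * a r * deriv a r) (at r)"
    by (auto intro!: derivative_eq_intros smooth_on_DERIV f a)
  moreover have "(\<lambda>r. (f r)\<^sup>2 + (a r)\<^sup>2) = (\<lambda>r. 1)" by (simp add: fa)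
  ultimately have "2 * f r * deriv f r + 2 * a r * deriv a r = 0" using DERIV_unique DERIV_const by metis
  then have 0: "f r * deriv f r = - a r * deriv a r" by simp
  have 1: "f r * f r = 1 - a r * a r" using fa[of r] by (simp add: power2_eq_square)
  have "- a r * speed f a r = f r * (- a r * deriv a r) + a r * a r * deriv f r"
    by (simp add: speed_def algebra_simps)
  also have "\<dots> = (f r * f r) * deriv f r + a r * a r * deriv f r" unfolding 0[symmetric] by simp
  finally show "deriv f r = - a r * speed f a r" unfolding 1 by (simp add: algebra_simps)
  have "f r * speed f a r = (f r * f r) * deriv a r - a r * (f r * deriv f r)"
    by (simp add: speed_def algebra_simps)
  then show "deriv a r = f r * speed f a r" unfolding 0 1 by (simp add: algebra_simps)
qed

text \<open>The factor \<open>f - \<i> a\<close> is multiplied by \<open>- \<i> \<kappa>\<close>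
  under differentiation, where \<kappa> is the speed; squaring doubles the rate.\<close>

lemma phase_has_derivative:
  assumes f: "smooth_on UNIV f" and a: "smooth_on UNIV a" and fa: "\<And>r. (f r)\<^sup>2 = 1 - (a r)\<^sup>2"
  shows "(phase f a has_vector_derivative - 2 * \<i> * complex_of_real (speed f a r) * phase f a r) (at r)"
proof -
  let ?z = "\<lambda>r. complex_of_real (f r) - \<i> * complex_of_real (a r)"
  have d: "(?z has_vector_derivative complex_of_real (deriv f r) - \<i> * complex_of_real (deriv a r)) (at r)"
    using f a by (auto intro!: derivative_intros smooth_on_DERIV simp: has_real_derivative_iff_has_vector_derivative[symmetric])
  have "((\<lambda>r. ?z r * ?z r) has_vector_derivative
      ?z r * (complex_of_real (deriv f r) - \<i> * complex_of_real (deriv a r)) +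
      (complex_of_real (deriv f r) - \<i> * complex_of_real (deriv a r)) * ?z r) (at r)"
    by (rule has_vector_derivative_mult[OF d d])
  moreover have "complex_of_real (deriv f r) - \<i> * complex_of_real (deriv a r) = - \<i> * complex_of_real (speed f a r) * ?z r"
    unfolding speed_unit[OF f a fa] by (simp add: complex_eq_iff)
  ultimately show ?thesis by (simp add: phase_def[abs_def] power2_eq_square algebra_simps)
qed

lemma cmod_phase: "(f r)\<^sup>2 = 1 - (a r)\<^sup>2 \<Longrightarrow> cmod (phase f a r) = 1"
  by (simp add: phase_def norm_power cmod_power2)

lemma has_derivative_snd_compose:
  fixes h :: "'e::real_normed_vector \<Rightarrow> 'a::real_normed_vector" and p :: "real \<times> 'e"
  assumes "h differentiable (at (snd p))"
  shows "((\<lambda>q. h (snd q)) has_derivative (\<lambda>u. Der h (snd p) (snd u))) (at p)"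
  using has_derivative_compose[OF bounded_linear_imp_has_derivative[OF bounded_linear_snd]
      assms[unfolded frechet_derivative_works]] .

lemma has_derivative_fst_compose:
  fixes h :: "real \<Rightarrow> 'a::real_normed_vector" and p :: "real \<times> 'e::real_normed_vector"
  assumes "(h has_vector_derivative d) (at (fst p))"
  shows "((\<lambda>q. h (fst q)) has_derivative (\<lambda>u. fst u *\<^sub>R d)) (at p)"
  using has_derivative_compose[OF bounded_linear_imp_has_derivative[OF bounded_linear_fst]
      assms[unfolded has_vector_derivative_def]] .

section \<open>From the global Calabi-Yau data to charts\<close>

locale calabi_yau =
  fixes C :: "'i \<Rightarrow> ('n::{t2_space,second_countable_topology}, real^6) chart"
    and g :: "('i, real^6, real) tensor"
    and J :: "'i \<Rightarrow> real^6 \<Rightarrow> real^6 \<Rightarrow> real^6"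
    and \<omega> :: "('i, real^6, real) tensor"
    and \<Omega> :: "('i, real^6, complex) tensor"
  assumes calabi_yau_3fold: "calabi_yau_3fold C g J \<omega> \<Omega>"
begin

lemma atlas_C: "atlas C"
  using calabi_yau_3fold by (simp add: calabi_yau_3fold_def)

lemma tensor_field_cy: "tensor_field C 2 g" "tensor_field C 2 \<omega>" "tensor_field C 3 \<Omega>"
    "tensor_field C 6 (kaehler_volume \<omega>)"
  using calabi_yau_3fold by (simp_all add: calabi_yau_3fold_def riemannian_metric_def form_field_def volume_form_def)

lemma su3:
  assumes x: "x \<in> coord_image C i"
  shows "su3_form (g i x) (J i x) (\<Omega> i x) (\<omega> i x) (kaehler_volume \<omega> i x)"
proof (intro su3_form.intro hermitian_form.intro inner_form.intro form_3_0.intro hermitian_form_axioms.intro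
    su3_form_axioms.intro)
  show "multilinear 2 (g i x)" "multilinear 3 (\<Omega> i x)" "multilinear 6 (kaehler_volume \<omega> i x)"
    by (rule tensor_field_cy[THEN tensor_fieldD(1), OF x])+
  have g: "riemannian_metric C g" and J: "integrable_complex_structure C J" and \<Omega>: "form_field C 3 \<Omega>"
    and vol: "volume_form C g (kaehler_volume \<omega>)"
    using calabi_yau_3fold by (simp_all add: calabi_yau_3fold_def)
  show "alternating 3 (\<Omega> i x)" "alternating 6 (kaehler_volume \<omega> i x)"
    using \<Omega> vol x by (simp_all add: form_field_def volume_form_def)
  show "g i x [u, v] = g i x [v, u]" "v \<noteq> 0 \<Longrightarrow> 0 < g i x [v, v]" for u v
    using g x unfolding riemannian_metric_def by blast+
  show "linear (J i x)" "J i x (J i x v) = - v" for v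
    using J x by (simp_all add: integrable_complex_structure_def endomorphism_field_def)
  show "orthonormal_frame (g i x) es \<Longrightarrow> \<bar>kaehler_volume \<omega> i x es\<bar> = 1" for es
    using vol x unfolding volume_form_def by blast
  have p: "(\<forall>u v. g i x [J i x u, J i x v] = g i x [u, v]) \<and> (\<forall>u v. \<omega> i x [u, v] = g i x [J i x u, v]) \<and>
      (\<forall>u v w. \<Omega> i x [J i x u, v, w] = \<i> * \<Omega> i x [u, v, w]) \<and>
      (\<forall>vs. length vs = 6 \<longrightarrow> complex_of_real (kaehler_volume \<omega> i x vs) =
        \<i> / 8 * wedge 3 (\<Omega> i x) (\<lambda>us. cnj (\<Omega> i x us)) vs)"
    using calabi_yau_3fold x unfolding calabi_yau_3fold_def by (elim conjE ballE allE[of _ i]) blast+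
  show "g i x [J i x u, J i x v] = g i x [u, v]" for u v using p by blast
  show "\<omega> i x [u, v] = g i x [J i x u, v]" for u v using p by blast
  show "\<Omega> i x [J i x u, v, w] = \<i> * \<Omega> i x [u, v, w]" for u v w using p by blast
  show "length vs = 6 \<Longrightarrow> complex_of_real (kaehler_volume \<omega> i x vs) =
      \<i> / 8 * wedge 3 (\<Omega> i x) (\<lambda>us. cnj (\<Omega> i x us)) vs" for vs using p by blast
qed

lemma cy_chart: "cy_chart (coord_image C i) (g i) (J i) (\<omega> i) (\<Omega> i) (kaehler_volume \<omega> i)"
proof (intro cy_chart.intro kaehler_chart.intro metric_chart.intro kaehler_chart_axioms.intro cy_chart_axioms.intro)
  let ?S = "coord_image C i"
  have J: "integrable_complex_structure C J" and closed: "closed_form C 2 \<omega>" "closed_form C 3 \<Omega>"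
    using calabi_yau_3fold by (simp_all add: calabi_yau_3fold_def)
  show "open ?S" by (rule atlasD(1)[OF atlas_C])
  fix x assume x: "x \<in> ?S"
  interpret su3_form "g i x" "J i x" "\<Omega> i x" "\<omega> i x" "kaehler_volume \<omega> i x" using su3[OF x] .
  show "inner_form (g i x)" by (rule inner_form_axioms)
  show "(\<lambda>y. g i y [u, v]) differentiable (at x)" for u v
    using tensor_fieldD(2)[OF tensor_field_cy(1), of "[u, v]"] smooth_on_differentiable x by auto
  show "hermitian_form (g i x) (J i x) (\<omega> i x)" by (rule hermitian_form_axioms)
  show "(\<lambda>y. J i y v) differentiable (at x)" for v
    using J x by (intro smooth_on_differentiable[of ?S])
      (simp_all add: integrable_complex_structure_def endomorphism_field_def)
  show "ext_deriv (\<omega> i) x [u, v, w] = 0" for u v w using closed x by (simp add: closed_form_def)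
  show "lie_bracket (\<lambda>y. J i y u) (\<lambda>y. J i y v) x - J i x (lie_bracket (\<lambda>y. J i y u) (\<lambda>y. v) x)
      - J i x (lie_bracket (\<lambda>y. u) (\<lambda>y. J i y v) x) = 0" for u v
    using J x by (simp add: integrable_complex_structure_def)
  show "su3_form (g i x) (J i x) (\<Omega> i x) (\<omega> i x) (kaehler_volume \<omega> i x)" by (rule su3[OF x])
  show "(\<lambda>y. \<Omega> i y vs) differentiable (at x)" if "length vs = 3" for vs
    using tensor_fieldD(2)[OF tensor_field_cy(3) that] smooth_on_differentiable x by auto
  show "ext_deriv (\<Omega> i) x [a, b, c, d] = 0" for a b c d using closed x by (simp add: closed_form_def)
  show "kaehler_volume \<omega> i x vs = wedge 2 (\<omega> i x) (wedge 2 (\<omega> i x) (\<omega> i x)) vs / 6" for vs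
    by (simp add: kaehler_volume_def)
qed

lemma metric_chart: "metric_chart (coord_image C i) (g i)"
  using cy_chart by (simp add: cy_chart_def kaehler_chart_def)

section \<open>The rotated structure and its torsion\<close>

context
  fixes f a :: "real \<Rightarrow> real" and i :: 'i
  assumes f: "smooth_on UNIV f" and a: "smooth_on UNIV a" and fa: "\<And>r. (f r)\<^sup>2 = 1 - (a r)\<^sup>2"
begin

abbreviation "S \<equiv> coord_image C i"
abbreviation "\<zeta> \<equiv> phase f a"
abbreviation "\<kappa> \<equiv> speed f a"
abbreviation "\<phi> \<equiv> cyl_isometric_form g \<omega> \<Omega> f a i"
abbreviation "cg \<equiv> cyl_metric g i"
abbreviation "\<mu> \<equiv> cyl_volume \<omega> i"

definition phi :: "cyl \<Rightarrow> cyl list \<Rightarrow> real" where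
  "phi p vs = Re (\<zeta> (fst p) * \<Omega> i (snd p) (map snd vs)) - wedge (Suc 0) (dr i p) (pullback_N \<omega> i p) vs"

lemma open_cyl: "open (UNIV \<times> S)"
  by (simp add: open_Times atlasD(1)[OF atlas_C])

lemma su3_rotated:
  assumes "snd p \<in> S"
  shows "su3_form (g i (snd p)) (J i (snd p)) (\<lambda>vs. \<zeta> (fst p) * \<Omega> i (snd p) vs) (\<omega> i (snd p))
    (kaehler_volume \<omega> i (snd p))"
  using su3_form.su3_form_rotate[OF su3[OF assms] cmod_phase[of f "fst p" a]] fa by simp

lemma cyl_tensors:
  assumes p: "snd p \<in> S"
  shows "cg p = su3_form.cyl_G (g i (snd p))" "\<mu> p = su3_form.cyl_vol (kaehler_volume \<omega> i (snd p))"
    "cyl_g2 \<omega> \<Omega> i p = su3_form.cyl_phi (\<Omega> i (snd p)) (\<omega> i (snd p))"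
  using su3_form.cyl_G_def[OF su3[OF p]] su3_form.cyl_vol_def[OF su3[OF p]] su3_form.cyl_phi_def[OF su3[OF p]]
  by (simp_all add: fun_eq_iff cyl_metric_def pullback_N_def[abs_def] cyl_volume_def dr_def[abs_def] cyl_g2_def)

text \<open>The double-angle coefficients \<open>f^2 - a^2\<close> and \<open>2 f a\<close> of the
  real and imaginary parts of \<Omega> form the phase. The coefficients of the wedge of dr and
  \<omega>, \<open>- (f^2 - a^2)\<close> and \<open>- 2 a^2\<close>, add up to -1.\<close>

lemma cyl_isometric_form_eq:
  assumes p: "snd p \<in> S" and vs: "length vs = 3"
  shows "\<phi> p vs = phi p vs"
proof -
  interpret su3_form "g i (snd p)" "J i (snd p)" "\<Omega> i (snd p)" "\<omega> i (snd p)" "kaehler_volume \<omega> i (snd p)"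
    using su3[OF p] .
  note [simp] = cyl_tensors[OF p]
  let ?W = "wedge (Suc 0) (dr i p) (pullback_N \<omega> i p) vs"
  let ?r = "fst p"
  \<comment> \<open>A vector along the line is annihilated by both pullbacks, so contraction only
    strips off dr.\<close>
  have 1: "interior (a ?r, 0) cyl_phi us = - a ?r * pullback_N \<omega> i p us" if "length us = 2" for us
  proof -
    have "\<omega> i (snd p) (0 # ws) = 0" if "length ws = 1" for ws
      using multilinear_zero[OF multilinear_\<omega>, of "0 # ws"] that by simp
    then have "wedge (Suc 0) (\<lambda>vs. fst (vs ! 0)) (\<lambda>us. \<omega> i (snd p) (0 # map snd us)) us = 0"
      using that by (intro wedge_1_zero) auto
    moreover have "\<Omega> i (snd p) (0 # map snd us) = 0"
      using multilinear_zero[OF multilinear_\<Omega>, of "0 # map snd us"] that by simp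
    ultimately show ?thesis by (simp add: interior_def cyl_phi_def wedge_1_Cons pullback_N_def)
  qed
  have "wedge 1 (flat cyl_G (a ?r, 0)) (interior (a ?r, 0) cyl_phi) vs =
      wedge 1 (\<lambda>us. a ?r * dr i p us) (\<lambda>us. - a ?r * pullback_N \<omega> i p us) vs"
    by (rule wedge_cong) (use vs 1 in \<open>auto simp: length_Suc_conv flat_def cyl_G_def dr_def G_simps\<close>)
  also have "\<dots> = - (a ?r)\<^sup>2 * ?W"
    by (simp only: wedge_cmult) (simp add: power2_eq_square)
  finally have W: "wedge 1 (flat cyl_G (a ?r, 0)) (interior (a ?r, 0) cyl_phi) vs = - (a ?r)\<^sup>2 * ?W" .
  have N: "cyl_G [(a ?r, 0), (a ?r, 0)] = (a ?r)\<^sup>2" by (simp add: cyl_G_def G_simps power2_eq_square)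
  have 2: "\<phi> p vs = ((f ?r)\<^sup>2 - (a ?r)\<^sup>2) * cyl_phi vs + 2 * f ?r * a ?r * Im (\<Omega> i (snd p) (map snd vs)) - 2 * (a ?r)\<^sup>2 * ?W"
    using W N vs
    by (simp add: cyl_isometric_form_def isometric_form_def cyl_function_def cyl_field_def interior_def hodge_cyl_phi_dr)
  have 4: "cyl_phi vs = Re (\<Omega> i (snd p) (map snd vs)) - ?W"
    by (simp add: cyl_phi_def dr_def[abs_def] pullback_N_def[abs_def])
  have 3: "Re (\<zeta> ?r * z) = ((f ?r)\<^sup>2 - (a ?r)\<^sup>2) * Re z + 2 * f ?r * a ?r * Im z" for z
    by (simp add: phase_def power2_eq_square algebra_simps)
  show ?thesis unfolding phi_def 2 3 4 fa by (simp add: algebra_simps)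
qed

lemma cyl_metric_has_derivative:
  assumes p: "snd p \<in> S"
  shows "((\<lambda>q. cg q [v, w]) has_derivative (\<lambda>u. Der (\<lambda>y. g i y [snd v, snd w]) (snd p) (snd u))) (at p)"
proof -
  have "((\<lambda>q. fst v * fst w + g i (snd q) [snd v, snd w]) has_derivative
      (\<lambda>u. 0 + Der (\<lambda>y. g i y [snd v, snd w]) (snd p) (snd u))) (at p)"
    by (intro has_derivative_add has_derivative_const has_derivative_snd_compose metric_chart.diff_g[OF metric_chart p])
  then show ?thesis by (simp add: cyl_metric_def pullback_N_def)
qed

lemma metric_chart_cyl: "metric_chart (UNIV \<times> S) cg"
proof (rule metric_chart.intro)
  show "open (UNIV \<times> S)" by (rule open_cyl)
next
  fix p :: "cyl" assume "p \<in> UNIV \<times> S"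
  then have p: "snd p \<in> S" by auto
  interpret su3_form "g i (snd p)" "J i (snd p)" "\<Omega> i (snd p)" "\<omega> i (snd p)" "kaehler_volume \<omega> i (snd p)"
    using su3[OF p] .
  show "inner_form (cg p)" using cyl.inner_form_axioms by (simp add: cyl_tensors[OF p])
  show "(\<lambda>y. cg y [u, v]) differentiable (at p)" for u v
    using cyl_metric_has_derivative[OF p] unfolding differentiable_def by blast
qed

text \<open>By the Koszul formula: the dr-part of the metric is constant and the other part does not
  depend on \<open>r\<close>.\<close>

lemma christoffel_cyl:
  assumes p: "snd p \<in> S"
  shows "christoffel cg p u v = (0, christoffel (g i) (snd p) (snd u) (snd v))"
proof -
  interpret cy_chart S "g i" "J i" "\<omega> i" "\<Omega> i" "kaehler_volume \<omega> i" by (rule cy_chart)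
  interpret cyl: metric_chart "UNIV \<times> S" cg by (rule metric_chart_cyl)
  have p': "p \<in> UNIV \<times> S" using p by (simp add: mem_Times_iff)
  note D = Der_eqI[OF cyl_metric_has_derivative[OF p]]
  interpret inner_form "cg p" by (rule cyl.inner_g[OF p'])
  show ?thesis
  proof (rule G_eqI)
    fix w
    have "cg p [(0, christoffel (g i) (snd p) (snd u) (snd v)), w] =
        g i (snd p) [christoffel (g i) (snd p) (snd u) (snd v), snd w]"
      by (simp add: cyl_metric_def pullback_N_def)
    then show "cg p [christoffel cg p u v, w] = cg p [(0, christoffel (g i) (snd p) (snd u) (snd v)), w]"
      by (simp add: cyl.christoffel[OF p'] christoffel[OF p] D)
  qed
qed

text \<open>The Christoffel terms cancel the derivatives of the parallel forms \<omega> and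
  \<Omega>. What remains is the derivative of the phase, and the real part of
  \<open>- 2 \<i> \<kappa> \<zeta> \<Omega>\<close> is \<open>2 \<kappa>\<close> times the imaginary
  part of \<open>\<zeta> \<Omega>\<close>.\<close>

lemma nabla_phi:
  assumes p: "snd p \<in> S"
  shows "nabla cg \<phi> p u [v, w, z] =
    2 * \<kappa> (fst p) * fst u * Im (\<zeta> (fst p) * \<Omega> i (snd p) [snd v, snd w, snd z])"
proof -
  interpret cy_chart S "g i" "J i" "\<omega> i" "\<Omega> i" "kaehler_volume \<omega> i" by (rule cy_chart)
  interpret cyl: metric_chart "UNIV \<times> S" cg by (rule metric_chart_cyl)
  have p': "p \<in> UNIV \<times> S" using p by (simp add: mem_Times_iff)
  have phi3: "phi q [v, w, z] = Re (\<zeta> (fst q) * \<Omega> i (snd q) [snd v, snd w, snd z]) -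
      (fst v * \<omega> i (snd q) [snd w, snd z] - (fst w * \<omega> i (snd q) [snd v, snd z] - fst z * \<omega> i (snd q) [snd v, snd w]))"
    for q v w z
    by (simp add: phi_def wedge_1_Cons wedge_Nil dr_def pullback_N_def)
  let ?D\<Omega> = "Der (\<lambda>y. \<Omega> i y [snd v, snd w, snd z]) (snd p) (snd u)"
  let ?D\<omega> = "\<lambda>v w. Der (\<lambda>y. \<omega> i y [v, w]) (snd p) (snd u)"
  let ?\<Gamma> = "\<lambda>v. christoffel (g i) (snd p) (snd u) v"
  have diff_\<omega>: "(\<lambda>y. \<omega> i y [v, w]) differentiable (at (snd p))" for v w
    using \<omega>_has_derivative[OF p] by (auto simp: differentiable_def)
  have "Der (\<lambda>q. \<phi> q [v, w, z]) p u = Der (\<lambda>q. phi q [v, w, z]) p u"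
    by (intro fun_cong[OF Der_cong_open[OF open_cyl p']] cyl_isometric_form_eq) auto
  also have "\<dots> = Re (\<zeta> (fst p) * ?D\<Omega> +
        fst u *\<^sub>R (- 2 * \<i> * complex_of_real (\<kappa> (fst p)) * \<zeta> (fst p)) * \<Omega> i (snd p) [snd v, snd w, snd z]) -
      (fst v * ?D\<omega> (snd w) (snd z) - (fst w * ?D\<omega> (snd v) (snd z) - fst z * ?D\<omega> (snd v) (snd w)))"
    unfolding phi3
    by (rule Der_eqI, intro has_derivative_diff has_derivative_Re has_derivative_mult
        has_derivative_mult_right has_derivative_fst_compose has_derivative_snd_compose diff_\<Omega>[OF p] diff_\<omega>
        phase_has_derivative[OF f a fa]) simp
  finally have D: "Der (\<lambda>q. \<phi> q [v, w, z]) p u = \<dots>" .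
  have "covariant (g i) (\<Omega> i) (snd p) (snd u) [snd v, snd w, snd z] = 0"
    by (rule covariant_\<Omega>[OF p]) simp
  then have 1: "?D\<Omega> = \<Omega> i (snd p) [?\<Gamma> (snd v), snd w, snd z] + \<Omega> i (snd p) [snd v, ?\<Gamma> (snd w), snd z] +
      \<Omega> i (snd p) [snd v, snd w, ?\<Gamma> (snd z)]"
    by (simp add: covariant_def numeral_3_eq_3 algebra_simps)
  have 2: "?D\<omega> v w = \<omega> i (snd p) [?\<Gamma> v, w] + \<omega> i (snd p) [v, ?\<Gamma> w]" for v w
    using nabla_\<omega>[OF p, of "snd u" v w] by (simp add: nabla_def algebra_simps)
  show ?thesis
    unfolding nabla_def D 1 2
    by (simp add: numeral_3_eq_3 cyl_isometric_form_eq[OF p] phi3 christoffel_cyl[OF p])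
       (simp add: algebra_simps)
qed

context
  fixes p :: "cyl"
  assumes p: "snd p \<in> S"
begin

interpretation su3_form "g i (snd p)" "J i (snd p)" "\<lambda>vs. \<zeta> (fst p) * \<Omega> i (snd p) vs" "\<omega> i (snd p)"
    "kaehler_volume \<omega> i (snd p)"
  using su3_rotated[OF p] .

text \<open>Metric and volume form do not see the phase, so the pointwise results for product forms
  apply with \<open>\<zeta> \<Omega>\<close> in place of \<Omega>, including the star of \<phi>(f,
  X).\<close>

lemma isometric_form_rotated:
  "cg p = cyl_G" "\<mu> p = cyl_vol" "length vs = 3 \<Longrightarrow> \<phi> p vs = cyl_phi vs"
  "hodge (cg p) (\<mu> p) 3 (\<phi> p) = hodge cyl_G cyl_vol 3 cyl_phi"
proof -
  show 1: "cg p = cyl_G" "\<mu> p = cyl_vol" by (rule cyl_tensors[OF p])+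
  show 2: "\<phi> p vs = cyl_phi vs" if "length vs = 3" for vs
    using cyl_isometric_form_eq[OF p that]
    by (simp add: phi_def cyl_phi_def pullback_N_def[abs_def] dr_def[abs_def])
  show "hodge (cg p) (\<mu> p) 3 (\<phi> p) = hodge cyl_G cyl_vol 3 cyl_phi"
    unfolding 1 hodge_def using 2 by (intro ext arg_cong2[where f = "(/)"] sum.cong) auto
qed

text \<open>For fixed \<open>u\<close>, the candidate is dual to a multiple of
  \<open>(1, 0)\<close>, and \<open>hodge_cyl_phi_dr\<close> turns that vector into the right-hand
  side of \<open>nabla_phi\<close>. Uniqueness is the nondegeneracy of the 4-form.\<close>

lemma torsion_cyl:
  "torsion \<phi> cg \<mu> p vs = - 2 * \<kappa> (fst p) * fst (vs ! 0) * fst (vs ! 1)"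
proof -
  let ?H = "hodge cyl_G cyl_vol 3 cyl_phi"
  let ?P = "\<lambda>T. bilinear T \<and> (\<forall>u v w z. nabla cg \<phi> p u [v, w, z] = (\<Sum>q\<in>onb (cg p). T u q * ?H [q, v, w, z]))"
  define T0 where "T0 u v = - 2 * \<kappa> (fst p) * fst u * fst v" for u v :: "cyl"
  have sum_H: "(\<Sum>q\<in>onb cyl_G. c q * ?H [q, v, w, z]) = ?H [\<Sum>q\<in>onb cyl_G. c q *\<^sub>R q, v, w, z]"
    for c v w z
    by (simp add: linear_sum[OF linear_hodge_cyl_phi] linear_scale[OF linear_hodge_cyl_phi])
  have T0: "?P T0"
  proof (intro conjI allI)
    show "bilinear T0" by (simp add: bilinear_def T0_def linear_iff algebra_simps)
    fix u v w z :: "cyl"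
    have "(\<Sum>q\<in>onb cyl_G. cyl_G [(- 2 * \<kappa> (fst p) * fst u, 0), q] *\<^sub>R q) = (- 2 * \<kappa> (fst p) * fst u, 0)"
      by (rule cyl.onb_expand)
    moreover have "cyl_G [(- 2 * \<kappa> (fst p) * fst u, 0), q] = T0 u q" for q
      by (simp add: cyl_G_def T0_def G_simps)
    ultimately have "(\<Sum>q\<in>onb cyl_G. T0 u q *\<^sub>R q) = (- 2 * \<kappa> (fst p) * fst u, 0)" by simp
    then have "(\<Sum>q\<in>onb cyl_G. T0 u q * ?H [q, v, w, z]) =
        2 * \<kappa> (fst p) * fst u * Im (\<zeta> (fst p) * \<Omega> i (snd p) [snd v, snd w, snd z])"
      unfolding sum_H using hodge_cyl_phi_dr[of "[v, w, z]" "- 2 * \<kappa> (fst p) * fst u"] by simp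
    then show "nabla cg \<phi> p u [v, w, z] = (\<Sum>q\<in>onb (cg p). T0 u q * ?H [q, v, w, z])"
      using nabla_phi[OF p, of u v w z] isometric_form_rotated(1) by simp
  qed
  have "T = T0" if T: "?P T" for T
  proof (intro ext)
    fix u q'
    \<comment> \<open>The vector dual to this functional is annihilated by the 4-form; hence it
      vanishes, and the functional with it.\<close>
    let ?D = "\<lambda>q. T u q - T0 u q"
    have "bilinear T" "bilinear T0" using T T0 by blast+
    then have lin: "linear ?D"
      unfolding bilinear_def by (intro linear_compose_sub) blast+
    have "?H [\<Sum>q\<in>onb cyl_G. ?D q *\<^sub>R q, v, w, z] = 0" for v w z
    proof -
      have "(\<Sum>q\<in>onb cyl_G. T u q * ?H [q, v, w, z]) = (\<Sum>q\<in>onb cyl_G. T0 u q * ?H [q, v, w, z])"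
        using T T0 isometric_form_rotated(1) by metis
      then show ?thesis unfolding sum_H[symmetric] by (simp add: left_diff_distrib sum_subtractf)
    qed
    then have z: "(\<Sum>q\<in>onb cyl_G. ?D q *\<^sub>R q) = 0" by (rule hodge_cyl_phi_nondegenerate)
    have "?D q' = ?D (\<Sum>q\<in>onb cyl_G. cyl_G [q', q] *\<^sub>R q)" by (simp only: cyl.onb_expand)
    also have "\<dots> = cyl_G [q', \<Sum>q\<in>onb cyl_G. ?D q *\<^sub>R q]"
      by (simp only: linear_sum[OF lin] linear_scale[OF lin] cyl.G_simps real_scaleR_def mult.commute)
    finally show "T u q' = T0 u q'" unfolding z by (simp add: cyl.G_simps)
  qed
  with T0 have "(THE T. ?P T) = T0" by (intro the_equality)
  then show ?thesis unfolding torsion_def isometric_form_rotated(4) by (simp add: T0_def)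
qed

text \<open>dr is the functional dual to the unit vector \<open>(1, 0)\<close>, so its contractions
  over \<open>onb\<close> are known without choosing a frame.\<close>

lemma onb_dr:
  "(\<Sum>e\<in>onb (cg p). (fst e)\<^sup>2) = 1" "(\<Sum>e\<in>onb (cg p). fst e *\<^sub>R e) = (1, 0)"
proof -
  have "cyl_G [(1, 0), e] = fst e" for e by (simp add: cyl_G_def G_simps)
  then show "(\<Sum>e\<in>onb (cg p). (fst e)\<^sup>2) = 1" "(\<Sum>e\<in>onb (cg p). fst e *\<^sub>R e) = (1, 0)"
    using cyl.onb_Parseval[of "(1, 0)"] cyl.onb_expand[of "(1, 0)"] isometric_form_rotated(1) by simp_all
qed

lemma form_dr_dr: "\<phi> p [(1, 0), (1, 0), w] = 0"
  using alternating_cyl(2) by (simp add: isometric_form_rotated alternating_def)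

lemma cyl_pointwise:
  "alternating 3 (\<phi> p)" "inner_form (cg p)" "alternating 7 (\<mu> p)"
  "orthonormal_frame (cg p) es \<Longrightarrow> \<bar>\<mu> p es\<bar> = 1"
  "\<exists>es. orthonormal_frame (cg p) es \<and> \<mu> p es = 1 \<and>
     (\<forall>q s t. q < s \<longrightarrow> s < t \<longrightarrow> t < 7 \<longrightarrow> \<phi> p [es ! q, es ! s, es ! t] = model_g2 q s t)"
  using alternating_cyl cyl.inner_form_axioms cyl_vol_orthonormal g2_frame_exists
  by (simp_all add: isometric_form_rotated alternating_def)

lemma linear_isometric_form: "linear (\<lambda>v. \<phi> p [v, z, w])" "linear (\<lambda>v. \<phi> p [z, v, w])"
proof -
  have e: "\<phi> p [u, v, w] = cyl_phi [u, v, w]" for u v w by (simp add: isometric_form_rotated)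
  show "linear (\<lambda>v. \<phi> p [v, z, w])" "linear (\<lambda>v. \<phi> p [z, v, w])"
    unfolding e using multilinear_cyl(2) unfolding multilinear_3 by blast+
qed

end

lemma tensor_norm2_torsion:
  assumes p: "snd p \<in> S"
  shows "tensor_norm2 (cg p) (torsion \<phi> cg \<mu> p) = 2 * \<bar>\<kappa> (fst p)\<bar>"
proof -
  have "(\<Sum>e\<in>onb (cg p). \<Sum>e'\<in>onb (cg p). (torsion \<phi> cg \<mu> p [e, e'])\<^sup>2) =
      (\<Sum>e\<in>onb (cg p). \<Sum>e'\<in>onb (cg p). (2 * \<kappa> (fst p))\<^sup>2 * ((fst e)\<^sup>2 * (fst e')\<^sup>2))"
    by (simp add: torsion_cyl[OF p] power_mult_distrib mult_ac)
  also have "\<dots> = (2 * \<kappa> (fst p))\<^sup>2 * ((\<Sum>e\<in>onb (cg p). (fst e)\<^sup>2) * (\<Sum>e\<in>onb (cg p). (fst e)\<^sup>2))"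
    unfolding sum_product by (simp only: sum_distrib_left)
  also have "\<dots> = (2 * \<kappa> (fst p))\<^sup>2" by (simp add: onb_dr[OF p])
  finally show ?thesis by (simp only: tensor_norm2_def real_sqrt_abs abs_mult abs_numeral)
qed

text \<open>The torsion reads only the dr-components of its arguments and the Christoffel symbols
  have none, so \<nabla> acts as the ordinary derivative of its coefficient.\<close>

lemma divergence_torsion:
  assumes p: "snd p \<in> S"
  shows "divergence cg (torsion \<phi> cg \<mu>) p w = - 2 * deriv \<kappa> (fst p) * fst w"
proof -
  have p': "p \<in> UNIV \<times> S" using p by (simp add: mem_Times_iff)
  have "nabla cg (torsion \<phi> cg \<mu>) p e [e, w] = - 2 * deriv \<kappa> (fst p) * fst w * (fst e)\<^sup>2" for e
  proof -
    have "Der (\<lambda>q. torsion \<phi> cg \<mu> q [e, w]) p e =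
        Der (\<lambda>q. - 2 * fst e * fst w * \<kappa> (fst q)) p e"
      by (intro fun_cong[OF Der_cong_open[OF open_cyl p']]) (auto simp: torsion_cyl)
    also have "\<dots> = - 2 * fst e * fst w * (fst e *\<^sub>R deriv \<kappa> (fst p))"
      by (rule Der_eqI)
         (intro has_derivative_mult_right has_derivative_fst_compose
            smooth_on_DERIV[OF smooth_on_speed[OF f a], unfolded has_real_derivative_iff_has_vector_derivative])
    finally show ?thesis
      by (simp add: nabla_def torsion_cyl[OF p] christoffel_cyl[OF p] power2_eq_square numeral_2_eq_2)
  qed
  then show ?thesis by (simp add: divergence_def sum_negf sum_distrib_left[symmetric] onb_dr[OF p])
qed

section \<open>The vector field b(r) d/dr: curl and Lie derivative of the metric\<close>

context
  fixes b :: "real \<Rightarrow> real"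
  assumes b: "smooth_on UNIV b"
begin

lemma b_fst_has_derivative: "((\<lambda>q. b (fst q)) has_derivative (\<lambda>u. fst u *\<^sub>R deriv b (fst p))) (at p)"
  by (intro has_derivative_fst_compose smooth_on_DERIV[OF b, unfolded has_real_derivative_iff_has_vector_derivative])

text \<open>The covariant derivative of the dual 1-form is \<open>b'\<close> times the square of dr,
  so both contractions insert the same vector \<open>(1, 0)\<close> into the 3-form.\<close>

lemma curl_cyl_field:
  assumes p: "snd p \<in> S"
  shows "curl \<phi> cg (cyl_field b i) p w = 0"
proof -
  have p': "p \<in> UNIV \<times> S" using p by (simp add: mem_Times_iff)
  have flat: "flat (cg q) (cyl_field b i q) [e] = fst e * b (fst q)" if "snd q \<in> S" for q e
    using inner_form.G_simps(7)[OF metric_chart.inner_g[OF metric_chart that]]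
    by (simp add: flat_def cyl_metric_def cyl_field_def pullback_N_def)
  have nab: "nabla cg (\<lambda>y. flat (cg y) (cyl_field b i y)) p e [e'] = deriv b (fst p) * (fst e * fst e')" for e e'
  proof -
    have "Der (\<lambda>q. flat (cg q) (cyl_field b i q) [e']) p e =
        Der (\<lambda>q. fst e' * b (fst q)) p e"
      by (intro fun_cong[OF Der_cong_open[OF open_cyl p']]) (auto simp: flat)
    also have "\<dots> = fst e' * (fst e *\<^sub>R deriv b (fst p))"
      by (rule Der_eqI) (intro has_derivative_mult_right b_fst_has_derivative)
    finally show ?thesis by (simp add: nabla_def flat[OF p] christoffel_cyl[OF p])
  qed
  note l = linear_isometric_form[OF p]
  have A: "(\<Sum>e'\<in>onb (cg p). fst e' * \<phi> p [e, e', w]) = \<phi> p [e, (1, 0), w]" for e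
    by (simp only: linear_sum[OF l(2)] linear_scale[OF l(2)] real_scaleR_def flip: onb_dr(2)[OF p])
  have B: "(\<Sum>e\<in>onb (cg p). fst e * \<phi> p [e, (1, 0), w]) = \<phi> p [(1, 0), (1, 0), w]"
    by (subst (2) onb_dr(2)[OF p, symmetric]) (simp only: linear_sum[OF l(1)] linear_scale[OF l(1)] real_scaleR_def)
  have "curl \<phi> cg (cyl_field b i) p w =
      (\<Sum>e\<in>onb (cg p). \<Sum>e'\<in>onb (cg p). deriv b (fst p) * (fst e * fst e') * \<phi> p [e, e', w])"
    by (simp add: curl_def nab)
  also have "\<dots> = deriv b (fst p) * (\<Sum>e\<in>onb (cg p). fst e * (\<Sum>e'\<in>onb (cg p). fst e' * \<phi> p [e, e', w]))"
    by (simp only: sum_distrib_left mult.assoc)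
  also have "\<dots> = deriv b (fst p) * \<phi> p [(1, 0), (1, 0), w]"
    by (simp only: A B)
  also have "\<dots> = 0" by (simp add: form_dr_dr[OF p])
  finally show ?thesis .
qed

lemma lie_derivative_cyl:
  assumes p: "snd p \<in> S"
  shows "lie_derivative (cyl_field b i) cg p [u, v] = 2 * deriv b (fst p) * fst u * fst v"
proof -
  interpret cy_chart S "g i" "J i" "\<omega> i" "\<Omega> i" "kaehler_volume \<omega> i" by (rule cy_chart)
  interpret inner_form "g i (snd p)" using inner_g[OF p] .
  have 1: "Der (\<lambda>q. cg q [u, v]) p (cyl_field b i p) = 0"
    using linear_0[OF linear_frechet_derivative[OF diff_g[OF p, of "snd u" "snd v"]]]
    by (simp add: Der_eqI[OF cyl_metric_has_derivative[OF p]] cyl_field_def)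
  have 2: "Der (cyl_field b i) p w = (fst w * deriv b (fst p), 0 :: real^6)" for w
  proof (rule Der_eqI)
    have "((\<lambda>q. (b (fst q), 0 :: real^6)) has_derivative (\<lambda>u. (fst u *\<^sub>R deriv b (fst p), 0))) (at p)"
      by (intro has_derivative_Pair b_fst_has_derivative has_derivative_const)
    then show "(cyl_field b i has_derivative (\<lambda>u. (fst u * deriv b (fst p), 0 :: real^6))) (at p)"
      by (simp add: cyl_field_def[abs_def])
  qed
  show ?thesis
    unfolding lie_derivative_def 1 by (simp add: 2 numeral_2_eq_2 cyl_metric_def pullback_N_def G_simps)
qed

end

end

section \<open>The global structure and the reduction to an ordinary differential equation\<close>

lemma g2_structure_cyl:
  assumes f: "smooth_on UNIV f" and a: "smooth_on UNIV a" and fa: "\<And>r. (f r)\<^sup>2 = 1 - (a r)\<^sup>2"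
  shows "g2_structure (cyl_atlas C) (cyl_isometric_form g \<omega> \<Omega> f a) (cyl_metric g) (cyl_volume \<omega>)"
proof -
  let ?\<phi> = "cyl_isometric_form g \<omega> \<Omega> f a"
  have snd: "snd p \<in> coord_image C i" if "p \<in> coord_image (cyl_atlas C) i" for p i
    using that by (auto simp: cyl_atlas_simps)
  note pt = cyl_pointwise[OF f a fa snd]
  have "tensor_field (cyl_atlas C) 3 ?\<phi>"
  proof (rule tensor_field_cong)
    show "open (coord_image (cyl_atlas C) i)" for i by (rule open_cyl_coord_image[OF atlas_C])
    show "transition (cyl_atlas C) i j x \<in> coord_image (cyl_atlas C) j" if "x \<in> coord_overlap (cyl_atlas C) i j" for i j x
      using that by (auto simp: cyl_atlas_simps cyl_transition[OF atlas_C] transition_coord_image[OF atlas_C])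
    let ?R = "\<lambda>i p vs. (((f (fst p))\<^sup>2 - (a (fst p))\<^sup>2) * Re (pullback_N \<Omega> i p vs) +
      (2 * f (fst p) * a (fst p)) * Im (pullback_N \<Omega> i p vs)) - wedge (Suc 0) (dr i p) (pullback_N \<omega> i p) vs"
    have "smooth_on UNIV (\<lambda>r. (f r)\<^sup>2 - (a r)\<^sup>2)" "smooth_on UNIV (\<lambda>r. 2 * f r * a r)"
      unfolding power2_eq_square by (intro smooth_on_diff smooth_on_mult smooth_on_const f a open_UNIV)+
    moreover note \<Omega> = tensor_field_pullback[OF atlas_C tensor_field_cy(3)]
    moreover have "tensor_field (cyl_atlas C) 3 (\<lambda>i p. wedge (Suc 0) (dr i p) (pullback_N \<omega> i p))"
      using tensor_field_wedge_dr[OF atlas_C tensor_field_cy(2)] by (simp add: numeral_3_eq_3 numeral_2_eq_2)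
    ultimately show "tensor_field (cyl_atlas C) 3 ?R"
      by (intro tensor_field_diff tensor_field_add tensor_field_cyl_function[OF atlas_C]
          tensor_field_bounded_linear[OF _ bounded_linear_Re] tensor_field_bounded_linear[OF _ bounded_linear_Im]
          open_cyl_coord_image[OF atlas_C])
    fix i p and vs :: "cyl list" assume p: "p \<in> coord_image (cyl_atlas C) i" and vs: "length vs = 3"
    have "Re (phase f a r * z) = ((f r)\<^sup>2 - (a r)\<^sup>2) * Re z + 2 * f r * a r * Im z" for r z
      by (simp add: phase_def power2_eq_square algebra_simps)
    then show "?\<phi> i p vs = ?R i p vs"
      by (simp add: cyl_isometric_form_eq[OF f a fa snd[OF p] vs] phi_def[OF f a fa] pullback_N_def)
  qed
  moreover have "riemannian_metric (cyl_atlas C) (cyl_metric g)"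
    unfolding riemannian_metric_def
    using tensor_field_cyl_metric[OF atlas_C tensor_field_cy(1)] pt(2)
    by (auto simp: inner_form_def)
  moreover have "volume_form (cyl_atlas C) (cyl_metric g) (cyl_volume \<omega>)"
  proof -
    have "tensor_field (cyl_atlas C) 7 (\<lambda>i p. wedge (Suc 0) (dr i p) (pullback_N (kaehler_volume \<omega>) i p))"
      using tensor_field_wedge_dr[OF atlas_C tensor_field_cy(4)] by simp
    then show ?thesis
      using pt(3,4) by (simp add: volume_form_def form_field_def cyl_volume_def[abs_def])
  qed
  ultimately show ?thesis using pt(1,5) by (simp add: g2_structure_def form_field_def)
qed

lemma isometric_soliton_iff:
  assumes f: "smooth_on UNIV f" and a: "smooth_on UNIV a" and fa: "\<And>r. (f r)\<^sup>2 = 1 - (a r)\<^sup>2"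
    and b: "smooth_on UNIV b"
  shows "isometric_soliton (cyl_atlas C) (cyl_metric g) (cyl_volume \<omega>) (cyl_isometric_form g \<omega> \<Omega> f a) (cyl_field b) c
    \<longleftrightarrow> c = 0 \<and> (\<forall>r. deriv b r = 0) \<and> (\<forall>r. deriv (speed f a) r = b r * speed f a r)"
    (is "?L \<longleftrightarrow> ?R")
proof -
  let ?\<phi> = "cyl_isometric_form g \<omega> \<Omega> f a"
  have snd: "snd p \<in> coord_image C i" if "p \<in> coord_image (cyl_atlas C) i" for p i
    using that by (auto simp: cyl_atlas_simps)
  let ?Lie = "\<lambda>i p u v. lie_derivative (cyl_field b i) (cyl_metric g i) p [u, v] = 2 * c * cyl_metric g i p [u, v]"
  let ?Div = "\<lambda>i p w. divergence (cyl_metric g i) (torsion (?\<phi> i) (cyl_metric g i) (cyl_volume \<omega> i)) p w =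
     - (1 / 2) * curl (?\<phi> i) (cyl_metric g i) (cyl_field b i) p w +
     torsion (?\<phi> i) (cyl_metric g i) (cyl_volume \<omega> i) p [cyl_field b i p, w]"
  have lie: "?Lie i p u v \<longleftrightarrow> deriv b (fst p) * fst u * fst v = c * cyl_metric g i p [u, v]"
    if "p \<in> coord_image (cyl_atlas C) i" for i p u v
    by (simp add: lie_derivative_cyl[OF f a fa b snd[OF that]] mult.assoc)
  have div: "?Div i p w \<longleftrightarrow> deriv (speed f a) (fst p) * fst w = b (fst p) * speed f a (fst p) * fst w"
    if "p \<in> coord_image (cyl_atlas C) i" for i p w
    by (simp add: divergence_torsion[OF f a fa snd[OF that]] curl_cyl_field[OF f a fa b snd[OF that]]
        torsion_cyl[OF f a fa snd[OF that]] cyl_field_def mult_ac)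
  have "?L \<longleftrightarrow> (\<forall>i. \<forall>p\<in>coord_image (cyl_atlas C) i. (\<forall>u v. ?Lie i p u v) \<and> (\<forall>w. ?Div i p w))"
    using g2_structure_cyl[OF f a fa] vector_field_cyl_field[OF atlas_C b] by (simp add: isometric_soliton_def)
  also have "\<dots> \<longleftrightarrow> ?R"
  proof
    assume L: "\<forall>i. \<forall>p\<in>coord_image (cyl_atlas C) i. (\<forall>u v. ?Lie i p u v) \<and> (\<forall>w. ?Div i p w)"
    \<comment> \<open>The underlying set is a whole type, hence nonempty: some chart contains a
      point at which the equations can be tested, for every \<open>r\<close>.\<close>
    obtain i m where "m \<in> fst (C i)" using atlasD(5)[OF atlas_C] by blast
    then obtain x where x: "x \<in> coord_image C i" by (auto simp: coord_image_def)
    then have p: "(r, x) \<in> coord_image (cyl_atlas C) i" for r by (simp add: cyl_atlas_simps)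
    obtain v where v: "g i x [v, v] = 1"
      using inner_form.unit_orthogonal_exists[OF metric_chart.inner_g[OF metric_chart x], of "{}"] by auto
    have 1: "(\<forall>u v. ?Lie i (r, x) u v) \<and> (\<forall>w. ?Div i (r, x) w)" for r
      using L[rule_format, OF p] by simp
    have "c = 0"
      using lie[OF p, THEN iffD1, OF 1[THEN conjunct1, rule_format, of 0 "(0, v)" "(0, v)"]] v
      by (simp add: cyl_metric_def pullback_N_def)
    moreover have "deriv b r = 0" for r
      using lie[OF p, THEN iffD1, OF 1[THEN conjunct1, rule_format, of r "(1, 0)" "(1, 0)"]] \<open>c = 0\<close> by simp
    moreover have "deriv (speed f a) r = b r * speed f a r" for r
      using div[OF p, THEN iffD1, OF 1[THEN conjunct2, rule_format, of r "(1, 0)"]] by simp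
    ultimately show ?R by blast
  next
    assume ?R
    then show "\<forall>i. \<forall>p\<in>coord_image (cyl_atlas C) i. (\<forall>u v. ?Lie i p u v) \<and> (\<forall>w. ?Div i p w)"
      using lie[THEN iffD2] div[THEN iffD2] by (intro allI ballI conjI) simp_all
  qed
  finally show ?thesis .
qed

text \<open>All charts around a point give the same value, as it depends on the first coordinate
  only; the definite description in \<open>scalar_at\<close> is therefore met.\<close>

lemma torsion_norm_cyl:
  assumes f: "smooth_on UNIV f" and a: "smooth_on UNIV a" and fa: "\<And>r. (f r)\<^sup>2 = 1 - (a r)\<^sup>2"
  shows "torsion_norm (cyl_atlas C) (cyl_metric g) (cyl_volume \<omega>) (cyl_isometric_form g \<omega> \<Omega> f a) m =
    2 * \<bar>speed f a (fst m)\<bar>"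
proof -
  let ?h = "\<lambda>i x. tensor_norm2 (cyl_metric g i x)
     (torsion (cyl_isometric_form g \<omega> \<Omega> f a i) (cyl_metric g i) (cyl_volume \<omega> i) x)"
  have h: "?h i (snd (cyl_atlas C i) m) = 2 * \<bar>speed f a (fst m)\<bar>" if "m \<in> fst (cyl_atlas C i)" for i
  proof -
    have "snd m \<in> fst (C i)" using that by (auto simp: cyl_atlas_simps)
    then have "snd (snd (cyl_atlas C i) m) \<in> coord_image C i" "fst (snd (cyl_atlas C i) m) = fst m"
      by (simp_all add: cyl_atlas_def coord_image_def)
    then show ?thesis using tensor_norm2_torsion[OF f a fa] by simp
  qed
  obtain i where "snd m \<in> fst (C i)" using atlasD(5)[OF atlas_C] by blast
  then have "m \<in> fst (cyl_atlas C i)" by (simp add: cyl_atlas_simps mem_Times_iff)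
  then show ?thesis
    unfolding torsion_norm_def scalar_at_def by (intro the_equality) (use h in blast, metis h)
qed

end


subsection \<open>The ordinary differential equation for the phase\<close>

lemma k_smooth_on_SucI_real:
  fixes f :: "real \<Rightarrow> real"
  assumes "\<And>r. (f has_real_derivative f' r) (at r)" "k_smooth_on k UNIV f'"
  shows "k_smooth_on (Suc k) UNIV f"
  by (rule k_smooth_on_SucI[OF open_UNIV assms(1)[unfolded has_field_derivative_def]])
     (intro k_smooth_on_mult k_smooth_on_const assms(2) open_UNIV)

lemma smooth_on_sin_exp: "smooth_on UNIV (\<lambda>r::real. sin (c0 + c1 * exp (b0 * r)))"
proof -
  have e: "k_smooth_on k UNIV (\<lambda>r. c * exp (b0 * r))" for k and c :: real
  proof (induction k arbitrary: c)
    case 0 show ?case by (auto intro!: continuous_intros)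
  next
    case (Suc k)
    show ?case
      by (rule k_smooth_on_SucI_real[of _ "\<lambda>r. (c * b0) * exp (b0 * r)"])
         (auto intro!: derivative_eq_intros Suc.IH[of "c * b0"])
  qed
  \<comment> \<open>Sine and cosine are treated together, since the derivative of each involves the
    other.\<close>
  have "k_smooth_on k UNIV (\<lambda>r. sin (c0 + c1 * exp (b0 * r))) \<and> k_smooth_on k UNIV (\<lambda>r. cos (c0 + c1 * exp (b0 * r)))" for k
  proof (induction k)
    case 0 show ?case by (auto intro!: continuous_intros)
  next
    case (Suc k)
    have 1: "k_smooth_on k UNIV (\<lambda>r. cos (c0 + c1 * exp (b0 * r)) * ((c1 * b0) * exp (b0 * r)))"
      and 2: "k_smooth_on k UNIV (\<lambda>r. sin (c0 + c1 * exp (b0 * r)) * ((- c1 * b0) * exp (b0 * r)))"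
      by (rule k_smooth_on_mult[OF open_UNIV conjunct2[OF Suc.IH] e] k_smooth_on_mult[OF open_UNIV conjunct1[OF Suc.IH] e])+
    show ?case
      by (intro conjI k_smooth_on_SucI_real[OF _ 1] k_smooth_on_SucI_real[OF _ 2])
         (auto intro!: derivative_eq_intros)
  qed
  then show ?thesis by (simp add: smooth_on_def)
qed

text \<open>The sign of \<open>f\<close> is not determined by \<open>a\<close>. At the zeros of \<open>f\<close> both \<open>f\<^sup>2\<close> and \<open>cos\<^sup>2 \<theta>\<close>
  have the same second-order behaviour.\<close>

lemma speed_square:
  assumes f: "smooth_on UNIV f" and a: "smooth_on UNIV a" and fa: "\<And>r. (f r)\<^sup>2 = 1 - (a r)\<^sup>2"
    and \<theta>: "(\<theta> has_real_derivative d) (at r)" and sin: "\<And>r. a r = sin (\<theta> r)"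
  shows "(speed f a r)\<^sup>2 = d\<^sup>2"
proof -
  have cos: "(f s)\<^sup>2 = (cos (\<theta> s))\<^sup>2" for s using fa[of s] by (simp add: sin cos_squared_eq)
  show ?thesis
  proof (cases "f r = 0")
    case False
    have "a = (\<lambda>s. sin (\<theta> s))" using sin by auto
    then have "(a has_real_derivative cos (\<theta> r) * d) (at r)"
      using \<theta> by (auto intro!: derivative_eq_intros)
    then have "f r * speed f a r = cos (\<theta> r) * d"
      using DERIV_unique[OF _ smooth_on_DERIV[OF a]] speed_unit(2)[OF f a fa] by metis
    then have "(f r)\<^sup>2 * (speed f a r)\<^sup>2 = (f r)\<^sup>2 * d\<^sup>2"
      unfolding cos by (metis cos power_mult_distrib)
    then show ?thesis using False by simp
  next
    case True
    then have c0: "cos (\<theta> r) = 0" using cos[of r] by simp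
    have a2: "(a r)\<^sup>2 = 1" using fa[of r] True by simp
    \<comment> \<open>As \<open>f\<close> and the cosine both vanish at \<open>r\<close>, their
      squared difference quotients are \<open>f^2 / h^2\<close> and \<open>cos^2 / h^2\<close>.
      These agree for every \<open>h\<close>, so their limits, the squares of the derivatives, agree
      as well.\<close>
    have "((\<lambda>s. cos (\<theta> s)) has_real_derivative - sin (\<theta> r) * d) (at r)"
      using \<theta> by (auto intro!: derivative_eq_intros)
    then have "((\<lambda>h. (cos (\<theta> (r + h)) / h)\<^sup>2) \<longlongrightarrow> (- sin (\<theta> r) * d)\<^sup>2) (at 0)"
      unfolding DERIV_def c0 by (intro tendsto_power) simp
    moreover have "((\<lambda>h. (f (r + h) / h)\<^sup>2) \<longlongrightarrow> (deriv f r)\<^sup>2) (at 0)"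
      using smooth_on_DERIV[OF f, of r] unfolding DERIV_def True by (intro tendsto_power) simp
    moreover have "(f (r + h) / h)\<^sup>2 = (cos (\<theta> (r + h)) / h)\<^sup>2" for h by (simp add: power_divide cos)
    ultimately have "(deriv f r)\<^sup>2 = (- sin (\<theta> r) * d)\<^sup>2" using LIM_unique by simp
    then have "(a r)\<^sup>2 * (speed f a r)\<^sup>2 = (a r)\<^sup>2 * d\<^sup>2"
      unfolding speed_unit(1)[OF f a fa] sin by (simp add: power_mult_distrib)
    then show ?thesis using a2 by simp
  qed
qed

text \<open>Only the square of the speed is known. After dividing out the exponential the square is
  constant, so \<open>h h' = 0\<close>; for \<open>d\<close> nonzero \<open>h\<close> has no zeros,
  whence \<open>h' = 0\<close>. This settles the sign question without tracking signs.\<close>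

lemma speed_exponential:
  assumes f: "smooth_on UNIV f" and a: "smooth_on UNIV a" and fa: "\<And>r. (f r)\<^sup>2 = 1 - (a r)\<^sup>2"
    and \<theta>: "\<And>r. (\<theta> has_real_derivative d * exp (b0 * r)) (at r)" and sin: "\<And>r. a r = sin (\<theta> r)"
  shows "deriv (speed f a) r = b0 * speed f a r"
proof -
  let ?\<kappa> = "speed f a"
  define h where "h r = ?\<kappa> r * exp (- b0 * r)" for r
  have \<kappa>: "(?\<kappa> r)\<^sup>2 = (d * exp (b0 * r))\<^sup>2" for r by (rule speed_square[OF f a fa \<theta> sin])
  have "(h r)\<^sup>2 = d\<^sup>2" for r
    by (simp add: h_def power_mult_distrib \<kappa>) (simp add: exp_minus power_inverse field_simps)
  then have h2: "(\<lambda>r. (h r)\<^sup>2) = (\<lambda>r. d\<^sup>2)" by auto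
  have D: "(h has_real_derivative (deriv ?\<kappa> r - b0 * ?\<kappa> r) * exp (- b0 * r)) (at r)"
    unfolding h_def[abs_def]
    by (auto intro!: derivative_eq_intros smooth_on_DERIV smooth_on_speed f a simp: algebra_simps)
  then have "((\<lambda>r. (h r)\<^sup>2) has_real_derivative 2 * h r * ((deriv ?\<kappa> r - b0 * ?\<kappa> r) * exp (- b0 * r))) (at r)"
    by (auto intro!: derivative_eq_intros)
  then have "2 * h r * ((deriv ?\<kappa> r - b0 * ?\<kappa> r) * exp (- b0 * r)) = 0"
    unfolding h2 using DERIV_unique DERIV_const by blast
  moreover have "d = 0 \<Longrightarrow> ?\<kappa> = (\<lambda>r. 0)" using \<kappa> by auto
  moreover have "d \<noteq> 0 \<Longrightarrow> h r \<noteq> 0" using fun_cong[OF h2, of r] by auto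
  ultimately show ?thesis by (cases "d = 0") auto
qed

text \<open>\<open>?E\<close> is the inner product of the unit vectors \<open>(f, a)\<close> and
  \<open>(cos \<theta>, sin \<theta>)\<close>. Both rotate at the same speed, so it stays 1, and
  unit vectors with inner product 1 coincide.\<close>

lemma unit_circle_lift:
  assumes f: "smooth_on UNIV f" and a: "smooth_on UNIV a" and fa: "\<And>r. (f r)\<^sup>2 = 1 - (a r)\<^sup>2"
    and \<theta>: "\<And>r. (\<theta> has_real_derivative speed f a r) (at r)" and 0: "f 0 = cos (\<theta> 0)" "a 0 = sin (\<theta> 0)"
  shows "a r = sin (\<theta> r)"
proof -
  let ?E = "\<lambda>r. f r * cos (\<theta> r) + a r * sin (\<theta> r)"
  have "(?E has_real_derivative 0) (at r)" for r
    by (rule derivative_eq_intros smooth_on_DERIV[OF f] smooth_on_DERIV[OF a] \<theta> refl)+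
       (simp add: speed_unit[OF f a fa] algebra_simps)
  then have "?E r = ?E 0" using DERIV_isconst_all by blast
  also have "\<dots> = 1" unfolding 0 using sin_cos_squared_add3[of "\<theta> 0"] by simp
  finally have "(f r - cos (\<theta> r))\<^sup>2 + (a r - sin (\<theta> r))\<^sup>2 = 0"
    using fa[of r] sin_cos_squared_add[of "\<theta> r"] by (simp add: power2_diff algebra_simps)
  then show ?thesis by (simp add: sum_power2_eq_zero_iff)
qed

text \<open>Forward, the integrating factor \<open>exp (- b0 * r)\<close> makes the speed a pure
  exponential, which is integrated to an angle and compared with \<open>(f, a)\<close>. Its
  primitive is affine for \<open>b0 = 0\<close>, which is where the second alternative
  originates.\<close>

lemma phase_ode_iff:
  assumes f: "smooth_on UNIV f" and a: "smooth_on UNIV a" and fa: "\<And>r. (f r)\<^sup>2 = 1 - (a r)\<^sup>2"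
    and b: "smooth_on UNIV b"
  shows "(\<forall>r. deriv b r = 0) \<and> (\<forall>r. deriv (speed f a) r = b r * speed f a r) \<longleftrightarrow>
    (\<exists>b0 c0 c1. b = (\<lambda>r. b0) \<and> (a = (\<lambda>r. sin (c0 + c1 * exp (b0 * r))) \<or> b0 = 0 \<and> a = (\<lambda>r. sin (c0 + c1 * r))))"
    (is "?L \<longleftrightarrow> ?R")
proof
  assume L: ?L
  define b0 where "b0 = b 0"
  define k where "k = speed f a 0"
  have "(b has_real_derivative 0) (at r)" for r using smooth_on_DERIV[OF b, of r] L by simp
  then have b0: "b = (\<lambda>r. b0)" unfolding b0_def using DERIV_isconst_all by blast
  have "((\<lambda>r. speed f a r * exp (- b0 * r)) has_real_derivative 0) (at r)" for r
    by (rule derivative_eq_intros smooth_on_DERIV[OF smooth_on_speed[OF f a]] refl)+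
       (use L b0 in \<open>simp add: algebra_simps\<close>)
  then have h: "speed f a r * exp (- b0 * r) = speed f a 0 * exp (- b0 * 0)" for r
    using DERIV_isconst_all by blast
  have \<kappa>: "speed f a r = k * exp (b0 * r)" for r
  proof -
    have "speed f a r = speed f a r * exp (- b0 * r) * exp (b0 * r)"
      by (simp add: mult.assoc flip: exp_add)
    then show ?thesis unfolding h[of r] by (simp add: k_def)
  qed
  have "(f 0)\<^sup>2 + (a 0)\<^sup>2 = 1" using fa[of 0] by simp
  then obtain t where t: "f 0 = cos t" "a 0 = sin t" using sincos_total_2pi by metis
  show ?R
  proof (cases "b0 = 0")
    case True
    have "a r = sin (t + k * r)" for r
    proof (rule unit_circle_lift[OF f a fa])
      show "((\<lambda>r. t + k * r) has_real_derivative speed f a r) (at r)" for r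
        by (auto intro!: derivative_eq_intros simp: \<kappa> True)
    qed (use t in auto)
    then show ?thesis using b0 True by blast
  next
    case False
    \<comment> \<open>This is the primitive of \<open>k * exp (b0 * r)\<close> whose value at 0 is
      the initial angle \<open>t\<close>.\<close>
    have "a r = sin ((t - k / b0) + k / b0 * exp (b0 * r))" for r
    proof (rule unit_circle_lift[OF f a fa])
      show "((\<lambda>r. (t - k / b0) + k / b0 * exp (b0 * r)) has_real_derivative speed f a r) (at r)" for r
        using False by (auto intro!: derivative_eq_intros simp: \<kappa>)
    qed (use t in auto)
    then show ?thesis using b0 by blast
  qed
next
  assume ?R
  then obtain b0 c0 c1 where b0: "b = (\<lambda>r. b0)"
    and "a = (\<lambda>r. sin (c0 + c1 * exp (b0 * r))) \<or> b0 = 0 \<and> a = (\<lambda>r. sin (c0 + c1 * r))" by blast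
  then have "deriv (speed f a) r = b0 * speed f a r" for r
  proof (elim disjE conjE)
    assume sin: "a = (\<lambda>r. sin (c0 + c1 * exp (b0 * r)))"
    show ?thesis
      by (rule speed_exponential[OF f a fa, of "\<lambda>r. c0 + c1 * exp (b0 * r)" "c1 * b0"])
         (auto intro!: derivative_eq_intros simp: sin)
  next
    assume sin: "b0 = 0" "a = (\<lambda>r. sin (c0 + c1 * r))"
    show ?thesis
      by (rule speed_exponential[OF f a fa, of "\<lambda>r. c0 + c1 * r" c1])
         (auto intro!: derivative_eq_intros simp: sin)
  qed
  moreover have "deriv b r = 0" for r unfolding b0 by (rule DERIV_imp_deriv) simp
  ultimately show ?L using b0 by simp
qed

text \<open>The ends are expressed by \<open>filtercomap fst\<close>, so the limits are uniform in
  the point of the Calabi-Yau factor, and unboundedness is obtained in the stronger form of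
  divergence to infinity.\<close>

theorem theorem4p10:
  fixes C :: "'i \<Rightarrow> ('n::{t2_space,second_countable_topology}, real^6) chart"
    and g :: "('i, real^6, real) tensor"
    and J :: "'i \<Rightarrow> real^6 \<Rightarrow> real^6 \<Rightarrow> real^6"
    and \<omega> :: "('i, real^6, real) tensor"
    and \<Omega> :: "('i, real^6, complex) tensor"
  assumes "calabi_yau_3fold C g J \<omega> \<Omega>"
  shows "(\<forall>f a b c.
      smooth_on UNIV f \<and> smooth_on UNIV a \<and> smooth_on UNIV b \<and> (\<forall>r. (f r)\<^sup>2 = 1 - (a r)\<^sup>2) \<longrightarrow>
      (isometric_soliton (cyl_atlas C) (cyl_metric g) (cyl_volume \<omega>)
         (cyl_isometric_form g \<omega> \<Omega> f a) (cyl_field b) c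
       \<longleftrightarrow>
       c = 0 \<and>
       (\<exists>b0 c0 c1. b = (\<lambda>r. b0) \<and>
          (a = (\<lambda>r. sin (c0 + c1 * exp (b0 * r))) \<or>
           b0 = 0 \<and> a = (\<lambda>r. sin (c0 + c1 * r))))))
    \<and>
    (\<forall>f b0 c0 c1.
      smooth_on UNIV f \<and> (\<forall>r. (f r)\<^sup>2 = 1 - (sin (c0 + c1 * exp (b0 * r)))\<^sup>2) \<and> b0 \<noteq> 0 \<and> c1 \<noteq> 0 \<longrightarrow>
      (\<exists>(E0, E1) \<in> {(at_bot, at_top), (at_top, at_bot)}.
         (torsion_norm (cyl_atlas C) (cyl_metric g) (cyl_volume \<omega>)
            (cyl_isometric_form g \<omega> \<Omega> f (\<lambda>r. sin (c0 + c1 * exp (b0 * r))))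
          \<longlongrightarrow> 0) (filtercomap fst E0) \<and>
         filterlim
           (torsion_norm (cyl_atlas C) (cyl_metric g) (cyl_volume \<omega>)
            (cyl_isometric_form g \<omega> \<Omega> f (\<lambda>r. sin (c0 + c1 * exp (b0 * r)))))
           at_top (filtercomap fst E1)))"
proof (intro conjI allI impI; elim conjE)
  interpret calabi_yau C g J \<omega> \<Omega> by standard (rule assms)
  fix f a b :: "real \<Rightarrow> real" and c :: real
  assume fab: "smooth_on UNIV f" "smooth_on UNIV a" "smooth_on UNIV b" and "\<forall>r. (f r)\<^sup>2 = 1 - (a r)\<^sup>2"
  then have fa: "(f r)\<^sup>2 = 1 - (a r)\<^sup>2" for r by simp
  show "isometric_soliton (cyl_atlas C) (cyl_metric g) (cyl_volume \<omega>) (cyl_isometric_form g \<omega> \<Omega> f a) (cyl_field b) c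
      \<longleftrightarrow> c = 0 \<and> (\<exists>b0 c0 c1. b = (\<lambda>r. b0) \<and> (a = (\<lambda>r. sin (c0 + c1 * exp (b0 * r))) \<or> b0 = 0 \<and> a = (\<lambda>r. sin (c0 + c1 * r))))"
    unfolding isometric_soliton_iff[OF fab(1,2) fa fab(3)] phase_ode_iff[OF fab(1,2) fa fab(3)] ..
next
  interpret calabi_yau C g J \<omega> \<Omega> by standard (rule assms)
  fix f :: "real \<Rightarrow> real" and b0 c0 c1 :: real
  let ?a = "\<lambda>r. sin (c0 + c1 * exp (b0 * r))"
  assume f: "smooth_on UNIV f" and "\<forall>r. (f r)\<^sup>2 = 1 - (?a r)\<^sup>2" and nz: "b0 \<noteq> 0" "c1 \<noteq> 0"
  then have fa: "(f r)\<^sup>2 = 1 - (?a r)\<^sup>2" for r by simp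
  let ?T = "torsion_norm (cyl_atlas C) (cyl_metric g) (cyl_volume \<omega>) (cyl_isometric_form g \<omega> \<Omega> f ?a)"
  define K where "K = 2 * \<bar>c1 * b0\<bar>"
  have K: "K > 0" using nz by (simp add: K_def)
  have "(speed f ?a r)\<^sup>2 = (c1 * b0 * exp (b0 * r))\<^sup>2" for r
    by (rule speed_square[OF f smooth_on_sin_exp fa, of "\<lambda>r. c0 + c1 * exp (b0 * r)"])
       (auto intro!: derivative_eq_intros)
  then have "\<bar>speed f ?a r\<bar> = \<bar>c1 * b0\<bar> * exp (b0 * r)" for r
    by (metis abs_exp_cancel abs_mult real_sqrt_abs)
  then have T: "?T = (\<lambda>m. K * exp (b0 * fst m))"
    using torsion_norm_cyl[OF f smooth_on_sin_exp fa] by (auto simp: K_def)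
  \<comment> \<open>Stated for arbitrary filters because the sign of \<open>b0\<close> decides which
    end is which.\<close>
  have lim: "(?T \<longlongrightarrow> 0) (filtercomap fst E0) \<and> filterlim ?T at_top (filtercomap fst E1)"
    if "filterlim (\<lambda>r. b0 * r) at_bot E0" "filterlim (\<lambda>r. b0 * r) at_top E1" for E0 E1
  proof
    have "((\<lambda>r. K * exp (b0 * r)) \<longlongrightarrow> K * 0) E0"
      by (intro tendsto_mult tendsto_const filterlim_compose[OF exp_at_bot that(1)])
    from filterlim_compose[OF this filterlim_filtercomap] show "(?T \<longlongrightarrow> 0) (filtercomap fst E0)"
      unfolding T by simp
    have "filterlim (\<lambda>r. K * exp (b0 * r)) at_top E1"
      by (rule filterlim_tendsto_pos_mult_at_top[OF tendsto_const K filterlim_compose[OF exp_at_top that(2)]])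
    from filterlim_compose[OF this filterlim_filtercomap] show "filterlim ?T at_top (filtercomap fst E1)"
      unfolding T .
  qed
  show "\<exists>(E0, E1) \<in> {(at_bot, at_top), (at_top, at_bot)}.
      (?T \<longlongrightarrow> 0) (filtercomap fst E0) \<and> filterlim ?T at_top (filtercomap fst E1)"
  proof (cases "b0 > 0")
    case True
    have "filterlim (\<lambda>r. b0 * r) at_bot at_bot" "filterlim (\<lambda>r. b0 * r) at_top at_top"
      by (rule filterlim_tendsto_pos_mult_at_bot[OF tendsto_const True filterlim_ident]
        filterlim_tendsto_pos_mult_at_top[OF tendsto_const True filterlim_ident])+
    from lim[OF this] show ?thesis by simp
  next
    case False
    then have "b0 < 0" using nz by simp
    then have "filterlim (\<lambda>r. b0 * r) at_bot at_top"
      by (rule filterlim_tendsto_neg_mult_at_bot[OF tendsto_const _ filterlim_ident])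
    moreover have "filterlim (\<lambda>r. - b0 * r) at_bot at_bot"
      by (rule filterlim_tendsto_pos_mult_at_bot[OF tendsto_const _ filterlim_ident]) (use \<open>b0 < 0\<close> in simp)
    then have "filterlim (\<lambda>r. b0 * r) at_top at_bot" by (simp add: filterlim_uminus_at_top)
    ultimately show ?thesis using lim by simp
  qed
qed

end
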